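(* Let $M$ be a closed orientable 3-manifold and let $\xi$ be a transversally orientable contact structure on $M$. For any smooth strictly negative function $f : M \to \mathbb{R}$ there is a Riemannian metric on $M$ such that $f$ is the sectional curvature of $\xi$, i.e. $K(\xi) = f$ on $M$.
   Context: A (plane) distribution on a 3-manifold $M$ is a rank-two smooth subbundle $\xi$ of $TM$. It is a contact structure if for any linearly independent (local) sections $S, T$ of $\xi$ and any point $p$ the Lie bracket $[S,T]$ at $p$ does not belong to $\xi_p$. It is transversally orientable (transversally oriented) if there is a globally defined 1-form $\alpha$ with $\xi = \ker \alpha$; equivalently, if there is a globally defined vector field transverse to $\xi$. For a transversally orientable $\xi=\ker\alpha$, being contact is equivalent to $\alpha\wedge d\alpha \neq 0$ everywhere. Given a Riemannian metric on $M$, the sectional curvature of $\xi$ is the function $K(\xi)$ on $M$ assigning to $p \in M$ the sectional curvature of the plane $\xi_p \subset T_pM$. *)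

theory Defs
  imports "HOL-Analysis.Analysis"
begin

text \<open>\<open>C_k\<close> is meant for open sets \<open>S\<close> only. Requiring all directional derivatives to be again
  of class \<open>k\<close>, down to continuity, makes \<open>smooth_on\<close> the usual class of infinitely
  differentiable maps.\<close>

primrec C_k :: "nat \<Rightarrow> 'e::euclidean_space set \<Rightarrow> ('e \<Rightarrow> 'b::real_normed_vector) \<Rightarrow> bool" where
  "C_k 0 S f \<longleftrightarrow> continuous_on S f"
| "C_k (Suc k) S f \<longleftrightarrow> (\<forall>x\<in>S. f differentiable (at x)) \<and>
     (\<forall>v. C_k k S (\<lambda>x. frechet_derivative f (at x) v))"

definition smooth_on :: "'e::euclidean_space set \<Rightarrow> ('e \<Rightarrow> 'b::real_normed_vector) \<Rightarrow> bool" where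
  "smooth_on S f \<longleftrightarrow> (\<forall>k. C_k k S f)"

text \<open>A chart is a pair of a domain and a coordinate map; only the values of the coordinate map
  on the domain are meaningful.\<close>

type_synonym 'a chart = "'a set \<times> ('a \<Rightarrow> real^3)"

definition chart_inv :: "'a chart \<Rightarrow> real^3 \<Rightarrow> 'a" where
  "chart_inv c = inv_into (fst c) (snd c)"

definition transition :: "'a chart \<Rightarrow> 'a chart \<Rightarrow> real^3 \<Rightarrow> real^3" where
  "transition c d = snd d \<circ> chart_inv c"

definition is_chart :: "'a topology \<Rightarrow> 'a chart \<Rightarrow> bool" where
  "is_chart M c \<longleftrightarrow> openin M (fst c) \<and> open (snd c ` fst c) \<and>
     homeomorphic_map (subtopology M (fst c)) (top_of_set (snd c ` fst c)) (snd c)"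

definition smooth_atlas :: "'a topology \<Rightarrow> 'a chart set \<Rightarrow> bool" where
  "smooth_atlas M A \<longleftrightarrow>
     (\<forall>c\<in>A. is_chart M c) \<and> (\<Union>c\<in>A. fst c) = topspace M \<and>
     (\<forall>c\<in>A. \<forall>d\<in>A. smooth_on (snd c ` (fst c \<inter> fst d)) (transition c d))"

definition smooth_3_manifold :: "'a topology \<Rightarrow> 'a chart set \<Rightarrow> bool" where
  "smooth_3_manifold M A \<longleftrightarrow> Hausdorff_space M \<and> second_countable M \<and> smooth_atlas M A"

text \<open>The model space of the charts has no boundary, so closed just means compact.\<close>

definition closed_3_manifold :: "'a topology \<Rightarrow> 'a chart set \<Rightarrow> bool" where
  "closed_3_manifold M A \<longleftrightarrow> smooth_3_manifold M A \<and> compact_space M"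

definition orientable :: "'a topology \<Rightarrow> 'a chart set \<Rightarrow> bool" where
  "orientable M A \<longleftrightarrow>
     (\<exists>B. smooth_atlas M B \<and> smooth_atlas M (A \<union> B) \<and>
        (\<forall>c\<in>B. \<forall>d\<in>B. \<forall>p\<in>fst c \<inter> fst d.
           det (matrix (frechet_derivative (transition c d) (at (snd c p)))) > 0))"

definition smooth_function :: "'a chart set \<Rightarrow> ('a \<Rightarrow> real) \<Rightarrow> bool" where
  "smooth_function A f \<longleftrightarrow> (\<forall>c\<in>A. smooth_on (snd c ` fst c) (f \<circ> chart_inv c))"

text \<open>A tangent vector at \<open>p\<close> is the family of its coordinate vectors in all charts of the atlas
  around \<open>p\<close>, related by the differentials of the transition maps. The entries at all other
  charts carry no information and are set to zero.\<close>

type_synonym 'a tvec = "'a chart \<Rightarrow> real^3"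

definition charts_at :: "'a chart set \<Rightarrow> 'a \<Rightarrow> 'a chart set" where
  "charts_at A p = {c \<in> A. p \<in> fst c}"

definition tangent_space :: "'a chart set \<Rightarrow> 'a \<Rightarrow> 'a tvec set" where
  "tangent_space A p = {v.
     (\<forall>c\<in>charts_at A p. \<forall>d\<in>charts_at A p.
        v d = frechet_derivative (transition c d) (at (snd c p)) (v c)) \<and>
     (\<forall>c. c \<notin> charts_at A p \<longrightarrow> v c = 0)}"

text \<open>The tangent vector at \<open>p\<close> whose coordinate vector in the chart \<open>c\<close> is \<open>u\<close>.\<close>

definition tvec_of :: "'a chart set \<Rightarrow> 'a chart \<Rightarrow> 'a \<Rightarrow> real^3 \<Rightarrow> 'a tvec" where
  "tvec_of A c p u = (\<lambda>d. if d \<in> charts_at A p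
     then frechet_derivative (transition c d) (at (snd c p)) u else 0)"

definition lincomb :: "real \<Rightarrow> 'a tvec \<Rightarrow> real \<Rightarrow> 'a tvec \<Rightarrow> 'a tvec" where
  "lincomb a u b v = (\<lambda>c. a *\<^sub>R u c + b *\<^sub>R v c)"

definition lin_indep :: "'a tvec \<Rightarrow> 'a tvec \<Rightarrow> bool" where
  "lin_indep u v \<longleftrightarrow> (\<forall>a b. lincomb a u b v = (\<lambda>c. 0) \<longrightarrow> a = 0 \<and> b = 0)"

definition plane_of :: "'a tvec \<Rightarrow> 'a tvec \<Rightarrow> 'a tvec set" where
  "plane_of u v = {lincomb a u b v |a b. True}"

type_synonym 'a vfield = "'a \<Rightarrow> 'a tvec"

definition vf_coord :: "'a vfield \<Rightarrow> 'a chart \<Rightarrow> real^3 \<Rightarrow> real^3" where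
  "vf_coord X c = (\<lambda>x. X (chart_inv c x) c)"

definition smooth_vfield_on :: "'a chart set \<Rightarrow> 'a set \<Rightarrow> 'a vfield \<Rightarrow> bool" where
  "smooth_vfield_on A U X \<longleftrightarrow> (\<forall>p\<in>U. X p \<in> tangent_space A p) \<and>
     (\<forall>c\<in>A. smooth_on (snd c ` (U \<inter> fst c)) (vf_coord X c))"

definition lie_bracket :: "'a chart set \<Rightarrow> 'a vfield \<Rightarrow> 'a vfield \<Rightarrow> 'a vfield" where
  "lie_bracket A X Y = (\<lambda>p c. if c \<in> charts_at A p
     then frechet_derivative (vf_coord Y c) (at (snd c p)) (X p c)
        - frechet_derivative (vf_coord X c) (at (snd c p)) (Y p c)
     else 0)"

type_synonym 'a distribution = "'a \<Rightarrow> 'a tvec set"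

definition plane_distribution :: "'a topology \<Rightarrow> 'a chart set \<Rightarrow> 'a distribution \<Rightarrow> bool" where
  "plane_distribution M A \<xi> \<longleftrightarrow>
     (\<forall>p\<in>topspace M. \<exists>U S T. openin M U \<and> p \<in> U \<and>
        smooth_vfield_on A U S \<and> smooth_vfield_on A U T \<and>
        (\<forall>q\<in>U. lin_indep (S q) (T q) \<and> \<xi> q = plane_of (S q) (T q)))"

definition section_on :: "'a chart set \<Rightarrow> 'a set \<Rightarrow> 'a distribution \<Rightarrow> 'a vfield \<Rightarrow> bool" where
  "section_on A U \<xi> S \<longleftrightarrow> smooth_vfield_on A U S \<and> (\<forall>q\<in>U. S q \<in> \<xi> q)"

definition contact_structure :: "'a topology \<Rightarrow> 'a chart set \<Rightarrow> 'a distribution \<Rightarrow> bool" where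
  "contact_structure M A \<xi> \<longleftrightarrow> plane_distribution M A \<xi> \<and>
     (\<forall>U S T. openin M U \<longrightarrow> section_on A U \<xi> S \<longrightarrow> section_on A U \<xi> T \<longrightarrow>
        (\<forall>q\<in>U. lin_indep (S q) (T q)) \<longrightarrow>
        (\<forall>p\<in>U. lie_bracket A S T p \<notin> \<xi> p))"

definition smooth_1_form :: "'a topology \<Rightarrow> 'a chart set \<Rightarrow> ('a \<Rightarrow> 'a tvec \<Rightarrow> real) \<Rightarrow> bool" where
  "smooth_1_form M A \<alpha> \<longleftrightarrow>
     (\<forall>p\<in>topspace M. \<forall>u\<in>tangent_space A p. \<forall>v\<in>tangent_space A p. \<forall>a b.
        \<alpha> p (lincomb a u b v) = a * \<alpha> p u + b * \<alpha> p v) \<and>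
     (\<forall>c\<in>A. \<forall>u. smooth_on (snd c ` fst c)
        (\<lambda>x. \<alpha> (chart_inv c x) (tvec_of A c (chart_inv c x) u)))"

definition transversally_orientable :: "'a topology \<Rightarrow> 'a chart set \<Rightarrow> 'a distribution \<Rightarrow> bool" where
  "transversally_orientable M A \<xi> \<longleftrightarrow>
     (\<exists>\<alpha>. smooth_1_form M A \<alpha> \<and>
        (\<forall>p\<in>topspace M. \<xi> p = {v \<in> tangent_space A p. \<alpha> p v = 0}))"

type_synonym 'a metric = "'a \<Rightarrow> 'a tvec \<Rightarrow> 'a tvec \<Rightarrow> real"

definition metric_coord ::
  "'a chart set \<Rightarrow> 'a metric \<Rightarrow> 'a chart \<Rightarrow> real^3 \<Rightarrow> real^3 \<Rightarrow> real^3 \<Rightarrow> real" where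
  "metric_coord A g c u v x =
     g (chart_inv c x) (tvec_of A c (chart_inv c x) u) (tvec_of A c (chart_inv c x) v)"

definition riemannian_metric :: "'a topology \<Rightarrow> 'a chart set \<Rightarrow> 'a metric \<Rightarrow> bool" where
  "riemannian_metric M A g \<longleftrightarrow>
     (\<forall>p\<in>topspace M. \<forall>u\<in>tangent_space A p. \<forall>v\<in>tangent_space A p.
        g p u v = g p v u \<and>
        (\<forall>w\<in>tangent_space A p. \<forall>a b. g p (lincomb a u b v) w = a * g p u w + b * g p v w)) \<and>
     (\<forall>p\<in>topspace M. \<forall>v\<in>tangent_space A p. v \<noteq> (\<lambda>c. 0) \<longrightarrow> g p v v > 0) \<and>
     (\<forall>c\<in>A. \<forall>u v. smooth_on (snd c ` fst c) (metric_coord A g c u v))"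

text \<open>The Christoffel symbols of the Levi-Civita connection in the chart \<open>c\<close>, as a bilinear map:
  for basis vectors, \<open>christoffel A g c x e\<^sub>i e\<^sub>j\<close> is the sum of the \<open>\<Gamma>\<^sub>i\<^sub>j\<^sup>k e\<^sub>k\<close> over \<open>k\<close>, and the
  defining equation reads
  \<open>g\<^sub>k\<^sub>l \<Gamma>\<^sub>i\<^sub>j\<^sup>k = (\<partial>\<^sub>i g\<^sub>j\<^sub>l + \<partial>\<^sub>j g\<^sub>i\<^sub>l - \<partial>\<^sub>l g\<^sub>i\<^sub>j) / 2\<close>.\<close>

definition christoffel ::
  "'a chart set \<Rightarrow> 'a metric \<Rightarrow> 'a chart \<Rightarrow> real^3 \<Rightarrow> real^3 \<Rightarrow> real^3 \<Rightarrow> real^3" where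
  "christoffel A g c x u v = (THE w. \<forall>z. metric_coord A g c w z x =
     (frechet_derivative (metric_coord A g c v z) (at x) u
    + frechet_derivative (metric_coord A g c u z) (at x) v
    - frechet_derivative (metric_coord A g c u v) (at x) z) / 2)"

definition cov_deriv :: "'a chart set \<Rightarrow> 'a metric \<Rightarrow> 'a vfield \<Rightarrow> 'a vfield \<Rightarrow> 'a vfield" where
  "cov_deriv A g X Y = (\<lambda>p c. if c \<in> charts_at A p
     then frechet_derivative (vf_coord Y c) (at (snd c p)) (X p c)
        + christoffel A g c (snd c p) (X p c) (Y p c)
     else 0)"

definition riemann_curvature ::
  "'a chart set \<Rightarrow> 'a metric \<Rightarrow> 'a vfield \<Rightarrow> 'a vfield \<Rightarrow> 'a vfield \<Rightarrow> 'a vfield" where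
  "riemann_curvature A g X Y Z = (\<lambda>p c.
       cov_deriv A g X (cov_deriv A g Y Z) p c
     - cov_deriv A g Y (cov_deriv A g X Z) p c
     - cov_deriv A g (lie_bracket A X Y) Z p c)"

text \<open>The quotient does not depend on the local fields \<open>X\<close>, \<open>Y\<close> extending a basis of the
  plane \<open>P\<close>, which is what makes the definite description meaningful.\<close>

definition sectional_curvature ::
  "'a topology \<Rightarrow> 'a chart set \<Rightarrow> 'a metric \<Rightarrow> 'a \<Rightarrow> 'a tvec set \<Rightarrow> real" where
  "sectional_curvature M A g p P = (THE k. \<forall>U X Y.
     openin M U \<longrightarrow> p \<in> U \<longrightarrow> smooth_vfield_on A U X \<longrightarrow> smooth_vfield_on A U Y \<longrightarrow>
     lin_indep (X p) (Y p) \<longrightarrow> plane_of (X p) (Y p) = P \<longrightarrow>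
     k = g p (riemann_curvature A g X Y Y p) (X p) /
         (g p (X p) (X p) * g p (Y p) (Y p) - (g p (X p) (Y p))\<^sup>2))"

definition distribution_curvature ::
  "'a topology \<Rightarrow> 'a chart set \<Rightarrow> 'a metric \<Rightarrow> 'a distribution \<Rightarrow> 'a \<Rightarrow> real" where
  "distribution_curvature M A g \<xi> p = sectional_curvature M A g p (\<xi> p)"

end

theory Submission
  imports Defs
begin

text \<open>
  Choose a vector field \<open>R\<close> with \<open>\<alpha> R = 1\<close> and a form \<open>h\<close> with kernel \<open>R\<close> that is positive definite on
  \<open>\<xi> = ker \<alpha>\<close>, and consider the metrics \<open>h + L \<alpha>\<^sup>2\<close> for positive functions \<open>L\<close>. By the Koszul formula
  the components \<open>g (\<nabla>\<^sub>X Y, Z)\<close> for sections \<open>X, Y, Z\<close> of \<open>\<xi>\<close> do not depend on \<open>L\<close>, and the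
  component of \<open>\<nabla>\<^sub>X Y\<close> along \<open>R\<close> involves \<open>L\<close> but none of its derivatives. Hence the curvature of
  \<open>\<xi>\<close> is \<open>P - C L + D / L\<close> pointwise, with functions \<open>P\<close>, \<open>C\<close>, \<open>D\<close> independent of \<open>L\<close>, and \<open>C > 0\<close> is
  a multiple of \<open>\<alpha> [X, Y]\<^sup>2\<close>, which is where the contact condition enters. Taking \<open>L = 1, 2, 3\<close>
  expresses \<open>P\<close>, \<open>C\<close>, \<open>D\<close> through curvatures, so that they are smooth on all of \<open>M\<close>. For a large constant \<open>s\<close>
  the equation \<open>P - C L + D / L = s f\<close> has a positive smooth solution, because \<open>f\<close> is negative and
  \<open>M\<close> is compact, and \<open>s (h + L \<alpha>\<^sup>2)\<close> is the metric sought.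
\<close>

section \<open>Smooth maps between Euclidean spaces\<close>

text \<open>L enters the metric multiplied by two values of \<alpha>, and this product vanishes
  identically as soon as one argument is a section of \<xi>. That is why no derivative of L survives
  and why prescribing the curvature is not a differential equation here but, at each point, the
  quadratic equation C L^2 - (P - t) L - D = 0, where t is the prescribed value. D has no definite
  sign, so for t = f a positive root may fail to exist. A constant factor s in the metric divides
  the curvature by s; hence t = s f can be prescribed instead, and it lies far below P and C D when
  s is large. P, C and D come from local frames of \<xi>, and only their existence at each point is
  proved. Since three curvatures determine them, they inherit smoothness from these without any
  comparison of frames. Much of the length is due to \<open>sectional_curvature\<close>, a definite
  description over all local extensions of all bases: it has a usable value only once the curvature
  is known to be tensorial, to be compatible with changes of charts, and to scale like the Gram
  determinant under a change of basis.\<close>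

lemma C_k_imp_continuous_on: "C_k k S f \<Longrightarrow> continuous_on S f"
  by (cases k) (auto simp: continuous_at_imp_continuous_on differentiable_imp_continuous_within)

lemma C_k_SucD: "C_k (Suc k) S f \<Longrightarrow> C_k k S f"
proof (induction k arbitrary: f)
  case 0
  then show ?case using C_k_imp_continuous_on by (metis C_k.simps(1))
next
  case (Suc k)
  then show ?case by auto
qed

lemma frechet_derivative_cong_open:
  fixes f g :: "'a::real_normed_vector \<Rightarrow> 'b::real_normed_vector"
  assumes "open S" "x \<in> S" "\<And>y. y \<in> S \<Longrightarrow> f y = g y"
  shows "frechet_derivative f (at x) = frechet_derivative g (at x)"
proof -
  have "(f has_derivative D) (at x) \<longleftrightarrow> (g has_derivative D) (at x)" for D
    using has_derivative_transform_within_open[OF _ assms(1,2), of f D UNIV g]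
      has_derivative_transform_within_open[OF _ assms(1,2), of g D UNIV f] assms(3) by auto
  then show ?thesis unfolding frechet_derivative_def by simp
qed

lemma differentiable_cong_open:
  fixes f g :: "'a::real_normed_vector \<Rightarrow> 'b::real_normed_vector"
  assumes "open S" "x \<in> S" "\<And>y. y \<in> S \<Longrightarrow> f y = g y" "f differentiable (at x)"
  shows "g differentiable (at x)"
  using assms has_derivative_transform_within_open[OF _ assms(1,2), of f _ UNIV g]
  unfolding differentiable_def by metis

lemma C_k_cong:
  assumes "open S" "\<And>x. x \<in> S \<Longrightarrow> f x = g x" "C_k k S f"
  shows "C_k k S g"
  using assms(2,3)
proof (induction k arbitrary: f g)
  case 0
  then show ?case by (metis C_k.simps(1) continuous_on_cong)
next
  case (Suc k)
  have "C_k k S (\<lambda>x. frechet_derivative g (at x) v)" for v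
  proof (rule Suc.IH)
    show "C_k k S (\<lambda>x. frechet_derivative f (at x) v)" using Suc.prems by simp
    show "frechet_derivative f (at x) v = frechet_derivative g (at x) v" if "x \<in> S" for x
      using frechet_derivative_cong_open[OF assms(1) that, of f g] Suc.prems by simp
  qed
  moreover have "g differentiable (at x)" if "x \<in> S" for x
    using differentiable_cong_open[OF assms(1) that, of f g] Suc.prems that by simp
  ultimately show ?case by simp
qed

lemma C_k_subset: "C_k k S f \<Longrightarrow> T \<subseteq> S \<Longrightarrow> C_k k T f"
  by (induction k arbitrary: f) (auto intro: continuous_on_subset)

lemma C_k_locally:
  assumes "\<And>x. x \<in> S \<Longrightarrow> \<exists>T. open T \<and> x \<in> T \<and> C_k k T f"
  shows "C_k k S f"
  using assms
proof (induction k arbitrary: f)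
  case 0
  have "isCont f x" if "x \<in> S" for x
    using 0[OF that] by (metis C_k.simps(1) continuous_on_eq_continuous_at)
  then show ?case by (simp add: continuous_at_imp_continuous_on)
next
  case (Suc k)
  have "C_k k S (\<lambda>x. frechet_derivative f (at x) v)" for v
    using Suc.prems by (intro Suc.IH) (metis C_k.simps(2))
  then show ?case using Suc.prems by (metis C_k.simps(2))
qed

text \<open>Accepts any family of maps known to be the derivative, so that inductions on the order
  can use explicit formulas in place of \<open>frechet_derivative\<close>.\<close>

lemma C_k_SucI:
  assumes "open S" "\<And>x. x \<in> S \<Longrightarrow> (f has_derivative f' x) (at x)"
    and "\<And>v. C_k k S (\<lambda>x. f' x v)"
  shows "C_k (Suc k) S f"
proof -
  have "C_k k S (\<lambda>x. frechet_derivative f (at x) v)" for v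
    by (rule C_k_cong[OF assms(1) _ assms(3)[of v]])
      (use assms(2) frechet_derivative_at in metis)
  then show ?thesis using assms(2) by (auto simp: differentiable_def)
qed

lemma C_k_SucE:
  assumes "C_k (Suc k) S f" "x \<in> S"
  shows "(f has_derivative frechet_derivative f (at x)) (at x)"
  using assms frechet_derivative_works by auto

lemma C_k_const: "open S \<Longrightarrow> C_k k S (\<lambda>x. c)"
  by (induction k arbitrary: c) (auto intro!: C_k_SucI[where f'="\<lambda>_ _. 0"] simp del: C_k.simps(2))

lemma C_k_bounded_linear: "bounded_linear f \<Longrightarrow> open S \<Longrightarrow> C_k k S f"
  by (cases k) (auto intro!: C_k_SucI[where f'="\<lambda>_. f"] C_k_const bounded_linear_imp_has_derivative
      linear_continuous_on simp del: C_k.simps(2))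

lemma C_k_add:
  assumes "open S"
  shows "C_k k S f \<Longrightarrow> C_k k S g \<Longrightarrow> C_k k S (\<lambda>x. f x + g x)"
proof (induction k arbitrary: f g)
  case (Suc k)
  show ?case
    by (rule C_k_SucI[OF assms has_derivative_add[OF C_k_SucE[OF Suc.prems(1)] C_k_SucE[OF Suc.prems(2)]]])
      (use Suc in auto)
qed (auto intro: continuous_on_add)

lemma (in bounded_bilinear) C_k:
  assumes "open S"
  shows "C_k k S f \<Longrightarrow> C_k k S g \<Longrightarrow> C_k k S (\<lambda>x. prod (f x) (g x))"
proof (induction k arbitrary: f g)
  case 0
  then show ?case using continuous_on by auto
next
  case (Suc k)
  show ?case
  proof (rule C_k_SucI[OF assms FDERIV[OF C_k_SucE[OF Suc.prems(1)] C_k_SucE[OF Suc.prems(2)]]])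
    show "C_k k S (\<lambda>x. prod (f x) (frechet_derivative g (at x) v) + prod (frechet_derivative f (at x) v) (g x))" for v
      by (intro C_k_add[OF assms] Suc.IH C_k_SucD[OF Suc.prems(1)] C_k_SucD[OF Suc.prems(2)])
        (use Suc.prems in auto)
  qed
qed

lemma C_k_sum:
  assumes "open S" "\<And>i. i \<in> I \<Longrightarrow> C_k k S (f i)"
  shows "C_k k S (\<lambda>x. \<Sum>i\<in>I. f i x)"
  using assms(2)
  by (induction I rule: infinite_finite_induct)
    (auto intro!: C_k_add[OF assms(1)] C_k_const[OF assms(1)])

lemma C_k_compose:
  fixes g :: "'e::euclidean_space \<Rightarrow> 'c::euclidean_space" and f :: "'c \<Rightarrow> 'b::real_normed_vector"
  assumes "open S" "open T" "\<And>x. x \<in> S \<Longrightarrow> g x \<in> T"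
  shows "C_k k S g \<Longrightarrow> C_k k T f \<Longrightarrow> C_k k S (\<lambda>x. f (g x))"
proof (induction k arbitrary: f)
  case 0
  then show ?case using continuous_on_compose2[of T f S g] assms(3) by auto
next
  case (Suc k)
  show ?case
  proof (rule C_k_SucI[OF assms(1)])
    show "((\<lambda>x. f (g x)) has_derivative (\<lambda>v. frechet_derivative f (at (g x)) (frechet_derivative g (at x) v))) (at x)"
      if "x \<in> S" for x
      using has_derivative_compose[OF C_k_SucE[OF Suc.prems(1) that] C_k_SucE[OF Suc.prems(2) assms(3)[OF that]]] .
    \<comment> \<open>\<open>C_k\<close> speaks of derivatives in fixed directions, whereas the
      chain rule applies the derivative of \<open>f\<close> to a direction that varies with
      \<open>x\<close>. Expansion in the basis leaves products of functions covered by the induction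
      hypothesis.\<close>
    have "C_k k S (\<lambda>x. \<Sum>b\<in>Basis. (frechet_derivative g (at x) v \<bullet> b) *\<^sub>R frechet_derivative f (at (g x)) b)" for v
    proof (intro C_k_sum assms(1) bounded_bilinear.C_k[OF bounded_bilinear_scaleR] 
        bounded_bilinear.C_k[OF bounded_bilinear_inner] C_k_const Suc.IH C_k_SucD[OF Suc.prems(1)])
      show "C_k k S (\<lambda>x. frechet_derivative g (at x) v)" using Suc.prems by simp
      show "C_k k T (\<lambda>y. frechet_derivative f (at y) b)" for b using Suc.prems by simp
    qed
    then show "C_k k S (\<lambda>x. frechet_derivative f (at (g x)) (frechet_derivative g (at x) v))" for v
    proof (rule C_k_cong[OF assms(1), rotated])
      fix x assume x: "x \<in> S"
      interpret linear "frechet_derivative f (at (g x))"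
        using C_k_SucE[OF Suc.prems(2) assms(3)[OF x]] has_derivative_linear by blast
      show "(\<Sum>b\<in>Basis. (frechet_derivative g (at x) v \<bullet> b) *\<^sub>R frechet_derivative f (at (g x)) b) = 
        frechet_derivative f (at (g x)) (frechet_derivative g (at x) v)"
        by (subst (2) euclidean_representation[symmetric]) (simp add: sum scaleR)
    qed
  qed
qed

lemma smooth_on_imp_continuous_on: "smooth_on S f \<Longrightarrow> continuous_on S f"
  unfolding smooth_on_def using C_k_imp_continuous_on by blast

lemma smooth_on_cong: "open S \<Longrightarrow> (\<And>x. x \<in> S \<Longrightarrow> f x = g x) \<Longrightarrow> smooth_on S f \<Longrightarrow> smooth_on S g"
  unfolding smooth_on_def using C_k_cong by blast

lemma smooth_on_subset: "smooth_on S f \<Longrightarrow> T \<subseteq> S \<Longrightarrow> smooth_on T f"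
  unfolding smooth_on_def using C_k_subset by blast

lemma smooth_on_locally:
  "(\<And>x. x \<in> S \<Longrightarrow> \<exists>T. open T \<and> x \<in> T \<and> smooth_on T f) \<Longrightarrow> smooth_on S f"
  unfolding smooth_on_def using C_k_locally by metis

lemma smooth_on_has_derivative:
  "smooth_on S f \<Longrightarrow> x \<in> S \<Longrightarrow> (f has_derivative frechet_derivative f (at x)) (at x)"
  unfolding smooth_on_def using C_k_SucE by blast

lemma smooth_on_linear_derivative:
  "smooth_on S f \<Longrightarrow> x \<in> S \<Longrightarrow> linear (frechet_derivative f (at x))"
  using smooth_on_has_derivative has_derivative_linear by blast

lemma smooth_on_derivative: "smooth_on S f \<Longrightarrow> smooth_on S (\<lambda>x. frechet_derivative f (at x) v)"
  unfolding smooth_on_def using C_k.simps(2) by blast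

lemma smooth_on_const: "open S \<Longrightarrow> smooth_on S (\<lambda>x. c)"
  unfolding smooth_on_def using C_k_const by blast

lemma smooth_on_bounded_linear: "bounded_linear f \<Longrightarrow> open S \<Longrightarrow> smooth_on S f"
  unfolding smooth_on_def using C_k_bounded_linear by blast

lemma smooth_on_add:
  "open S \<Longrightarrow> smooth_on S f \<Longrightarrow> smooth_on S g \<Longrightarrow> smooth_on S (\<lambda>x. f x + g x)"
  unfolding smooth_on_def using C_k_add by blast

lemma (in bounded_bilinear) smooth_on:
  "open S \<Longrightarrow> smooth_on S f \<Longrightarrow> smooth_on S g \<Longrightarrow> smooth_on S (\<lambda>x. prod (f x) (g x))"
  unfolding smooth_on_def using C_k by blast

lemmas smooth_on_scaleR = bounded_bilinear.smooth_on[OF bounded_bilinear_scaleR]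
  and smooth_on_inner = bounded_bilinear.smooth_on[OF bounded_bilinear_inner]

lemma smooth_on_mult:
  fixes f g :: "'e::euclidean_space \<Rightarrow> real"
  shows "open S \<Longrightarrow> smooth_on S f \<Longrightarrow> smooth_on S g \<Longrightarrow> smooth_on S (\<lambda>x. f x * g x)"
  by (rule bounded_bilinear.smooth_on[OF bounded_bilinear_mult])

lemma smooth_on_sum:
  "open S \<Longrightarrow> (\<And>i. i \<in> I \<Longrightarrow> smooth_on S (f i)) \<Longrightarrow> smooth_on S (\<lambda>x. \<Sum>i\<in>I. f i x)"
  unfolding smooth_on_def by (simp add: C_k_sum)

lemma smooth_on_compose:
  fixes g :: "'e::euclidean_space \<Rightarrow> 'c::euclidean_space" and f :: "'c \<Rightarrow> 'b::real_normed_vector"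
  assumes "open S" "open T" "\<And>x. x \<in> S \<Longrightarrow> g x \<in> T" "smooth_on S g" "smooth_on T f"
  shows "smooth_on S (\<lambda>x. f (g x))"
  using C_k_compose[OF assms(1,2), of g] assms(3-5) unfolding smooth_on_def by blast

lemma smooth_on_minus: "open S \<Longrightarrow> smooth_on S f \<Longrightarrow> smooth_on S (\<lambda>x. - f x)"
  using smooth_on_scaleR[OF _ smooth_on_const, of S f "-1"] by simp

lemma smooth_on_diff:
  "open S \<Longrightarrow> smooth_on S f \<Longrightarrow> smooth_on S g \<Longrightarrow> smooth_on S (\<lambda>x. f x - g x)"
  using smooth_on_add[OF _ _ smooth_on_minus, of S f g] by simp

text \<open>The derivative is a polynomial in \<open>inverse\<close> itself, so the order can be
  raised by induction.\<close>

lemma smooth_on_inverse_real: "smooth_on {x::real. x \<noteq> 0} inverse"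
proof -
  have o: "open {x::real. x \<noteq> 0}" by (simp add: open_Collect_neq)
  have "C_k k {x::real. x \<noteq> 0} inverse" for k
  proof (induction k)
    case (Suc k)
    show ?case
    proof (rule C_k_SucI[OF o])
      show "(inverse has_derivative (\<lambda>v. - (inverse x * v * inverse x))) (at x)" if "x \<in> {x::real. x \<noteq> 0}" for x
        using that by (intro has_derivative_inverse') auto
      have "C_k k {x::real. x \<noteq> 0} (\<lambda>x. (- v) * (inverse x * inverse x))" for v
        by (intro bounded_bilinear.C_k[OF bounded_bilinear_mult] Suc o C_k_const)
      then show "C_k k {x::real. x \<noteq> 0} (\<lambda>x. - (inverse x * v * inverse x))" for v
        by (rule C_k_cong[OF o, rotated]) simp
    qed
  qed (auto intro: continuous_on_inverse)
  then show ?thesis by (simp add: smooth_on_def)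
qed

lemma smooth_on_divide:
  fixes f g :: "'e::euclidean_space \<Rightarrow> real"
  assumes "open S" "smooth_on S f" "smooth_on S g" "\<And>x. x \<in> S \<Longrightarrow> g x \<noteq> 0"
  shows "smooth_on S (\<lambda>x. f x / g x)"
proof -
  have "smooth_on S (\<lambda>x. inverse (g x))"
    by (rule smooth_on_compose[OF assms(1) _ _ assms(3) smooth_on_inverse_real])
      (use assms(4) in \<open>auto simp: open_Collect_neq\<close>)
  from smooth_on_mult[OF assms(1,2) this] show ?thesis by (simp add: divide_inverse)
qed

lemma smooth_on_sqrt_real: "smooth_on {0<..} sqrt"
proof -
  have "C_k k {0<..} sqrt" for k
  proof (induction k)
    case (Suc k)
    show ?case
    proof (rule C_k_SucI)
      show "(sqrt has_derivative (\<lambda>v. inverse (sqrt x) / 2 * v)) (at x)" if "x \<in> {0<..}" for x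
        by (rule DERIV_real_sqrt[unfolded has_field_derivative_def]) (use that in simp)
      have "C_k k {0<..} (\<lambda>x. inverse (sqrt x))"
        by (rule C_k_compose[where T="{x. x \<noteq> 0}" and f=inverse, OF _ _ _ Suc])
          (use smooth_on_inverse_real in \<open>auto simp: open_Collect_neq smooth_on_def\<close>)
      then have "C_k k {0<..} (\<lambda>x. (v / 2) * inverse (sqrt x))" for v
        by (intro bounded_bilinear.C_k[OF bounded_bilinear_mult] C_k_const) auto
      then show "C_k k {0<..} (\<lambda>x. inverse (sqrt x) / 2 * v)" for v
        by (rule C_k_cong[rotated 2]) auto
    qed auto
  qed (auto intro: continuous_intros)
  then show ?thesis by (simp add: smooth_on_def)
qed

lemma smooth_on_sqrt:
  fixes f :: "'e::euclidean_space \<Rightarrow> real"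
  assumes "open S" "smooth_on S f" "\<And>x. x \<in> S \<Longrightarrow> f x > 0"
  shows "smooth_on S (\<lambda>x. sqrt (f x))"
  by (rule smooth_on_compose[OF assms(1) _ _ assms(2) smooth_on_sqrt_real]) (use assms(3) in auto)

section \<open>Second derivatives and bump functions\<close>

text \<open>The product rule for a linear map and a vector that both vary with the point. Smoothness
  of \<open>A\<close> is available for each fixed argument only, as for Jacobians, 1-forms and
  Christoffel symbols; expanding \<open>Y x\<close> in the basis reduces the claim to products with
  scalar functions.\<close>

lemma smooth_on_linear_coeff:
  fixes A :: "'e::euclidean_space \<Rightarrow> 'a::euclidean_space \<Rightarrow> 'b::real_normed_vector"
  assumes S: "open S" and lin: "\<And>x. x \<in> S \<Longrightarrow> linear (A x)"
    and A: "\<And>u. smooth_on S (\<lambda>x. A x u)" and Y: "smooth_on S Y"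
  shows "smooth_on S (\<lambda>x. A x (Y x))"
    and "x \<in> S \<Longrightarrow> frechet_derivative (\<lambda>x. A x (Y x)) (at x) w =
      frechet_derivative (\<lambda>y. A y (Y x)) (at x) w + A x (frechet_derivative Y (at x) w)"
proof -
  have eq: "(\<Sum>b\<in>Basis. (u \<bullet> b) *\<^sub>R A x b) = A x u" if "x \<in> S" for x u
  proof -
    interpret linear "A x" using lin that .
    show ?thesis by (subst (2) euclidean_representation[symmetric, of u]) (simp add: sum scaleR)
  qed
  have "smooth_on S (\<lambda>x. \<Sum>b\<in>Basis. (Y x \<bullet> b) *\<^sub>R A x b)"
    by (intro smooth_on_sum S smooth_on_scaleR smooth_on_inner smooth_on_const A Y)
  then show "smooth_on S (\<lambda>x. A x (Y x))"
    by (rule smooth_on_cong[OF S, rotated]) (simp add: eq)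
  assume x: "x \<in> S"
  note DY = smooth_on_has_derivative[OF Y x] and DA = smooth_on_has_derivative[OF A x]
  let ?DA = "\<lambda>u. frechet_derivative (\<lambda>y. A y u) (at x)"
  have "((\<lambda>x. \<Sum>b\<in>Basis. (Y x \<bullet> b) *\<^sub>R A x b) has_derivative
     (\<lambda>w. \<Sum>b\<in>Basis. (Y x \<bullet> b) *\<^sub>R ?DA b w + (frechet_derivative Y (at x) w \<bullet> b) *\<^sub>R A x b)) (at x)"
    by (intro has_derivative_sum has_derivative_scaleR has_derivative_inner_left DA DY)
  then have "((\<lambda>x. A x (Y x)) has_derivative
     (\<lambda>w. \<Sum>b\<in>Basis. (Y x \<bullet> b) *\<^sub>R ?DA b w + (frechet_derivative Y (at x) w \<bullet> b) *\<^sub>R A x b)) (at x)"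
    by (rule has_derivative_transform_within_open[OF _ S x]) (simp add: eq)
  from frechet_derivative_at[OF this, symmetric] 
  have 1: "frechet_derivative (\<lambda>x. A x (Y x)) (at x) w =
      (\<Sum>b\<in>Basis. (Y x \<bullet> b) *\<^sub>R ?DA b w) + A x (frechet_derivative Y (at x) w)"
    by (simp add: sum.distrib eq x)
  have "((\<lambda>y. \<Sum>b\<in>Basis. (Y x \<bullet> b) *\<^sub>R A y b) has_derivative
     (\<lambda>w. \<Sum>b\<in>Basis. (Y x \<bullet> b) *\<^sub>R ?DA b w)) (at x)"
    by (intro has_derivative_sum has_derivative_scaleR_right DA)
  then have "((\<lambda>y. A y (Y x)) has_derivative
     (\<lambda>w. \<Sum>b\<in>Basis. (Y x \<bullet> b) *\<^sub>R ?DA b w)) (at x)"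
    by (rule has_derivative_transform_within_open[OF _ S x]) (simp add: eq)
  from frechet_derivative_at[OF this, symmetric] 1
  show "frechet_derivative (\<lambda>x. A x (Y x)) (at x) w =
      frechet_derivative (\<lambda>y. A y (Y x)) (at x) w + A x (frechet_derivative Y (at x) w)" by simp
qed

lemma smooth_on_bilinear_coeff:
  fixes B :: "'e::euclidean_space \<Rightarrow> 'a::euclidean_space \<Rightarrow> 'c::euclidean_space \<Rightarrow> 'b::real_normed_vector"
  assumes S: "open S" and l: "\<And>x v. x \<in> S \<Longrightarrow> linear (\<lambda>u. B x u v)"
    and r: "\<And>x u. x \<in> S \<Longrightarrow> linear (B x u)"
    and B: "\<And>u v. smooth_on S (\<lambda>x. B x u v)" and Y: "smooth_on S Y" and Z: "smooth_on S Z"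
  shows "smooth_on S (\<lambda>x. B x (Y x) (Z x))"
    and "x \<in> S \<Longrightarrow> frechet_derivative (\<lambda>x. B x (Y x) (Z x)) (at x) w =
      frechet_derivative (\<lambda>y. B y (Y x) (Z x)) (at x) w
      + B x (frechet_derivative Y (at x) w) (Z x) + B x (Y x) (frechet_derivative Z (at x) w)"
proof -
  have 1: "smooth_on S (\<lambda>x. B x u (Z x))" for u
    by (rule smooth_on_linear_coeff[OF S r B Z])
  show "smooth_on S (\<lambda>x. B x (Y x) (Z x))"
    by (rule smooth_on_linear_coeff[where A="\<lambda>x u. B x u (Z x)", OF S l 1 Y])
  show "frechet_derivative (\<lambda>x. B x (Y x) (Z x)) (at x) w =
      frechet_derivative (\<lambda>y. B y (Y x) (Z x)) (at x) w
      + B x (frechet_derivative Y (at x) w) (Z x) + B x (Y x) (frechet_derivative Z (at x) w)" if x: "x \<in> S"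
    using smooth_on_linear_coeff(2)[where A="\<lambda>x u. B x u (Z x)", OF S l 1 Y x]
      smooth_on_linear_coeff(2)[where A="\<lambda>y. B y (Y x)", OF S r B Z x] by simp
qed

section \<open>Symmetry of second derivatives\<close>

lemma frechet_derivative_inner_left:
  assumes "f differentiable (at x)"
  shows "frechet_derivative (\<lambda>y. f y \<bullet> b) (at x) v = frechet_derivative f (at x) v \<bullet> b"
  using frechet_derivative_at[OF has_derivative_inner_left[OF assms[unfolded frechet_derivative_works], of b]]
  by metis

text \<open>The mean value theorem is applied to the increment in direction \<open>v\<close>,
  regarded as a function along \<open>u\<close>, and then once more along \<open>v\<close>. The
  second difference is symmetric in \<open>u\<close> and \<open>v\<close>, the mixed derivative on
  the right not visibly so.\<close>

lemma second_difference_mean_value: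
  fixes f :: "'e::euclidean_space \<Rightarrow> real"
  assumes f: "smooth_on (ball x r) f" and h: "h > 0" "h * (norm u + norm v) < r"
  shows "\<exists>y. dist x y \<le> h * (norm u + norm v) \<and>
     f (x + h *\<^sub>R u + h *\<^sub>R v) - f (x + h *\<^sub>R u) - f (x + h *\<^sub>R v) + f x =
     h * (h * frechet_derivative (\<lambda>z. frechet_derivative f (at z) u) (at y) v)"
proof -
  let ?Du = "\<lambda>z. frechet_derivative f (at z) u"
  have d: "dist x (x + s *\<^sub>R u + t *\<^sub>R v) \<le> h * (norm u + norm v)" if "0 \<le> s" "s \<le> h" "0 \<le> t" "t \<le> h" for s t
  proof -
    have "norm (s *\<^sub>R u + t *\<^sub>R v) \<le> s * norm u + t * norm v"
      using norm_triangle_ineq[of "s *\<^sub>R u" "t *\<^sub>R v"] that by simp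
    also have "\<dots> \<le> h * norm u + h * norm v"
      using that by (intro add_mono mult_right_mono) auto
    finally show ?thesis by (simp add: dist_norm algebra_simps norm_minus_commute)
  qed
  have b: "x + s *\<^sub>R u + t *\<^sub>R v \<in> ball x r" if "0 \<le> s" "s \<le> h" "0 \<le> t" "t \<le> h" for s t
    using d[OF that] h(2) by simp
  have D1: "((\<lambda>s. f (x + s *\<^sub>R u + t *\<^sub>R v)) has_real_derivative ?Du (x + s *\<^sub>R u + t *\<^sub>R v)) (at s)"
    if "0 \<le> s" "s \<le> h" "0 \<le> t" "t \<le> h" for s t
  proof -
    have "((\<lambda>s. x + s *\<^sub>R u + t *\<^sub>R v) has_derivative (\<lambda>k. k *\<^sub>R u)) (at s)"
      by (auto intro!: derivative_eq_intros)
    from has_derivative_compose[OF this smooth_on_has_derivative[OF f b[OF that]]]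
    show ?thesis unfolding has_field_derivative_def
      by (rule has_derivative_eq_rhs)
        (simp add: fun_eq_iff linear_cmul[OF smooth_on_linear_derivative[OF f b[OF that]]] mult.commute)
  qed
  have D2: "((\<lambda>t. ?Du (x + s *\<^sub>R u + t *\<^sub>R v)) has_real_derivative
      frechet_derivative ?Du (at (x + s *\<^sub>R u + t *\<^sub>R v)) v) (at t)"
    if "0 \<le> s" "s \<le> h" "0 \<le> t" "t \<le> h" for s t
  proof -
    have "((\<lambda>t. x + s *\<^sub>R u + t *\<^sub>R v) has_derivative (\<lambda>k. k *\<^sub>R v)) (at t)"
      by (auto intro!: derivative_eq_intros)
    from has_derivative_compose[OF this smooth_on_has_derivative[OF smooth_on_derivative[OF f] b[OF that]]]
    show ?thesis unfolding has_field_derivative_def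
      by (rule has_derivative_eq_rhs)
        (simp add: fun_eq_iff linear_cmul[OF smooth_on_linear_derivative[OF smooth_on_derivative[OF f] b[OF that]]]
          mult.commute)
  qed
  have "\<exists>s>0. s < h \<and> (f (x + h *\<^sub>R u + h *\<^sub>R v) - f (x + h *\<^sub>R u + 0 *\<^sub>R v)) - (f (x + 0 *\<^sub>R u + h *\<^sub>R v) - f (x + 0 *\<^sub>R u + 0 *\<^sub>R v)) =
     (h - 0) * (?Du (x + s *\<^sub>R u + h *\<^sub>R v) - ?Du (x + s *\<^sub>R u + 0 *\<^sub>R v))"
    by (rule MVT2) (use h in \<open>auto intro!: DERIV_diff D1 simp del: scaleR_zero_left add_0_right\<close>)
  then obtain s where s: "0 < s" "s < h" and 1: "f (x + h *\<^sub>R u + h *\<^sub>R v) - f (x + h *\<^sub>R u) - f (x + h *\<^sub>R v) + f x =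
     h * (?Du (x + s *\<^sub>R u + h *\<^sub>R v) - ?Du (x + s *\<^sub>R u + 0 *\<^sub>R v))" by auto
  have "\<exists>t>0. t < h \<and> ?Du (x + s *\<^sub>R u + h *\<^sub>R v) - ?Du (x + s *\<^sub>R u + 0 *\<^sub>R v) =
     (h - 0) * frechet_derivative ?Du (at (x + s *\<^sub>R u + t *\<^sub>R v)) v"
    by (rule MVT2) (use h s in \<open>auto intro!: D2 simp del: scaleR_zero_left add_0_right\<close>)
  then obtain t where t: "0 < t" "t < h" and "?Du (x + s *\<^sub>R u + h *\<^sub>R v) - ?Du (x + s *\<^sub>R u + 0 *\<^sub>R v) =
     h * frechet_derivative ?Du (at (x + s *\<^sub>R u + t *\<^sub>R v)) v" by auto
  with 1 d[of s t] s show ?thesis by (intro exI[of _ "x + s *\<^sub>R u + t *\<^sub>R v"]) auto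
qed

text \<open>The symmetric second difference makes the two mixed derivatives agree at suitable points
  arbitrarily close to \<open>x\<close>, and continuity excludes a gap at \<open>x\<close>
  itself.\<close>

lemma second_derivative_symmetric_real:
  fixes f :: "'e::euclidean_space \<Rightarrow> real"
  assumes "open S" "smooth_on S f" "x \<in> S"
  shows "frechet_derivative (\<lambda>z. frechet_derivative f (at z) u) (at x) v =
    frechet_derivative (\<lambda>z. frechet_derivative f (at z) v) (at x) u" (is "?A x = ?B x")
proof (rule ccontr)
  assume ne: "?A x \<noteq> ?B x"
  define e where "e = \<bar>?A x - ?B x\<bar> / 2"
  have e: "e > 0" using ne by (simp add: e_def)
  have "isCont ?A x" "isCont ?B x"
    using smooth_on_imp_continuous_on[OF smooth_on_derivative[OF smooth_on_derivative[OF assms(2)]]] assms(1,3)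
    by (auto simp: continuous_on_eq_continuous_at)
  then obtain d1 d2 where d: "d1 > 0" "\<And>y. dist x y < d1 \<Longrightarrow> \<bar>?A y - ?A x\<bar> < e"
      "d2 > 0" "\<And>y. dist x y < d2 \<Longrightarrow> \<bar>?B y - ?B x\<bar> < e"
    using e unfolding continuous_at_eps_delta by (metis dist_commute dist_real_def)
  obtain r where r: "r > 0" "ball x r \<subseteq> S" using assms open_contains_ball by blast
  define m where "m = min r (min d1 d2)"
  have m: "m > 0" "m \<le> r" "m \<le> d1" "m \<le> d2" using r d by (auto simp: m_def)
  have "0 < norm u + norm v + 1" by (simp add: add_nonneg_pos)
  define h where "h = m / (norm u + norm v + 1)"
  have h: "h > 0" "h * (norm u + norm v) < m"
    using m \<open>0 < norm u + norm v + 1\<close> by (auto simp: h_def field_simps)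
  have f: "smooth_on (ball x r) f" using smooth_on_subset assms(2) r by blast
  obtain y z where "dist x y < m" "dist x z < m" "h * (h * ?A y) = h * (h * ?B z)"
    using second_difference_mean_value[OF f h(1), of u v] second_difference_mean_value[OF f h(1), of v u] h(2) m
    by (smt (verit) add.commute add.left_commute)
  moreover from this have "?A y = ?B z" using h by simp
  moreover have "\<bar>?A y - ?A x\<bar> < e" "\<bar>?B z - ?B x\<bar> < e"
    using d(2)[of y] d(4)[of z] m \<open>dist x y < m\<close> \<open>dist x z < m\<close> by linarith+
  ultimately show False unfolding e_def by argo
qed

lemma second_derivative_symmetric:
  fixes f :: "'e::euclidean_space \<Rightarrow> 'b::euclidean_space"
  assumes S: "open S" and f: "smooth_on S f" and x: "x \<in> S"
  shows "frechet_derivative (\<lambda>z. frechet_derivative f (at z) u) (at x) v =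
    frechet_derivative (\<lambda>z. frechet_derivative f (at z) v) (at x) u"
proof (rule euclidean_eqI)
  fix b :: 'b
  have d: "f differentiable at y" "(\<lambda>z. frechet_derivative f (at z) w) differentiable at y" if "y \<in> S" for y w
    using smooth_on_has_derivative[OF f that] smooth_on_has_derivative[OF smooth_on_derivative[OF f] that]
    by (auto simp: differentiable_def)
  have "frechet_derivative (\<lambda>z. frechet_derivative f (at z) u) (at x) v \<bullet> b =
    frechet_derivative (\<lambda>z. frechet_derivative (\<lambda>y. f y \<bullet> b) (at z) u) (at x) v" for u v
    by (subst frechet_derivative_inner_left[symmetric, OF d(2)[OF x]],
        rule arg_cong[where f="\<lambda>D. D v"], rule frechet_derivative_cong_open[OF S x])
      (simp add: frechet_derivative_inner_left d)
  moreover have "smooth_on S (\<lambda>y. f y \<bullet> b)" by (intro smooth_on_inner S f smooth_on_const)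
  ultimately show "frechet_derivative (\<lambda>z. frechet_derivative f (at z) u) (at x) v \<bullet> b =
    frechet_derivative (\<lambda>z. frechet_derivative f (at z) v) (at x) u \<bullet> b"
    using second_derivative_symmetric_real[OF S _ x] by simp
qed

text \<open>The classical flat function exp(-1/t), times t^(-n). With these powers the family is
  closed under differentiation up to linear combinations, which permits induction on the
  order.\<close>

definition flat_exp :: "nat \<Rightarrow> real \<Rightarrow> real" where
  "flat_exp n t = (if t > 0 then exp (- inverse t) * inverse t ^ n else 0)"

lemma flat_exp_tendsto_0: "((\<lambda>t. flat_exp n t) \<longlongrightarrow> 0) (at 0)"
proof -
  have "((\<lambda>x. x ^ n / exp x) \<longlongrightarrow> (0::real)) at_top" by (rule tendsto_power_div_exp_0)
  from filterlim_compose[OF this filterlim_inverse_at_top_right]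
  have "((\<lambda>t. flat_exp n t) \<longlongrightarrow> 0) (at_right 0)"
    by (rule Lim_transform_eventually)
      (auto simp: flat_exp_def exp_minus divide_inverse mult.commute intro!: eventually_at_right_less[THEN eventually_mono])
  moreover have "((\<lambda>t. flat_exp n t) \<longlongrightarrow> 0) (at_left 0)"
    by (rule Lim_transform_eventually[OF tendsto_const])
      (auto simp: flat_exp_def eventually_at_filter)
  ultimately show ?thesis by (simp add: filterlim_at_split)
qed

lemma flat_exp_has_derivative:
  "(flat_exp n has_real_derivative flat_exp (n + 2) t - real n * flat_exp (n + 1) t) (at t)"
proof -
  consider "t > 0" | "t = 0" | "t < 0" by linarith
  then show ?thesis
  proof cases
    case 1
    have "((\<lambda>t. exp (- inverse t)) has_real_derivative exp (- inverse t) * (inverse t)\<^sup>2) (at t)"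
      using 1 by (auto intro!: derivative_eq_intros simp: power2_eq_square)
    moreover have "((\<lambda>t. inverse t ^ n) has_real_derivative - (real n * inverse t ^ (n + 1))) (at t)"
    proof (cases n)
      case (Suc m)
      then show ?thesis using 1 DERIV_power[OF DERIV_inverse[of t UNIV], of n] by (simp add: algebra_simps)
    qed simp
    ultimately have "((\<lambda>t. exp (- inverse t) * inverse t ^ n) has_real_derivative
       exp (- inverse t) * (inverse t)\<^sup>2 * inverse t ^ n + - (real n * inverse t ^ (n + 1)) * exp (- inverse t)) (at t)"
      by (rule DERIV_mult)
    also have "exp (- inverse t) * (inverse t)\<^sup>2 * inverse t ^ n + - (real n * inverse t ^ (n + 1)) * exp (- inverse t) =
       flat_exp (n + 2) t - real n * flat_exp (n + 1) t"
      using 1 by (simp add: flat_exp_def power_add power2_eq_square algebra_simps)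
    finally have "((\<lambda>t. exp (- inverse t) * inverse t ^ n) has_real_derivative
       flat_exp (n + 2) t - real n * flat_exp (n + 1) t) (at t)" .
    then show ?thesis
      by (rule has_field_derivative_transform_within_open[where S="{0<..}"]) (use 1 in \<open>auto simp: flat_exp_def\<close>)
  next
    case 2
    \<comment> \<open>At the origin the difference quotient of \<open>flat_exp n\<close> is
      \<open>flat_exp (Suc n)\<close>, so its limit is already known.\<close>
    have "((\<lambda>h. (flat_exp n (0 + h) - flat_exp n 0) / h) \<longlongrightarrow> 0) (at 0)"
      by (rule Lim_transform_eventually[OF flat_exp_tendsto_0[of "Suc n"]])
        (auto simp: flat_exp_def divide_inverse eventually_at_filter)
    then show ?thesis using 2 by (simp add: DERIV_def flat_exp_def)
  next
    case 3
    have "((\<lambda>t. 0) has_real_derivative flat_exp (n + 2) t - real n * flat_exp (n + 1) t) (at t)"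
      using 3 by (simp add: flat_exp_def)
    then show ?thesis
      by (rule has_field_derivative_transform_within_open[where S="{..<0}"]) (use 3 in \<open>auto simp: flat_exp_def\<close>)
  qed
qed

lemma smooth_on_flat_exp: "smooth_on UNIV (flat_exp n)"
proof -
  have "C_k k UNIV (flat_exp n)" for k
  proof (induction k arbitrary: n)
    case 0
    then show ?case
      using flat_exp_has_derivative[THEN DERIV_isCont] by (simp add: continuous_at_imp_continuous_on)
  next
    case (Suc k)
    show ?case
    proof (rule C_k_SucI[OF _ flat_exp_has_derivative[unfolded has_field_derivative_def]])
      have "C_k k UNIV (\<lambda>x. (flat_exp (n + 2) x + (- real n) * flat_exp (n + 1) x) * v)" for v
        by (intro bounded_bilinear.C_k[OF bounded_bilinear_mult] C_k_add C_k_const Suc) auto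
      then show "C_k k UNIV (\<lambda>x. (flat_exp (n + 2) x - real n * flat_exp (n + 1) x) * v)" for v by simp
    qed auto
  qed
  then show ?thesis by (simp add: smooth_on_def)
qed

lemma smooth_bump:
  fixes x :: "'e::euclidean_space"
  assumes r: "r > 0"
  obtains \<rho> :: "'e \<Rightarrow> real" where "smooth_on UNIV \<rho>" "\<And>y. \<rho> y \<ge> 0" "\<And>y. \<rho> y > 0 \<longleftrightarrow> y \<in> ball x r"
proof -
  define \<rho> where "\<rho> y = flat_exp 0 (r\<^sup>2 - (y - x) \<bullet> (y - x))" for y
  have "smooth_on UNIV (\<lambda>y. r\<^sup>2 - (y - x) \<bullet> (y - x))"
    by (intro smooth_on_diff smooth_on_inner smooth_on_const smooth_on_bounded_linear[OF bounded_linear_ident] open_UNIV)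
  then have "smooth_on UNIV \<rho>"
    unfolding \<rho>_def by (rule smooth_on_compose[OF open_UNIV open_UNIV _ _ smooth_on_flat_exp, rotated]) simp
  moreover have "\<rho> y \<ge> 0" for y by (simp add: \<rho>_def flat_exp_def)
  moreover have "\<rho> y > 0 \<longleftrightarrow> y \<in> ball x r" for y
    using r power_strict_mono[of "norm (x - y)" r 2] power_less_imp_less_base[of "norm (x - y)" 2 r]
    by (auto simp: \<rho>_def flat_exp_def dist_norm norm_minus_commute dot_square_norm)
  ultimately show ?thesis using that by blast
qed

section \<open>Riemannian metrics on open sets\<close>

abbreviation fd :: "('e::real_normed_vector \<Rightarrow> 'b::real_normed_vector) \<Rightarrow> 'e \<Rightarrow> 'e \<Rightarrow> 'b" where
  "fd f x \<equiv> frechet_derivative f (at x)"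

lemma smooth_on_prod:
  fixes f :: "'i \<Rightarrow> 'e::euclidean_space \<Rightarrow> real"
  assumes "open S" "\<And>i. i \<in> I \<Longrightarrow> smooth_on S (f i)"
  shows "smooth_on S (\<lambda>x. \<Prod>i\<in>I. f i x)"
  using assms(2)
  by (induction I rule: infinite_finite_induct)
    (auto intro!: smooth_on_mult[OF assms(1)] smooth_on_const[OF assms(1)])

lemma smooth_on_det:
  fixes m :: "'e::euclidean_space \<Rightarrow> real ^ 'n ^ 'n"
  assumes "open S" "\<And>i j. smooth_on S (\<lambda>x. m x $ i $ j)"
  shows "smooth_on S (\<lambda>x. det (m x))"
  unfolding det_def
  by (intro smooth_on_sum smooth_on_mult smooth_on_const smooth_on_prod assms)

lemma smooth_on_vec:
  fixes f :: "'e::euclidean_space \<Rightarrow> real ^ 'n"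
  assumes "open S" "\<And>i. smooth_on S (\<lambda>x. f x $ i)"
  shows "smooth_on S f"
proof -
  have "smooth_on S (\<lambda>x. \<Sum>i\<in>UNIV. f x $ i *\<^sub>R axis i 1)"
    by (intro smooth_on_sum smooth_on_scaleR smooth_on_const assms)
  then show ?thesis
    by (rule smooth_on_cong[OF assms(1), rotated]) (metis basis_expansion scalar_mult_eq_scaleR)
qed

text \<open>A metric in coordinates. The point is the last argument, as in
  \<open>metric_coord\<close>, so that \<open>G u v\<close> for fixed vectors is the function to be
  differentiated.\<close>

locale local_metric =
  fixes V :: "(real ^ 'n) set" and G :: "real ^ 'n \<Rightarrow> real ^ 'n \<Rightarrow> real ^ 'n \<Rightarrow> real"
  assumes open_V: "open V"
    and smooth_G: "smooth_on V (G u v)"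
    and linear_G: "x \<in> V \<Longrightarrow> linear (\<lambda>u. G u v x)"
    and sym_G: "x \<in> V \<Longrightarrow> G u v x = G v u x"
    and pos_G: "x \<in> V \<Longrightarrow> u \<noteq> 0 \<Longrightarrow> G u u x > 0"
begin

lemma linear_G_right: "x \<in> V \<Longrightarrow> linear (\<lambda>v. G u v x)"
  using linear_G[of x u] sym_G[of x] by simp

lemmas G_add = linear_add[OF linear_G] and G_scale = linear_cmul[OF linear_G]
  and G_diff = linear_diff[OF linear_G] and G_zero = linear_0[OF linear_G]
  and G_neg = linear_neg[OF linear_G]
  and G_add_right = linear_add[OF linear_G_right] and G_scale_right = linear_cmul[OF linear_G_right]
  and G_diff_right = linear_diff[OF linear_G_right] and G_zero_right = linear_0[OF linear_G_right]
  and G_neg_right = linear_neg[OF linear_G_right]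

lemmas G_linear = G_add G_scale G_diff G_zero G_neg
  G_add_right G_scale_right G_diff_right G_zero_right G_neg_right

lemma G_eqI:
  assumes "x \<in> V" "\<And>z. G u z x = G v z x"
  shows "u = v"
proof (rule ccontr)
  assume "u \<noteq> v"
  then have "G (u - v) (u - v) x > 0" using pos_G[OF assms(1)] by simp
  then show False by (simp add: G_diff[OF assms(1)] assms(2))
qed

text \<open>The vector representing \<beta> with respect to \<open>G\<close>, given by Cramer's
  rule: as a quotient of determinants it visibly depends smoothly on the point.\<close>

definition riesz :: "real ^ 'n \<Rightarrow> (real ^ 'n \<Rightarrow> real) \<Rightarrow> real ^ 'n" where
  "riesz x \<beta> = (\<chi> k. det (\<chi> i j. if j = k then \<beta> (axis i 1) else G (axis j 1) (axis i 1) x) /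
     det (\<chi> i j. G (axis j 1) (axis i 1) x))"

lemma gram_mult:
  assumes "x \<in> V"
  shows "(\<chi> i j. G (axis j 1) (axis i 1) x) *v w = (\<chi> i. G w (axis i 1) x)"
proof (unfold vec_eq_iff, rule allI)
  fix i :: 'n
  have "G w (axis i 1) x = G (\<Sum>j\<in>UNIV. w $ j *\<^sub>R axis j 1) (axis i 1) x"
    using basis_expansion[of w] by (simp add: scalar_mult_eq_scaleR)
  also have "\<dots> = (\<Sum>j\<in>UNIV. w $ j * G (axis j 1) (axis i 1) x)"
    by (simp add: linear_sum[OF linear_G[OF assms]] G_scale[OF assms])
  finally show "((\<chi> i j. G (axis j 1) (axis i 1) x) *v w) $ i = (\<chi> i. G w (axis i 1) x) $ i"
    by (simp add: matrix_vector_mult_def mult.commute)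
qed

lemma G_eq_on_axes:
  assumes "x \<in> V" "linear \<beta>" "\<And>i. G w (axis i 1) x = \<beta> (axis i 1)"
  shows "G w z x = \<beta> z"
proof -
  have "range (\<lambda>i. axis i 1) = (Basis :: (real ^ 'n) set)" by (auto simp: Basis_vec_def)
  then have z: "z \<in> span (range (\<lambda>i. axis i 1))" by simp
  show ?thesis
    by (rule linear_eq_on_span[OF linear_G_right[OF assms(1)] assms(2) _ z]) (use assms(3) in auto)
qed

lemma det_gram_nonzero:
  assumes "x \<in> V"
  shows "det (\<chi> i j. G (axis j 1) (axis i 1) x) \<noteq> 0"
proof -
  have "w = 0" if "(\<chi> i j. G (axis j 1) (axis i 1) x) *v w = 0" for w
  proof -
    have "G w z x = G 0 z x" for z
      by (rule G_eq_on_axes[OF assms linear_G_right[OF assms]])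
        (use that in \<open>simp add: gram_mult[OF assms] vec_eq_iff G_zero[OF assms]\<close>)
    then show "w = 0" by (rule G_eqI[OF assms])
  qed
  then show ?thesis
    by (metis (no_types, lifting) invertible_det_nz invertible_left_inverse matrix_left_invertible_ker)
qed

lemma riesz:
  assumes "x \<in> V" "linear \<beta>"
  shows "G (riesz x \<beta>) z x = \<beta> z"
proof (rule G_eq_on_axes[OF assms])
  fix i :: 'n
  have "(\<chi> i j. G (axis j 1) (axis i 1) x) *v riesz x \<beta> = (\<chi> i. \<beta> (axis i 1))"
    unfolding cramer[OF det_gram_nonzero[OF assms(1)]] riesz_def
    by (simp add: vec_eq_iff cong: if_cong)
  then show "G (riesz x \<beta>) (axis i 1) x = \<beta> (axis i 1)"
    by (simp add: gram_mult[OF assms(1)] vec_eq_iff)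
qed

lemma smooth_on_riesz:
  assumes "\<And>z. smooth_on V (\<lambda>x. \<beta> x z)"
  shows "smooth_on V (\<lambda>x. riesz x (\<beta> x))"
proof (rule smooth_on_vec[OF open_V])
  fix k :: 'n
  have "smooth_on V (\<lambda>x. if j = k then \<beta> x (axis i 1) else G (axis j 1) (axis i 1) x)" for i j
    by (cases "j = k") (simp_all add: assms smooth_G)
  then have "smooth_on V (\<lambda>x. det (\<chi> i j. if j = k then \<beta> x (axis i 1) else G (axis j 1) (axis i 1) x) /
     det (\<chi> i j. G (axis j 1) (axis i 1) x))"
    by (intro smooth_on_divide smooth_on_det open_V det_gram_nonzero) (auto simp: assms smooth_G)
  then show "smooth_on V (\<lambda>x. riesz x (\<beta> x) $ k)" by (simp add: riesz_def)
qed

end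

section \<open>The Levi-Civita connection in coordinates\<close>

definition gamma where
  "gamma G x u v = (THE w. \<forall>z. G w z x = (fd (G v z) x u + fd (G u z) x v - fd (G u v) x z) / 2)"

definition nabla where "nabla G X Y x = fd Y x (X x) + gamma G x (X x) (Y x)"

definition bracket where "bracket X Y x = fd Y x (X x) - fd X x (Y x)"

text \<open>With \<open>gamma\<close>, \<open>nabla\<close> and \<open>bracket\<close> this mirrors
  \<open>riemann_curvature\<close> and its ingredients, but without an atlas, so that it applies to
  metrics given by a coordinate formula alone.\<close>

definition riem where
  "riem G X Y Z x = nabla G X (nabla G Y Z) x - nabla G Y (nabla G X Z) x - nabla G (bracket X Y) Z x"

lemma linear_fd_coeff:
  fixes A :: "'e::euclidean_space \<Rightarrow> 'a::euclidean_space \<Rightarrow> 'b::real_normed_vector"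
  assumes S: "open S" and lin: "\<And>x. x \<in> S \<Longrightarrow> linear (A x)"
    and A: "\<And>u. smooth_on S (\<lambda>x. A x u)" and x: "x \<in> S"
  shows "linear (\<lambda>u. fd (\<lambda>y. A y u) x w)"
proof (rule linearI)
  note d = smooth_on_has_derivative[OF A x]
  show "fd (\<lambda>y. A y (a + b)) x w = fd (\<lambda>y. A y a) x w + fd (\<lambda>y. A y b) x w" for a b
  proof -
    have "((\<lambda>y. A y (a + b)) has_derivative (\<lambda>w. fd (\<lambda>y. A y a) x w + fd (\<lambda>y. A y b) x w)) (at x)"
      by (rule has_derivative_transform_within_open[OF has_derivative_add[OF d d] S x])
        (simp add: linear_add[OF lin])
    from frechet_derivative_at[OF this, symmetric] show ?thesis by simp
  qed
  show "fd (\<lambda>y. A y (r *\<^sub>R a)) x w = r *\<^sub>R fd (\<lambda>y. A y a) x w" for r a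
  proof -
    have "((\<lambda>y. A y (r *\<^sub>R a)) has_derivative (\<lambda>w. r *\<^sub>R fd (\<lambda>y. A y a) x w)) (at x)"
      by (rule has_derivative_transform_within_open[OF has_derivative_scaleR_right[OF d] S x])
        (simp add: linear_cmul[OF lin])
    from frechet_derivative_at[OF this, symmetric] show ?thesis by simp
  qed
qed

lemma smooth_on_fd_apply:
  fixes Z :: "'e::euclidean_space \<Rightarrow> 'b::real_normed_vector"
  assumes S: "open S" and Z: "smooth_on S Z" and Y: "smooth_on S Y"
  shows "smooth_on S (\<lambda>x. fd Z x (Y x))"
  by (rule smooth_on_linear_coeff(1)[OF S smooth_on_linear_derivative[OF Z] smooth_on_derivative[OF Z] Y])

lemma smooth_on_bracket:
  assumes "open V" "smooth_on V X" "smooth_on V Y"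
  shows "smooth_on V (bracket X Y)"
proof -
  have "smooth_on V (\<lambda>x. fd Y x (X x) - fd X x (Y x))"
    by (intro smooth_on_diff smooth_on_fd_apply assms)
  then show ?thesis by (simp add: bracket_def[abs_def])
qed

context local_metric
begin

lemma fd_linear: "x \<in> V \<Longrightarrow> linear (fd (G u v) x)"
  using smooth_on_linear_derivative smooth_G by blast

lemma fd_left: "x \<in> V \<Longrightarrow> linear (\<lambda>u. fd (G u v) x w)"
  by (rule linear_fd_coeff[OF open_V linear_G smooth_G])

lemma fd_sym: "x \<in> V \<Longrightarrow> fd (G u v) x = fd (G v u) x"
  using frechet_derivative_cong_open[OF open_V, of x "G u v" "G v u"] sym_G by blast

lemma fd_right: "x \<in> V \<Longrightarrow> linear (\<lambda>v. fd (G u v) x w)"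
  using fd_left[of x u w] fd_sym[of x] by simp

lemmas fd_simps = linear_add[OF fd_left] linear_cmul[OF fd_left] linear_add[OF fd_right] linear_cmul[OF fd_right]
   linear_add[OF fd_linear] linear_cmul[OF fd_linear]

abbreviation (input) koszul_coord where
  "koszul_coord x u v z \<equiv> (fd (G v z) x u + fd (G u z) x v - fd (G u v) x z) / 2"

lemma linear_koszul_coord: "x \<in> V \<Longrightarrow> linear (koszul_coord x u v)"
  by (rule linearI) (simp_all add: fd_simps field_simps)

text \<open>Nondegeneracy gives uniqueness and the Riesz vector existence for the definite
  description; the explicit solution also yields smoothness in the point.\<close>

lemma gamma_eq_riesz:
  assumes x: "x \<in> V"
  shows "gamma G x u v = riesz x (koszul_coord x u v)"
  unfolding gamma_def
proof (rule the_equality)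
  note r = riesz[OF x linear_koszul_coord[OF x]]
  show "\<forall>z. G (riesz x (koszul_coord x u v)) z x = koszul_coord x u v z" by (rule allI) (rule r)
  show "w = riesz x (koszul_coord x u v)" if "\<forall>z. G w z x = koszul_coord x u v z" for w
    by (rule G_eqI[OF x]) (simp only: r that[rule_format])
qed

lemma gamma: "x \<in> V \<Longrightarrow> G (gamma G x u v) z x = koszul_coord x u v z"
  by (simp only: gamma_eq_riesz riesz linear_koszul_coord)

lemma gamma_left: "x \<in> V \<Longrightarrow> linear (\<lambda>u. gamma G x u v)"
  by (intro linearI) (auto intro!: G_eqI[of x] simp: gamma G_linear fd_simps field_simps)

lemma gamma_sym: "x \<in> V \<Longrightarrow> gamma G x u v = gamma G x v u"
  by (rule G_eqI[of x]) (simp_all add: gamma fd_sym[of _ v u] algebra_simps)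

lemma gamma_right:
  assumes x: "x \<in> V"
  shows "linear (gamma G x u)"
proof -
  have "(\<lambda>v. gamma G x v u) = gamma G x u" by (rule ext) (rule gamma_sym[OF x])
  then show ?thesis using gamma_left[OF x, of u] by simp
qed

lemma smooth_on_gamma: "smooth_on V (\<lambda>x. gamma G x u v)"
proof (rule smooth_on_cong[OF open_V])
  show "riesz x (koszul_coord x u v) = gamma G x u v" if "x \<in> V" for x
    using that gamma_eq_riesz by simp
  have "smooth_on V (\<lambda>x. (fd (G v z) x u + fd (G u z) x v - fd (G u v) x z) * (1 / 2))" for z
    by (intro smooth_on_mult smooth_on_diff smooth_on_add open_V smooth_on_const smooth_on_derivative smooth_G)
  then show "smooth_on V (\<lambda>x. riesz x (koszul_coord x u v))"
    by (intro smooth_on_riesz) simp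
qed

lemma smooth_on_gamma_apply:
  assumes "smooth_on V X" "smooth_on V Y"
  shows "smooth_on V (\<lambda>x. gamma G x (X x) (Y x))"
  by (rule smooth_on_bilinear_coeff(1)[OF open_V gamma_left gamma_right smooth_on_gamma assms])

lemma smooth_on_nabla:
  assumes "smooth_on V X" "smooth_on V Y"
  shows "smooth_on V (nabla G X Y)"
proof -
  have "smooth_on V (\<lambda>x. fd Y x (X x) + gamma G x (X x) (Y x))"
    by (intro smooth_on_add open_V smooth_on_fd_apply smooth_on_gamma_apply assms)
  then show ?thesis by (simp add: nabla_def[abs_def])
qed

lemma smooth_on_G:
  assumes "smooth_on V X" "smooth_on V Y"
  shows "smooth_on V (\<lambda>x. G (X x) (Y x) x)"
  by (rule smooth_on_bilinear_coeff(1)[where B="\<lambda>x u v. G u v x", OF open_V linear_G linear_G_right smooth_G assms])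

lemma fd_G:
  assumes "smooth_on V X" "smooth_on V Y" "x \<in> V"
  shows "fd (\<lambda>x. G (X x) (Y x) x) x w = fd (G (X x) (Y x)) x w + G (fd X x w) (Y x) x + G (X x) (fd Y x w) x"
  by (rule smooth_on_bilinear_coeff(2)[where B="\<lambda>x u v. G u v x", OF open_V linear_G linear_G_right smooth_G assms])

lemma nabla_compatible:
  assumes Y: "smooth_on V Y" and Z: "smooth_on V Z" and x: "x \<in> V"
  shows "fd (\<lambda>x. G (Y x) (Z x) x) x (X x) = G (nabla G X Y x) (Z x) x + G (Y x) (nabla G X Z x) x"
  unfolding fd_G[OF Y Z x] nabla_def G_add[OF x] G_add_right[OF x] sym_G[OF x, of "Y x" "gamma G x (X x) (Z x)"] gamma[OF x]
  using fd_sym[OF x, of "Y x" "Z x"] fd_sym[OF x, of "X x" "Z x"] fd_sym[OF x, of "X x" "Y x"]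
  by (simp add: field_simps)

lemma nabla_torsion_free: "x \<in> V \<Longrightarrow> nabla G X Y x - nabla G Y X x = bracket X Y x"
  using gamma_sym[of x "X x" "Y x"] by (simp add: nabla_def bracket_def)

text \<open>Metric compatibility expands the three derivatives, and vanishing torsion turns
  differences of covariant derivatives into brackets. The right-hand side involves the metric only
  through inner products of fields and brackets, which later shows how L can enter.\<close>

lemma koszul:
  assumes X: "smooth_on V X" and Y: "smooth_on V Y" and Z: "smooth_on V Z" and x: "x \<in> V"
  shows "2 * G (nabla G X Y x) (Z x) x =
    fd (\<lambda>x. G (Y x) (Z x) x) x (X x) + fd (\<lambda>x. G (X x) (Z x) x) x (Y x) - fd (\<lambda>x. G (X x) (Y x) x) x (Z x)
    + G (bracket X Y x) (Z x) x - G (bracket X Z x) (Y x) x - G (bracket Y Z x) (X x) x"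
  unfolding nabla_compatible[OF Y Z x] nabla_compatible[OF X Z x] nabla_compatible[OF X Y x]
    nabla_torsion_free[OF x, symmetric] G_diff[OF x]
  using sym_G[OF x, of "nabla G X Z x"] sym_G[OF x, of "nabla G Y Z x"] sym_G[OF x, of "nabla G Z Y x"]
    sym_G[OF x, of "nabla G X Y x"] sym_G[OF x, of "nabla G Y X x"] sym_G[OF x, of "nabla G Z X x"]
  by simp

section \<open>The curvature tensor and its symmetries\<close>

definition riem_tensor where
  "riem_tensor x u v w = fd (\<lambda>y. gamma G y v w) x u - fd (\<lambda>y. gamma G y u w) x v
     + gamma G x u (gamma G x v w) - gamma G x v (gamma G x u w)"

lemma fd_nabla:
  assumes Y: "smooth_on V Y" and Z: "smooth_on V Z" and x: "x \<in> V"
  shows "fd (nabla G Y Z) x w = fd (\<lambda>y. fd Z y (Y x)) x w + fd Z x (fd Y x w)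
     + (fd (\<lambda>y. gamma G y (Y x) (Z x)) x w + gamma G x (fd Y x w) (Z x) + gamma G x (Y x) (fd Z x w))"
proof -
  note 1 = smooth_on_fd_apply[OF open_V Z Y] and 2 = smooth_on_gamma_apply[OF Y Z]
  have "fd (nabla G Y Z) x w = fd (\<lambda>y. fd Z y (Y y)) x w + fd (\<lambda>y. gamma G y (Y y) (Z y)) x w"
    using frechet_derivative_at[OF has_derivative_add[OF smooth_on_has_derivative[OF 1 x] smooth_on_has_derivative[OF 2 x]], symmetric]
    by (simp only: nabla_def[abs_def])
  also have "fd (\<lambda>y. fd Z y (Y y)) x w = fd (\<lambda>y. fd Z y (Y x)) x w + fd Z x (fd Y x w)"
    by (rule smooth_on_linear_coeff(2)[OF open_V smooth_on_linear_derivative[OF Z] smooth_on_derivative[OF Z] Y x])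
  also have "fd (\<lambda>y. gamma G y (Y y) (Z y)) x w =
     fd (\<lambda>y. gamma G y (Y x) (Z x)) x w + gamma G x (fd Y x w) (Z x) + gamma G x (Y x) (fd Z x w)"
    by (rule smooth_on_bilinear_coeff(2)[OF open_V gamma_left gamma_right smooth_on_gamma Y Z x])
  finally show ?thesis .
qed

text \<open>The second derivatives of \<open>Z\<close> cancel by symmetry, its first derivatives
  occur symmetrically in \<open>X\<close> and \<open>Y\<close>, and the derivatives of
  \<open>X\<close> and \<open>Y\<close> cancel against the bracket term. Only the values at
  \<open>x\<close> remain.\<close>

lemma riem_eq_riem_tensor:
  assumes X: "smooth_on V X" and Y: "smooth_on V Y" and Z: "smooth_on V Z" and x: "x \<in> V"
  shows "riem G X Y Z x = riem_tensor x (X x) (Y x) (Z x)"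
proof -
  have s: "fd (\<lambda>y. fd Z y (Y x)) x (X x) = fd (\<lambda>y. fd Z y (X x)) x (Y x)"
    by (rule second_derivative_symmetric[OF open_V Z x])
  note l = linear_add[OF gamma_right[OF x]] linear_diff[OF gamma_left[OF x]]
    linear_diff[OF smooth_on_linear_derivative[OF Z x]]
  show ?thesis
    unfolding riem_def nabla_def[of G X "nabla G Y Z"] nabla_def[of G Y "nabla G X Z"] nabla_def[of G "bracket X Y"]
      fd_nabla[OF Y Z x] fd_nabla[OF X Z x] riem_tensor_def bracket_def s
    by (simp add: nabla_def l)
qed

lemma riem_tensor_linear_first:
  assumes x: "x \<in> V"
  shows "linear (\<lambda>u. riem_tensor x u v w)"
proof -
  note c = linear_fd_coeff[OF open_V gamma_left smooth_on_gamma x]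
  note l = linear_add[OF c] linear_cmul[OF c] linear_add[OF gamma_left[OF x]] linear_cmul[OF gamma_left[OF x]]
    linear_add[OF gamma_right[OF x]] linear_cmul[OF gamma_right[OF x]]
    linear_add[OF smooth_on_linear_derivative[OF smooth_on_gamma x]] linear_cmul[OF smooth_on_linear_derivative[OF smooth_on_gamma x]]
  show ?thesis unfolding riem_tensor_def by (rule linearI) (simp_all add: l algebra_simps)
qed

lemma riem_tensor_linear_third:
  assumes x: "x \<in> V"
  shows "linear (riem_tensor x u v)"
proof -
  note c = linear_fd_coeff[OF open_V gamma_right smooth_on_gamma x]
  note l = linear_add[OF c] linear_cmul[OF c]
    linear_add[OF gamma_right[OF x]] linear_cmul[OF gamma_right[OF x]]
  show ?thesis unfolding riem_tensor_def by (rule linearI) (simp_all add: l algebra_simps)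
qed

lemma riem_tensor_skew: "riem_tensor x u v w = - riem_tensor x v u w"
  by (simp add: riem_tensor_def)

text \<open>Constant fields commute. Expressing the second derivatives of \<open>G w w\<close> by
  two uses of metric compatibility, their symmetry says that twice this inner product
  vanishes.\<close>

lemma riem_tensor_skew_adjoint_diag:
  assumes x: "x \<in> V"
  shows "G (riem_tensor x u v w) w x = 0"
proof -
  have c: "smooth_on V (\<lambda>_. z)" for z :: "real ^ 'n" by (rule smooth_on_const[OF open_V])
  let ?n = "\<lambda>u. nabla G (\<lambda>_. u) (\<lambda>_. w)"
  have n: "smooth_on V (?n u)" for u by (rule smooth_on_nabla[OF c c])
  have 1: "fd (G w w) y u = 2 * G (?n u y) w y" if "y \<in> V" for u y
    using nabla_compatible[OF c c that, of w w "\<lambda>_. u"] sym_G[OF that, of w] by simp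
  have 2: "fd (\<lambda>y. fd (G w w) y u) x v = 2 * (G (nabla G (\<lambda>_. v) (?n u) x) w x + G (?n u x) (?n v x) x)" for u v
  proof -
    note s = smooth_on_G[OF n[of u] c[of w]]
    have "fd (\<lambda>y. fd (G w w) y u) x v = fd (\<lambda>y. 2 * G (?n u y) w y) x v"
      by (simp only: frechet_derivative_cong_open[OF open_V x 1])
    also have "\<dots> = 2 * fd (\<lambda>y. G (?n u y) w y) x v"
      using frechet_derivative_at[OF has_derivative_mult_right[OF smooth_on_has_derivative[OF s x], of 2], symmetric] by simp
    also have "fd (\<lambda>y. G (?n u y) w y) x v = G (nabla G (\<lambda>_. v) (?n u) x) w x + G (?n u x) (?n v x) x"
      by (rule nabla_compatible[OF n c x, where X="\<lambda>_. v"])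
    finally show ?thesis .
  qed
  have "fd (\<lambda>y. fd (G w w) y u) x v = fd (\<lambda>y. fd (G w w) y v) x u"
    by (rule second_derivative_symmetric[OF open_V smooth_G x])
  then have "G (nabla G (\<lambda>_. u) (?n v) x) w x = G (nabla G (\<lambda>_. v) (?n u) x) w x"
    unfolding 2 using sym_G[OF x, of "?n u x" "?n v x"] by simp
  moreover have "nabla G (bracket (\<lambda>_. u) (\<lambda>_. v)) (\<lambda>_. w) x = 0"
    by (simp add: nabla_def bracket_def linear_0[OF gamma_left[OF x]])
  ultimately have "G (riem G (\<lambda>_. u) (\<lambda>_. v) (\<lambda>_. w) x) w x = 0"
    by (simp add: riem_def G_diff[OF x])
  then show ?thesis by (simp add: riem_eq_riem_tensor[OF c c c x])
qed

text \<open>Polarisation of the diagonal case at \<open>w + z\<close>.\<close>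

lemma riem_tensor_skew_adjoint:
  assumes x: "x \<in> V"
  shows "G (riem_tensor x u v w) z x = - G (riem_tensor x u v z) w x"
  using riem_tensor_skew_adjoint_diag[OF x, of u v "w + z"] riem_tensor_skew_adjoint_diag[OF x, of u v w] riem_tensor_skew_adjoint_diag[OF x, of u v z]
  by (simp add: linear_add[OF riem_tensor_linear_third[OF x]] G_linear[OF x])

text \<open>The form is alternating in the first pair by construction and in the second by
  skew-adjointness, and each pair contributes one factor of the determinant. The Gram determinant
  acquires the same square.\<close>

lemma riem_tensor_change_of_basis:
  assumes x: "x \<in> V" and u': "u' = a *\<^sub>R u + b *\<^sub>R v" and v': "v' = c *\<^sub>R u + d *\<^sub>R v"
  shows "G (riem_tensor x u' v' v') u' x = (a * d - b * c)\<^sup>2 * G (riem_tensor x u v v) u x"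
proof -
  note l1 = linear_add[OF riem_tensor_linear_first[OF x]] linear_cmul[OF riem_tensor_linear_first[OF x]]
  note l3 = linear_add[OF riem_tensor_linear_third[OF x]] linear_cmul[OF riem_tensor_linear_third[OF x]]
  have self: "riem_tensor x u u w = 0" "riem_tensor x v v w = 0" for w by (simp_all add: riem_tensor_def)
  have r: "riem_tensor x z (p *\<^sub>R s + q *\<^sub>R t) w = p *\<^sub>R riem_tensor x z s w + q *\<^sub>R riem_tensor x z t w" for z p q s t w
    unfolding riem_tensor_skew[of x z] l1 by simp
  have 1: "riem_tensor x u' v' w = (a * d - b * c) *\<^sub>R riem_tensor x u v w" for w
    unfolding u' v' r l1 self using riem_tensor_skew[of x v u w] by (simp add: algebra_simps)
  have "G (riem_tensor x u v v') u' x = (a * d - b * c) * G (riem_tensor x u v v) u x"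
    unfolding u' v' l3 using riem_tensor_skew_adjoint[OF x, of u v u v] riem_tensor_skew_adjoint_diag[OF x, of u v]
    by (simp add: G_linear[OF x] algebra_simps)
  then show ?thesis unfolding 1 by (simp add: G_linear[OF x] power2_eq_square)
qed

end

lemma fd_cong:
  assumes "open S" "x \<in> S" "\<And>y. y \<in> S \<Longrightarrow> f y = g y"
  shows "fd f x w = fd g x w"
  by (simp only: frechet_derivative_cong_open[OF assms])

section \<open>Isometries\<close>

text \<open>Transition maps between charts are the instances in mind. \<open>surj_D\<close> allows
  identities between vectors of the target to be tested against images of vectors of the
  source.\<close>

locale local_isometry = V: local_metric V G + W: local_metric W G'
  for V W :: "(real ^ 'n) set" and G G' +
  fixes \<phi> :: "real ^ 'n \<Rightarrow> real ^ 'n"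
  assumes smooth_\<phi>: "smooth_on V \<phi>"
    and maps_to: "x \<in> V \<Longrightarrow> \<phi> x \<in> W"
    and surj_D: "x \<in> V \<Longrightarrow> surj (fd \<phi> x)"
    and isometry: "x \<in> V \<Longrightarrow> G u v x = G' (fd \<phi> x u) (fd \<phi> x v) (\<phi> x)"
begin

abbreviation "D2 x u v \<equiv> fd (\<lambda>y. fd \<phi> y v) x u"

lemma D2_sym: "x \<in> V \<Longrightarrow> D2 x u v = D2 x v u"
  by (rule second_derivative_symmetric[OF V.open_V smooth_\<phi>])

lemma fd_metric_pullback:
  assumes x: "x \<in> V"
  shows "fd (G u v) x w = fd (G' (fd \<phi> x u) (fd \<phi> x v)) (\<phi> x) (fd \<phi> x w)
    + G' (D2 x w u) (fd \<phi> x v) (\<phi> x) + G' (fd \<phi> x u) (D2 x w v) (\<phi> x)"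
proof -
  have s: "smooth_on V (\<lambda>x. G' u v (\<phi> x))" for u v
    by (rule smooth_on_compose[OF V.open_V W.open_V maps_to smooth_\<phi> W.smooth_G])
  have "fd (G u v) x w = fd (\<lambda>y. G' (fd \<phi> y u) (fd \<phi> y v) (\<phi> y)) x w"
    by (rule fd_cong[OF V.open_V x]) (rule isometry)
  also have "\<dots> = fd (\<lambda>y. G' (fd \<phi> x u) (fd \<phi> x v) (\<phi> y)) x w
    + G' (D2 x w u) (fd \<phi> x v) (\<phi> x) + G' (fd \<phi> x u) (D2 x w v) (\<phi> x)"
    by (rule smooth_on_bilinear_coeff(2)[where B="\<lambda>y u v. G' u v (\<phi> y)", OF V.open_V W.linear_G W.linear_G_right s])
      (auto intro: maps_to smooth_on_derivative smooth_\<phi> x)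
  also have "fd (\<lambda>y. G' (fd \<phi> x u) (fd \<phi> x v) (\<phi> y)) x w =
      fd (G' (fd \<phi> x u) (fd \<phi> x v)) (\<phi> x) (fd \<phi> x w)"
    using frechet_derivative_at[OF has_derivative_compose[OF smooth_on_has_derivative[OF smooth_\<phi> x]
      smooth_on_has_derivative[OF W.smooth_G maps_to[OF x]]], symmetric] by simp
  finally show ?thesis .
qed

text \<open>The transformation law of Christoffel symbols, with the second derivative of \<phi> as
  inhomogeneous term. Differentiating the metric produces six terms with \<open>D2\<close>; in the
  defining combination four of them cancel by symmetry and the other two add up.\<close>

lemma gamma_pullback:
  assumes x: "x \<in> V"
  shows "gamma G' (\<phi> x) (fd \<phi> x u) (fd \<phi> x v) = fd \<phi> x (gamma G x u v) - D2 x u v"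
proof (rule W.G_eqI[OF maps_to[OF x]])
  fix z'
  obtain z where z: "z' = fd \<phi> x z" using surj_D[OF x] by (metis surjD)
  note \<phi>x = maps_to[OF x]
  show "G' (gamma G' (\<phi> x) (fd \<phi> x u) (fd \<phi> x v)) z' (\<phi> x) = G' (fd \<phi> x (gamma G x u v) - D2 x u v) z' (\<phi> x)"
    unfolding z W.G_diff[OF \<phi>x] isometry[OF x, symmetric] V.gamma[OF x] W.gamma[OF \<phi>x] fd_metric_pullback[OF x]
    using D2_sym[OF x, of v u] D2_sym[OF x, of z u] D2_sym[OF x, of z v]
      W.sym_G[OF \<phi>x, of "fd \<phi> x u"] W.sym_G[OF \<phi>x, of "fd \<phi> x v"] W.sym_G[OF \<phi>x, of "fd \<phi> x z"]
    by (simp add: field_simps)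
qed

text \<open>The usual \<phi>-relatedness, bundled with smoothness so that covariant derivatives and
  brackets of related fields are again of this kind.\<close>

definition related where
  "related X X' \<longleftrightarrow> smooth_on V X \<and> smooth_on W X' \<and> (\<forall>x\<in>V. X' (\<phi> x) = fd \<phi> x (X x))"

lemma relatedD:
  assumes "related X X'"
  shows "smooth_on V X" "smooth_on W X'" "x \<in> V \<Longrightarrow> X' (\<phi> x) = fd \<phi> x (X x)"
  using assms by (auto simp: related_def)

lemma fd_related:
  assumes "related Y Y'" and x: "x \<in> V"
  shows "fd Y' (\<phi> x) (fd \<phi> x w) = D2 x w (Y x) + fd \<phi> x (fd Y x w)"
proof -
  note Y = relatedD[OF assms(1)]
  have "fd Y' (\<phi> x) (fd \<phi> x w) = fd (\<lambda>y. Y' (\<phi> y)) x w"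
    using frechet_derivative_at[OF has_derivative_compose[OF smooth_on_has_derivative[OF smooth_\<phi> x]
      smooth_on_has_derivative[OF Y(2) maps_to[OF x]]], symmetric] by simp
  also have "\<dots> = fd (\<lambda>y. fd \<phi> y (Y y)) x w"
    by (rule fd_cong[OF V.open_V x]) (rule Y(3))
  also have "\<dots> = D2 x w (Y x) + fd \<phi> x (fd Y x w)"
    by (rule smooth_on_linear_coeff(2)[OF V.open_V smooth_on_linear_derivative[OF smooth_\<phi>]
      smooth_on_derivative[OF smooth_\<phi>] Y(1) x])
  finally show ?thesis .
qed

text \<open>Differentiating a related field along \<phi> produces a second derivative of \<phi> that
  is exactly opposite to the one in \<open>gamma_pullback\<close>.\<close>

lemma related_nabla:
  assumes X: "related X X'" and Y: "related Y Y'"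
  shows "related (nabla G X Y) (nabla G' X' Y')"
proof -
  have "nabla G' X' Y' (\<phi> x) = fd \<phi> x (nabla G X Y x)" if x: "x \<in> V" for x
    unfolding nabla_def relatedD(3)[OF X x] relatedD(3)[OF Y x] fd_related[OF Y x] gamma_pullback[OF x]
      linear_add[OF smooth_on_linear_derivative[OF smooth_\<phi> x]] by simp
  then show ?thesis
    using V.smooth_on_nabla W.smooth_on_nabla relatedD[OF X] relatedD[OF Y] by (simp add: related_def)
qed

lemma related_bracket:
  assumes X: "related X X'" and Y: "related Y Y'"
  shows "related (bracket X Y) (bracket X' Y')"
proof -
  have "bracket X' Y' (\<phi> x) = fd \<phi> x (bracket X Y x)" if x: "x \<in> V" for x
    unfolding bracket_def relatedD(3)[OF X x] relatedD(3)[OF Y x] fd_related[OF Y x] fd_related[OF X x]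
      linear_diff[OF smooth_on_linear_derivative[OF smooth_\<phi> x]] D2_sym[OF x, of "X x"] by simp
  moreover have "smooth_on V (bracket X Y)" "smooth_on W (bracket X' Y')"
    by (intro smooth_on_bracket V.open_V W.open_V relatedD(1,2)[OF X] relatedD(1,2)[OF Y])+
  ultimately show ?thesis by (simp add: related_def)
qed

end

lemma (in local_metric) smooth_on_riem:
  assumes "smooth_on V X" "smooth_on V Y" "smooth_on V Z"
  shows "smooth_on V (riem G X Y Z)"
  unfolding riem_def[abs_def]
  by (intro smooth_on_diff smooth_on_nabla smooth_on_bracket open_V assms)

section \<open>Metrics split along a transverse field\<close>

text \<open>Coordinate version of the data in the overview: \<open>H\<close> stands for h,
  degenerate precisely along \<open>R\<close>, and \<open>a\<close> for \<alpha>.\<close>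

locale contact_splitting =
  fixes V :: "(real ^ 'n) set" and H :: "real ^ 'n \<Rightarrow> real ^ 'n \<Rightarrow> real ^ 'n \<Rightarrow> real"
    and a :: "real ^ 'n \<Rightarrow> real ^ 'n \<Rightarrow> real" and R :: "real ^ 'n \<Rightarrow> real ^ 'n"
  assumes open_V: "open V"
    and smooth_H: "smooth_on V (H u v)"
    and linear_H: "x \<in> V \<Longrightarrow> linear (\<lambda>u. H u v x)"
    and sym_H: "x \<in> V \<Longrightarrow> H u v x = H v u x"
    and smooth_a: "smooth_on V (a u)"
    and linear_a: "x \<in> V \<Longrightarrow> linear (\<lambda>u. a u x)"
    and smooth_R: "smooth_on V R"
    and a_R: "x \<in> V \<Longrightarrow> a (R x) x = 1"
    and H_R: "x \<in> V \<Longrightarrow> H (R x) u x = 0"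
    and pos_H: "x \<in> V \<Longrightarrow> a u x = 0 \<Longrightarrow> u \<noteq> 0 \<Longrightarrow> H u u x > 0"
begin

definition Gs where "Gs L u v x = H u v x + L x * (a u x * a v x)"

lemma H_R_right: "x \<in> V \<Longrightarrow> H u (R x) x = 0"
  using H_R sym_H by metis

lemma linear_H_right: "x \<in> V \<Longrightarrow> linear (\<lambda>v. H u v x)"
  using linear_H[of x u] sym_H[of x] by simp

lemmas H_linear = linear_add[OF linear_H] linear_cmul[OF linear_H] linear_diff[OF linear_H]
  linear_add[OF linear_H_right] linear_cmul[OF linear_H_right] linear_diff[OF linear_H_right]
lemmas a_linear = linear_add[OF linear_a] linear_cmul[OF linear_a] linear_diff[OF linear_a] linear_0[OF linear_a]

lemma local_metric_Gs:
  assumes "smooth_on V L" "\<And>x. x \<in> V \<Longrightarrow> L x > 0"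
  shows "local_metric V (Gs L)"
proof (rule local_metric.intro)
  show "smooth_on V (Gs L u v)" for u v
    unfolding Gs_def[abs_def] by (intro smooth_on_add smooth_on_mult open_V smooth_H smooth_a assms)
  show "linear (\<lambda>u. Gs L u v x)" if x: "x \<in> V" for x v
    by (rule linearI) (simp_all add: Gs_def H_linear[OF x] a_linear[OF x] algebra_simps)
  fix x u v assume x: "x \<in> V"
  show "Gs L u v x = Gs L v u x" using sym_H[OF x] by (simp add: Gs_def)
  assume u: "u \<noteq> 0"
  \<comment> \<open>The component of \<open>u\<close> in the kernel of \<open>a\<close> along
    \<open>R\<close>. \<open>H\<close> sees only \<open>w\<close>; if \<open>w\<close> vanishes,
    \<open>u\<close> is a multiple of \<open>R\<close> and the summand with \<open>L\<close> is
    positive.\<close>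
  define w where "w = u - a u x *\<^sub>R R x"
  have w: "a w x = 0" by (simp add: w_def a_linear[OF x] a_R[OF x])
  have H: "H u u x = H w w x" by (simp add: w_def H_linear[OF x] H_R[OF x] H_R_right[OF x])
  show "Gs L u u x > 0"
  proof (cases "w = 0")
    case True
    then have "u = a u x *\<^sub>R R x" by (simp add: w_def)
    then have "a u x \<noteq> 0" using u by auto
    moreover have "H u u x = 0" using H True linear_0[OF linear_H[OF x]] by simp
    ultimately show ?thesis using assms(2)[OF x] by (simp add: Gs_def zero_less_mult_iff) argo
  next
    case False
    then show ?thesis using pos_H[OF x w] assms(2)[OF x] unfolding Gs_def H
      by (intro add_pos_nonneg) auto
  qed
qed (rule open_V)

definition horizontal where "horizontal X \<longleftrightarrow> smooth_on V X \<and> (\<forall>x\<in>V. a (X x) x = 0)"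

text \<open>Twice the right-hand side of the Koszul formula for the degenerate form \<open>H\<close>.\<close>

definition koszul_form where
  "koszul_form A B C x = fd (\<lambda>x. H (B x) (C x) x) x (A x) + fd (\<lambda>x. H (A x) (C x) x) x (B x)
     - fd (\<lambda>x. H (A x) (B x) x) x (C x)
     + H (bracket A B x) (C x) x - H (bracket A C x) (B x) x - H (bracket B C x) (A x) x"

text \<open>Minus the Lie derivative of \<open>H\<close> along \<open>R\<close>, evaluated on
  \<open>A\<close> and \<open>B\<close>. For horizontal \<open>A\<close> and \<open>B\<close> it is
  what the Koszul formula with third field \<open>R\<close> contributes free of L.\<close>

definition neg_lie_deriv where
  "neg_lie_deriv A B x = - fd (\<lambda>x. H (A x) (B x) x) x (R x) - H (bracket A R x) (B x) x - H (bracket B R x) (A x) x"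

lemma neg_lie_deriv_sym:
  assumes x: "x \<in> V"
  shows "neg_lie_deriv A B x = neg_lie_deriv B A x"
proof -
  have "fd (\<lambda>x. H (A x) (B x) x) x = fd (\<lambda>x. H (B x) (A x) x) x"
    by (rule frechet_derivative_cong_open[OF open_V x]) (rule sym_H)
  then show ?thesis by (simp add: neg_lie_deriv_def)
qed

context
  fixes L :: "real ^ 'n \<Rightarrow> real" assumes smooth_L: "smooth_on V L" and pos_L: "\<And>x. x \<in> V \<Longrightarrow> L x > 0"
begin

interpretation local_metric V "Gs L" by (rule local_metric_Gs[OF smooth_L pos_L])

text \<open>Each of the three differentiated inner products involves \<open>B\<close> or
  \<open>C\<close>, so its part with L vanishes identically and no derivative of L arises.
  \<open>A\<close> may have a transverse component; this is needed for A =
  \<open>bracket X Y\<close>.\<close>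

lemma koszul_horizontal:
  assumes A: "smooth_on V A" and B: "horizontal B" and C: "horizontal C" and x: "x \<in> V"
  shows "2 * Gs L (nabla (Gs L) A B x) (C x) x = koszul_form A B C x - L x * (a (bracket B C x) x * a (A x) x)"
proof -
  have e: "fd (\<lambda>x. Gs L (Z x) (Z' x) x) x = fd (\<lambda>x. H (Z x) (Z' x) x) x" if "horizontal Z' \<or> horizontal Z" for Z Z'
    by (rule frechet_derivative_cong_open[OF open_V x]) (use that in \<open>auto simp: horizontal_def Gs_def\<close>)
  have BC: "smooth_on V B" "smooth_on V C" "a (B x) x = 0" "a (C x) x = 0"
    using B C x by (auto simp: horizontal_def)
  show ?thesis
    unfolding koszul[OF A BC(1,2) x] koszul_form_def using B C
    by (simp add: e, simp add: Gs_def BC)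
qed

text \<open>\<open>R\<close> is orthogonal to horizontal fields for every L, so two derivatives
  vanish and the third falls on \<open>H\<close> alone. Division by 2 L is the origin of the terms
  with 1 / L.\<close>

lemma koszul_transverse:
  assumes A: "horizontal A" and B: "horizontal B" and x: "x \<in> V"
  shows "2 * (L x * a (nabla (Gs L) A B x) x) = neg_lie_deriv A B x + L x * a (bracket A B x) x"
proof -
  have z: "fd (\<lambda>x. Gs L (Z x) (R x) x) x = (\<lambda>_. 0)" if "horizontal Z" for Z
    using frechet_derivative_cong_open[OF open_V x, of "\<lambda>x. Gs L (Z x) (R x) x" "\<lambda>_. 0"] that
    by (simp add: horizontal_def Gs_def H_R_right)
  have e: "fd (\<lambda>x. Gs L (A x) (B x) x) x = fd (\<lambda>x. H (A x) (B x) x) x"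
    by (rule frechet_derivative_cong_open[OF open_V x]) (use A in \<open>auto simp: horizontal_def Gs_def\<close>)
  have AB: "smooth_on V A" "smooth_on V B" "a (A x) x = 0" "a (B x) x = 0"
    using A B x by (auto simp: horizontal_def)
  have "L x * a (nabla (Gs L) A B x) x = Gs L (nabla (Gs L) A B x) (R x) x"
    by (simp add: Gs_def H_R_right[OF x] a_R[OF x])
  then show ?thesis
    using koszul[OF AB(1,2) smooth_R x] unfolding z[OF A] z[OF B] e
    by (simp add: neg_lie_deriv_def) (simp add: Gs_def AB H_R_right[OF x] a_R[OF x])
qed

lemma H_nabla:
  assumes "horizontal A" "horizontal B" "horizontal C" and x: "x \<in> V"
  shows "2 * H (nabla (Gs L) A B x) (C x) x = koszul_form A B C x"
  using koszul_horizontal[OF _ assms(2-4), of A] assms by (simp add: horizontal_def Gs_def)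

end

text \<open>\<open>H\<close> ignores the component of \<open>z\<close> along \<open>R\<close>, and
  the rest of \<open>z\<close> is a combination of horizontal fields, for which the Koszul formula
  contains only \<open>H\<close>.\<close>

lemma H_nabla_indep:
  assumes X: "horizontal X" "horizontal Y" and x: "x \<in> V"
    and span: "\<And>w. a w x = 0 \<Longrightarrow> \<exists>p q. w = p *\<^sub>R X x + q *\<^sub>R Y x"
    and L: "smooth_on V L" "\<And>x. x \<in> V \<Longrightarrow> L x > 0" and L': "smooth_on V L'" "\<And>x. x \<in> V \<Longrightarrow> L' x > 0"
    and AB: "horizontal A" "horizontal B"
  shows "H (nabla (Gs L) A B x) z x = H (nabla (Gs L') A B x) z x"
proof -
  have "a (z - a z x *\<^sub>R R x) x = 0" by (simp add: a_linear[OF x] a_R[OF x])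
  then obtain p q where "z - a z x *\<^sub>R R x = p *\<^sub>R X x + q *\<^sub>R Y x" using span by blast
  then have z: "z = p *\<^sub>R X x + q *\<^sub>R Y x + a z x *\<^sub>R R x" by (simp add: algebra_simps)
  have "H (nabla (Gs L) A B x) (C x) x = H (nabla (Gs L') A B x) (C x) x" if "horizontal C" for C
    using H_nabla[OF L AB that x] H_nabla[OF L' AB that x] by simp
  then show ?thesis
    using X by (subst (1 2) z) (simp add: H_linear[OF x] H_R_right[OF x])
qed

theorem curvature_splitting:
  assumes X: "horizontal X" and Y: "horizontal Y" and x: "x \<in> V"
    and span: "\<And>w. a w x = 0 \<Longrightarrow> \<exists>p q. w = p *\<^sub>R X x + q *\<^sub>R Y x"
  shows "\<exists>P D. \<forall>L. smooth_on V L \<longrightarrow> (\<forall>x\<in>V. L x > 0) \<longrightarrow>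
    Gs L (riem (Gs L) X Y Y x) (X x) x = P - 3 / 4 * (a (bracket X Y x) x)\<^sup>2 * L x + D / L x"
proof -
  let ?n = "\<lambda>A B. nabla (Gs (\<lambda>_. 1)) A B x"
  \<comment> \<open>By \<open>H_nabla_indep\<close> the last two terms are the same for all metrics
    of the family; the metric with L = 1 stands for all of them.\<close>
  define P where "P = fd (\<lambda>y. koszul_form Y Y X y / 2) x (X x) - fd (\<lambda>y. koszul_form X Y X y / 2) x (Y x)
    - koszul_form (bracket X Y) Y X x / 2 - H (?n Y Y) (?n X X) x + H (?n X Y) (?n Y X) x"
  define D where "D = ((neg_lie_deriv X Y x)\<^sup>2 - neg_lie_deriv X X x * neg_lie_deriv Y Y x) / 4"
  have one: "smooth_on V (\<lambda>_. 1::real)" "(1::real) > 0" using smooth_on_const[OF open_V] by auto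
  have sX: "smooth_on V X" "smooth_on V Y" using X Y by (auto simp: horizontal_def)
  have "Gs L (riem (Gs L) X Y Y x) (X x) x = P - 3 / 4 * (a (bracket X Y x) x)\<^sup>2 * L x + D / L x"
    if L: "smooth_on V L" "\<forall>x\<in>V. L x > 0" for L
  proof -
    have Lp: "\<And>x. x \<in> V \<Longrightarrow> L x > 0" using L(2) by blast
    interpret local_metric V "Gs L" by (rule local_metric_Gs[OF L(1) Lp])
    let ?N = "nabla (Gs L)"
    \<comment> \<open>The inner product of \<open>?N B Y\<close> with \<open>X\<close> is given by
      \<open>H\<close> alone. Metric compatibility trades the second covariant derivative for a
      derivative of this function and a product of first covariant derivatives.\<close>
    have second: "Gs L (nabla (Gs L) A (?N B Y) x) (X x) x = fd (\<lambda>y. koszul_form B Y X y / 2) x (A x)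
        - (H (?n B Y) (?n A X) x + L x * (a (?N B Y x) x * a (?N A X x) x))" if "horizontal A" "horizontal B" for A B
    proof -
      have s: "smooth_on V A" "smooth_on V B" using that by (auto simp: horizontal_def)
      have "fd (\<lambda>y. Gs L (?N B Y y) (X y) y) x = fd (\<lambda>y. koszul_form B Y X y / 2) x"
      proof (rule frechet_derivative_cong_open[OF open_V x])
        fix y assume y: "y \<in> V"
        show "Gs L (?N B Y y) (X y) y = koszul_form B Y X y / 2"
          using koszul_horizontal[OF L(1) Lp s(2) Y X y] that y by (simp add: horizontal_def)
      qed
      then have "fd (\<lambda>y. koszul_form B Y X y / 2) x (A x) =
          Gs L (nabla (Gs L) A (?N B Y) x) (X x) x + Gs L (?N B Y x) (?N A X x) x"
        using nabla_compatible[OF smooth_on_nabla[OF s(2) sX(2)] sX(1) x, of A] by simp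
      moreover have "H (?N B Y x) (?N A X x) x = H (?n B Y) (?n A X) x"
        using H_nabla_indep[OF X Y x span L(1) Lp one that(2) Y, of "?N A X x"]
          H_nabla_indep[OF X Y x span L(1) Lp one that(1) X, of "?n B Y"]
          sym_H[OF x, of "?n B Y"] by simp
      ultimately show ?thesis by (simp add: Gs_def)
    qed
    let ?c = "a (bracket X Y x) x" and ?l = "L x"
    have l: "?l > 0" using Lp x by simp
    have c: "a (bracket Y X x) x = - ?c"
      using a_linear(3)[OF x, of "fd Y x (X x)" "fd X x (Y x)"] a_linear(3)[OF x, of "fd X x (Y x)" "fd Y x (X x)"]
      by (simp add: bracket_def)
    have c0: "a (bracket Z Z x) x = 0" for Z by (simp add: bracket_def a_linear[OF x])
    \<comment> \<open>The bracket has the transverse component \<open>?c\<close>, and the reversed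
      bracket \<open>-?c\<close>; their product accounts for the extra term.\<close>
    have third: "Gs L (?N (bracket X Y) Y x) (X x) x = koszul_form (bracket X Y) Y X x / 2 + ?l * ?c\<^sup>2 / 2"
      using koszul_horizontal[OF L(1) Lp smooth_on_bracket[OF open_V sX] Y X x] c by (simp add: power2_eq_square)
    have t: "a (?N A B x) x = (neg_lie_deriv A B x / ?l + a (bracket A B x) x) / 2" if "horizontal A" "horizontal B" for A B
      using koszul_transverse[OF L(1) Lp that x] l by (simp add: field_simps)
    have "Gs L (riem (Gs L) X Y Y x) (X x) x =
       Gs L (nabla (Gs L) X (?N Y Y) x) (X x) x - Gs L (nabla (Gs L) Y (?N X Y) x) (X x) x
       - Gs L (?N (bracket X Y) Y x) (X x) x"
      by (simp add: riem_def G_linear[OF x])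
    also have "\<dots> = P - ?l * (a (?N Y Y x) x * a (?N X X x) x) + ?l * (a (?N X Y x) x * a (?N Y X x) x)
       - ?l * ?c\<^sup>2 / 2"
      unfolding second[OF X Y] second[OF Y X] third P_def by simp
    \<comment> \<open>The coefficient 3/4 is 1/2 from the bracket term plus 1/4 from the product of
      the transverse components of \<open>?N X Y\<close> and \<open>?N Y X\<close>, which contain
      \<open>?c\<close> with opposite signs.\<close>
    also have "\<dots> = P - 3 / 4 * ?c\<^sup>2 * ?l + D / ?l"
      unfolding t[OF X X] t[OF X Y] t[OF Y X] t[OF Y Y] c c0 D_def neg_lie_deriv_sym[OF x, of Y X]
      using l by (simp add: field_simps power2_eq_square)
    finally show ?thesis .
  qed
  then show ?thesis by blast
qed

end

section \<open>Riemannian metrics on manifolds\<close>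

locale smooth_manifold =
  fixes M :: "'a topology" and A :: "'a chart set"
  assumes smooth_atlas: "smooth_atlas M A"
begin

lemma is_chart: "c \<in> A \<Longrightarrow> is_chart M c"
  using smooth_atlas by (simp add: smooth_atlas_def)

lemma ex_chart: "p \<in> topspace M \<Longrightarrow> \<exists>c\<in>A. p \<in> fst c"
  using smooth_atlas by (auto simp: smooth_atlas_def)

lemma openin_chart: "c \<in> A \<Longrightarrow> openin M (fst c)"
  using is_chart by (auto simp: is_chart_def)

lemma chart_subset: "c \<in> A \<Longrightarrow> fst c \<subseteq> topspace M"
  using openin_chart openin_subset by blast

lemma homeo: "c \<in> A \<Longrightarrow> homeomorphic_map (subtopology M (fst c)) (top_of_set (snd c ` fst c)) (snd c)"
  using is_chart by (auto simp: is_chart_def)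

lemma inj_chart: "c \<in> A \<Longrightarrow> inj_on (snd c) (fst c)"
  using homeomorphic_imp_injective_map[OF homeo, of c] chart_subset by (simp add: Int_absorb1)

lemma chart_inv: "c \<in> A \<Longrightarrow> p \<in> fst c \<Longrightarrow> chart_inv c (snd c p) = p"
  using inj_chart by (simp add: chart_inv_def)

lemma open_chart_image:
  assumes "c \<in> A" "openin M U"
  shows "open (snd c ` (U \<inter> fst c))"
proof -
  have "openin (subtopology M (fst c)) (U \<inter> fst c)"
    using assms(2) by (auto simp: openin_subtopology)
  then have "openin (top_of_set (snd c ` fst c)) (snd c ` (U \<inter> fst c))"
    using homeomorphic_imp_open_map[OF homeo[OF assms(1)]] by (simp add: open_map_def)
  moreover have "open (snd c ` fst c)" using is_chart[OF assms(1)] by (simp add: is_chart_def)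
  ultimately show ?thesis using openin_open_eq by blast
qed

lemma open_chart_codomain: "c \<in> A \<Longrightarrow> open (snd c ` fst c)"
  using is_chart by (simp add: is_chart_def)

lemma openin_chart_preimage:
  assumes "c \<in> A" "open W"
  shows "openin M {p \<in> fst c. snd c p \<in> W}"
proof -
  have "openin (top_of_set (snd c ` fst c)) (snd c ` fst c \<inter> W)" using assms(2) by (simp add: openin_open_Int)
  from openin_continuous_map_preimage[OF homeomorphic_imp_continuous_map[OF homeo[OF assms(1)]] this]
  have "openin (subtopology M (fst c)) {p \<in> fst c. snd c p \<in> W}"
    using chart_subset[OF assms(1)] by (elim back_subst[of "openin _"]) auto
  then show ?thesis using openin_open_subtopology[OF openin_chart[OF assms(1)]] by simp
qed

lemma smooth_transition: "c \<in> A \<Longrightarrow> d \<in> A \<Longrightarrow> smooth_on (snd c ` (fst c \<inter> fst d)) (transition c d)"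
  using smooth_atlas by (simp add: smooth_atlas_def)

lemma open_overlap: "c \<in> A \<Longrightarrow> d \<in> A \<Longrightarrow> open (snd c ` (fst c \<inter> fst d))"
  using open_chart_image[of c "fst d"] openin_chart by (simp add: Int_commute)

lemma transition: "c \<in> A \<Longrightarrow> p \<in> fst c \<Longrightarrow> transition c d (snd c p) = snd d p"
  by (simp add: transition_def chart_inv)

lemma linear_transition:
  "c \<in> A \<Longrightarrow> d \<in> A \<Longrightarrow> p \<in> fst c \<Longrightarrow> p \<in> fst d \<Longrightarrow> linear (fd (transition c d) (snd c p))"
  by (rule smooth_on_linear_derivative[OF smooth_transition]) auto

lemma fd_transition_self:
  assumes "c \<in> A" "p \<in> fst c"
  shows "fd (transition c c) (snd c p) u = u"
proof -
  have "fd (transition c c) (snd c p) u = fd (\<lambda>x. x) (snd c p) u"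
    by (rule fd_cong[OF open_chart_codomain[OF assms(1)]]) (use assms in \<open>auto simp: transition\<close>)
  then show ?thesis by simp
qed

lemma fd_transition_compose:
  assumes c: "c \<in> A" and d: "d \<in> A" and e: "e \<in> A" and p: "p \<in> fst c" "p \<in> fst d" "p \<in> fst e"
  shows "fd (transition d e) (snd d p) (fd (transition c d) (snd c p) u) = fd (transition c e) (snd c p) u"
proof -
  have 1: "(transition c d has_derivative fd (transition c d) (snd c p)) (at (snd c p))"
    by (rule smooth_on_has_derivative[OF smooth_transition[OF c d]]) (use p in auto)
  have "(transition d e has_derivative fd (transition d e) (snd d p)) (at (snd d p))"
    by (rule smooth_on_has_derivative[OF smooth_transition[OF d e]]) (use p in auto)
  then have "(transition d e has_derivative fd (transition d e) (snd d p)) (at (transition c d (snd c p)))"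
    by (simp add: transition[OF c p(1)])
  from frechet_derivative_at[OF has_derivative_compose[OF 1 this], symmetric]
  have "fd (transition d e) (snd d p) (fd (transition c d) (snd c p) u) =
      fd (\<lambda>x. transition d e (transition c d x)) (snd c p) u" by simp
  also have "\<dots> = fd (transition c e) (snd c p) u"
    by (rule fd_cong[OF open_chart_image[OF c openin_Int[OF openin_chart[OF d] openin_chart[OF e]]]])
      (use p c d e in \<open>auto simp: transition\<close>)
  finally show ?thesis .
qed

lemma charts_at: "c \<in> charts_at A p \<longleftrightarrow> c \<in> A \<and> p \<in> fst c"
  by (simp add: charts_at_def)

lemma tvec_of_self: "c \<in> A \<Longrightarrow> p \<in> fst c \<Longrightarrow> tvec_of A c p u c = u"
  by (simp add: tvec_of_def charts_at fd_transition_self)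

lemma tvec_of_in_tangent_space:
  assumes "c \<in> A" "p \<in> fst c"
  shows "tvec_of A c p u \<in> tangent_space A p"
  using assms by (auto simp: tangent_space_def tvec_of_def charts_at fd_transition_compose simp del: split_paired_All)

lemma tangent_space_change:
  "v \<in> tangent_space A p \<Longrightarrow> c \<in> A \<Longrightarrow> d \<in> A \<Longrightarrow> p \<in> fst c \<Longrightarrow> p \<in> fst d \<Longrightarrow>
   v d = fd (transition c d) (snd c p) (v c)"
  unfolding tangent_space_def charts_at_def by blast

lemma tangent_space_outside: "v \<in> tangent_space A p \<Longrightarrow> c \<notin> charts_at A p \<Longrightarrow> v c = 0"
  unfolding tangent_space_def by blast

lemma tvec_of_coord:
  assumes "v \<in> tangent_space A p" "c \<in> A" "p \<in> fst c"
  shows "tvec_of A c p (v c) = v"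
proof (rule ext)
  fix d
  show "tvec_of A c p (v c) d = v d"
  proof (cases "d \<in> charts_at A p")
    case True
    then have "v d = fd (transition c d) (snd c p) (v c)"
      unfolding charts_at using tangent_space_change[OF assms(1,2) _ assms(3)] by blast
    with True show ?thesis by (simp only: tvec_of_def if_True)
  next
    case False
    then show ?thesis using tangent_space_outside[OF assms(1) False] by (simp add: tvec_of_def)
  qed
qed

text \<open>Since the entries of a compatible family determine each other, equality can be checked
  in a single chart.\<close>

lemma tangent_space_eqI:
  assumes "v \<in> tangent_space A p" "w \<in> tangent_space A p" "c \<in> A" "p \<in> fst c" "v c = w c"
  shows "v = w"
  using tvec_of_coord[OF assms(1,3,4)] tvec_of_coord[OF assms(2,3,4)] assms(5) by metis

lemma lincomb_in_tangent_space:
  assumes "u \<in> tangent_space A p" "v \<in> tangent_space A p"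
  shows "lincomb a u b v \<in> tangent_space A p"
proof -
  have "lincomb a u b v d = fd (transition c d) (snd c p) (lincomb a u b v c)"
    if "c \<in> charts_at A p" "d \<in> charts_at A p" for c d
  proof -
    have cd: "c \<in> A" "d \<in> A" "p \<in> fst c" "p \<in> fst d" using that by (auto simp: charts_at)
    show ?thesis
      unfolding lincomb_def tangent_space_change[OF assms(1) cd] tangent_space_change[OF assms(2) cd]
      by (simp add: linear_add[OF linear_transition[OF cd]] linear_cmul[OF linear_transition[OF cd]])
  qed
  moreover have "lincomb a u b v c = 0" if "c \<notin> charts_at A p" for c
    using tangent_space_outside[OF assms(1) that] tangent_space_outside[OF assms(2) that]
    by (simp add: lincomb_def)
  ultimately show ?thesis unfolding tangent_space_def by blast
qed

lemma tvec_of_lincomb: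
  assumes "c \<in> A" "p \<in> fst c"
  shows "tvec_of A c p (a *\<^sub>R u + b *\<^sub>R v) = lincomb a (tvec_of A c p u) b (tvec_of A c p v)"
proof (rule tangent_space_eqI[OF _ _ assms])
  show "lincomb a (tvec_of A c p u) b (tvec_of A c p v) \<in> tangent_space A p"
    by (intro lincomb_in_tangent_space tvec_of_in_tangent_space assms)
qed (simp_all add: assms tvec_of_in_tangent_space tvec_of_self lincomb_def)

lemma metric_eq_coord:
  assumes "c \<in> A" "p \<in> fst c" "u \<in> tangent_space A p" "v \<in> tangent_space A p"
  shows "g p u v = metric_coord A g c (u c) (v c) (snd c p)"
  using assms by (simp add: metric_coord_def chart_inv tvec_of_coord)

lemma smooth_vfieldD:
  assumes "smooth_vfield_on A U X"
  shows "p \<in> U \<Longrightarrow> X p \<in> tangent_space A p" "c \<in> A \<Longrightarrow> smooth_on (snd c ` (U \<inter> fst c)) (vf_coord X c)"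
  using assms by (auto simp: smooth_vfield_on_def)

lemma vf_coord: "c \<in> A \<Longrightarrow> p \<in> fst c \<Longrightarrow> vf_coord X c (snd c p) = X p c"
  by (simp add: vf_coord_def chart_inv)

end

section \<open>Chart independence of connection and curvature\<close>

locale riemannian_manifold = smooth_manifold M A for M :: "'a topology" and A +
  fixes g :: "'a metric"
  assumes riemannian: "riemannian_metric M A g"
begin

lemma g_sym: "p \<in> topspace M \<Longrightarrow> u \<in> tangent_space A p \<Longrightarrow> v \<in> tangent_space A p \<Longrightarrow> g p u v = g p v u"
  using riemannian by (simp add: riemannian_metric_def)

lemma g_lincomb: "p \<in> topspace M \<Longrightarrow> u \<in> tangent_space A p \<Longrightarrow> v \<in> tangent_space A p \<Longrightarrow> w \<in> tangent_space A p \<Longrightarrow>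
    g p (lincomb a u b v) w = a * g p u w + b * g p v w"
  using riemannian by (simp add: riemannian_metric_def)

lemma g_pos: "p \<in> topspace M \<Longrightarrow> v \<in> tangent_space A p \<Longrightarrow> v \<noteq> (\<lambda>c. 0) \<Longrightarrow> g p v v > 0"
  using riemannian by (simp add: riemannian_metric_def)

abbreviation "mc \<equiv> metric_coord A g"

lemma local_metric_chart:
  assumes c: "c \<in> A" and U: "openin M U"
  shows "local_metric (snd c ` (U \<inter> fst c)) (mc c)"
proof (rule local_metric.intro)
  show "open (snd c ` (U \<inter> fst c))" by (rule open_chart_image[OF c U])
  show "smooth_on (snd c ` (U \<inter> fst c)) (mc c u v)" for u v
    by (rule smooth_on_subset[where S="snd c ` fst c"]) (use riemannian c in \<open>auto simp: riemannian_metric_def\<close>)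
  fix x assume "x \<in> snd c ` (U \<inter> fst c)"
  then obtain p where p: "p \<in> fst c" "x = snd c p" by auto
  then have pt: "p \<in> topspace M" using chart_subset[OF c] by blast
  note t = tvec_of_in_tangent_space[OF c p(1)]
  have mc: "mc c u v x = g p (tvec_of A c p u) (tvec_of A c p v)" for u v
    using p chart_inv[OF c p(1)] by (simp add: metric_coord_def)
  have l: "mc c (a *\<^sub>R u + b *\<^sub>R v) w x = a * mc c u w x + b * mc c v w x" for a b u v w
    unfolding mc tvec_of_lincomb[OF c p(1)] by (rule g_lincomb[OF pt t t t])
  show "linear (\<lambda>u. mc c u v x)" for v
    using l[of 1 _ 1 _ v] l[of _ _ 0 0 v] by (intro linearI) simp_all
  show "mc c u v x = mc c v u x" for u v unfolding mc by (rule g_sym[OF pt t t])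
  show "mc c u u x > 0" if "u \<noteq> 0" for u
    unfolding mc using that tvec_of_self[OF c p(1), of u] by (intro g_pos[OF pt t]) auto
qed

text \<open>Both coordinate metrics evaluate the same \<open>g\<close> on the same tangent vectors.
  The chart's own domain stands last in each intersection, so that \<open>local_metric_chart\<close>
  applies with the remaining open set in the role of \<open>U\<close>.\<close>

lemma local_isometry_transition:
  assumes c: "c \<in> A" and d: "d \<in> A" and U: "openin M U"
  shows "local_isometry (snd c ` (U \<inter> fst d \<inter> fst c)) (snd d ` (U \<inter> fst c \<inter> fst d)) (mc c) (mc d) (transition c d)"
proof (intro local_isometry.intro local_metric_chart local_isometry_axioms.intro openin_Int U openin_chart c d)
  show "smooth_on (snd c ` (U \<inter> fst d \<inter> fst c)) (transition c d)"
    by (rule smooth_on_subset[OF smooth_transition[OF c d]]) auto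
  fix x assume "x \<in> snd c ` (U \<inter> fst d \<inter> fst c)"
  then obtain p where p: "p \<in> U" "p \<in> fst c" "p \<in> fst d" and x: "x = snd c p" by auto
  show "transition c d x \<in> snd d ` (U \<inter> fst c \<inter> fst d)" using p by (auto simp: x transition[OF c])
  show "surj (fd (transition c d) x)"
    unfolding x by (rule surjI[where f="fd (transition d c) (snd d p)"]) (simp add: fd_transition_compose[OF d c d] p fd_transition_self[OF d])
  fix u v
  have "tvec_of A d p (fd (transition c d) (snd c p) u) = tvec_of A c p u" for u
    by (rule tangent_space_eqI[OF tvec_of_in_tangent_space tvec_of_in_tangent_space, where c=d])
      (use p c d in \<open>simp_all add: tvec_of_self, simp add: tvec_of_def charts_at\<close>)
  then show "mc c u v x = mc d (fd (transition c d) x u) (fd (transition c d) x v) (transition c d x)"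
    unfolding metric_coord_def x transition[OF c p(2)] chart_inv[OF c p(2)] chart_inv[OF d p(3)] by simp
qed

lemma related_vf_coord:
  assumes c: "c \<in> A" and d: "d \<in> A" and U: "openin M U" and X: "smooth_vfield_on A U X"
  shows "local_isometry.related (snd c ` (U \<inter> fst d \<inter> fst c)) (snd d ` (U \<inter> fst c \<inter> fst d))
     (transition c d) (vf_coord X c) (vf_coord X d)"
proof -
  interpret local_isometry "snd c ` (U \<inter> fst d \<inter> fst c)" "snd d ` (U \<inter> fst c \<inter> fst d)" "mc c" "mc d" "transition c d"
    by (rule local_isometry_transition[OF c d U])
  have "smooth_on (snd c ` (U \<inter> fst d \<inter> fst c)) (vf_coord X c)"
    by (rule smooth_on_subset[OF smooth_vfieldD(2)[OF X c]]) auto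
  moreover have "smooth_on (snd d ` (U \<inter> fst c \<inter> fst d)) (vf_coord X d)"
    by (rule smooth_on_subset[OF smooth_vfieldD(2)[OF X d]]) auto
  moreover have "vf_coord X d (transition c d (snd c p)) = fd (transition c d) (snd c p) (vf_coord X c (snd c p))"
    if "p \<in> U" "p \<in> fst c" "p \<in> fst d" for p
    using tangent_space_change[OF smooth_vfieldD(1)[OF X that(1)] c d that(2,3)]
    by (simp add: transition[OF c that(2)] vf_coord c d that)
  ultimately show ?thesis by (auto simp: related_def)
qed

lemma smooth_vfieldI:
  assumes U: "openin M U"
    and smooth: "\<And>c. c \<in> A \<Longrightarrow> smooth_on (snd c ` (U \<inter> fst c)) (vf_coord X c)"
    and related: "\<And>c d. c \<in> A \<Longrightarrow> d \<in> A \<Longrightarrow>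
      local_isometry.related (snd c ` (U \<inter> fst d \<inter> fst c)) (snd d ` (U \<inter> fst c \<inter> fst d))
       (transition c d) (vf_coord X c) (vf_coord X d)"
    and outside: "\<And>p c. c \<notin> charts_at A p \<Longrightarrow> X p c = 0"
  shows "smooth_vfield_on A U X"
proof -
  have "X p d = fd (transition c d) (snd c p) (X p c)"
    if p: "p \<in> U" "p \<in> fst c" "p \<in> fst d" and c: "c \<in> A" and d: "d \<in> A" for p c d
  proof -
    interpret local_isometry "snd c ` (U \<inter> fst d \<inter> fst c)" "snd d ` (U \<inter> fst c \<inter> fst d)" "mc c" "mc d" "transition c d"
      by (rule local_isometry_transition[OF c d U])
    from relatedD(3)[OF related[OF c d], of "snd c p"] p
    show ?thesis by (simp add: transition[OF c p(2)] vf_coord c d p)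
  qed
  then show ?thesis using smooth outside by (auto simp: smooth_vfield_on_def tangent_space_def charts_at simp del: split_paired_All)
qed

lemma vf_coord_cov_deriv:
  assumes "c \<in> A" "x \<in> snd c ` fst c"
  shows "vf_coord (cov_deriv A g X Y) c x = nabla (mc c) (vf_coord X c) (vf_coord Y c) x"
  using assms by (auto simp: vf_coord_def chart_inv cov_deriv_def charts_at nabla_def christoffel_def gamma_def)

lemma vf_coord_lie_bracket:
  assumes "c \<in> A" "x \<in> snd c ` fst c"
  shows "vf_coord (lie_bracket A X Y) c x = bracket (vf_coord X c) (vf_coord Y c) x"
  using assms by (auto simp: vf_coord_def chart_inv lie_bracket_def charts_at bracket_def)

text \<open>The chart entries of the covariant derivative fit together because \<open>nabla\<close>
  respects relatedness under transition maps. Iterated, this makes the curvature vector tangent, as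
  the passage to coordinates in \<open>metric_eq_coord\<close> demands.\<close>

lemma smooth_cov_deriv:
  assumes U: "openin M U" and X: "smooth_vfield_on A U X" and Y: "smooth_vfield_on A U Y"
  shows "smooth_vfield_on A U (cov_deriv A g X Y)"
proof (rule smooth_vfieldI[OF U])
  fix c assume c: "c \<in> A"
  interpret U: local_metric "snd c ` (U \<inter> fst c)" "mc c" by (rule local_metric_chart[OF c U])
  show "smooth_on (snd c ` (U \<inter> fst c)) (vf_coord (cov_deriv A g X Y) c)"
    by (rule smooth_on_cong[OF U.open_V _ U.smooth_on_nabla[OF smooth_vfieldD(2)[OF X c] smooth_vfieldD(2)[OF Y c]]])
      (use c in \<open>auto simp: vf_coord_cov_deriv\<close>)
  fix d assume d: "d \<in> A"
  interpret local_isometry "snd c ` (U \<inter> fst d \<inter> fst c)" "snd d ` (U \<inter> fst c \<inter> fst d)" "mc c" "mc d" "transition c d"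
    by (rule local_isometry_transition[OF c d U])
  note r = related_nabla[OF related_vf_coord[OF c d U X] related_vf_coord[OF c d U Y]]
  have "smooth_on (snd c ` (U \<inter> fst d \<inter> fst c)) (vf_coord (cov_deriv A g X Y) c)"
    by (rule smooth_on_cong[OF V.open_V _ relatedD(1)[OF r]]) (use c in \<open>auto simp: vf_coord_cov_deriv\<close>)
  moreover have "smooth_on (snd d ` (U \<inter> fst c \<inter> fst d)) (vf_coord (cov_deriv A g X Y) d)"
    by (rule smooth_on_cong[OF W.open_V _ relatedD(2)[OF r]]) (use d in \<open>auto simp: vf_coord_cov_deriv\<close>)
  moreover have "vf_coord (cov_deriv A g X Y) d (transition c d x) = fd (transition c d) x (vf_coord (cov_deriv A g X Y) c x)"
    if x: "x \<in> snd c ` (U \<inter> fst d \<inter> fst c)" for x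
  proof -
    have "x \<in> snd c ` fst c" "transition c d x \<in> snd d ` fst d" using x maps_to[OF x] by auto
    then show ?thesis using relatedD(3)[OF r x] by (simp add: vf_coord_cov_deriv c d)
  qed
  ultimately show "related (vf_coord (cov_deriv A g X Y) c) (vf_coord (cov_deriv A g X Y) d)"
    by (simp add: related_def)
qed (simp add: cov_deriv_def)

lemma smooth_lie_bracket:
  assumes U: "openin M U" and X: "smooth_vfield_on A U X" and Y: "smooth_vfield_on A U Y"
  shows "smooth_vfield_on A U (lie_bracket A X Y)"
proof (rule smooth_vfieldI[OF U])
  fix c assume c: "c \<in> A"
  note o = open_chart_image[OF c U]
  show "smooth_on (snd c ` (U \<inter> fst c)) (vf_coord (lie_bracket A X Y) c)"
    by (rule smooth_on_cong[OF o _ smooth_on_bracket[OF o smooth_vfieldD(2)[OF X c] smooth_vfieldD(2)[OF Y c]]])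
      (use c in \<open>auto simp: vf_coord_lie_bracket\<close>)
  fix d assume d: "d \<in> A"
  interpret local_isometry "snd c ` (U \<inter> fst d \<inter> fst c)" "snd d ` (U \<inter> fst c \<inter> fst d)" "mc c" "mc d" "transition c d"
    by (rule local_isometry_transition[OF c d U])
  note r = related_bracket[OF related_vf_coord[OF c d U X] related_vf_coord[OF c d U Y]]
  have "smooth_on (snd c ` (U \<inter> fst d \<inter> fst c)) (vf_coord (lie_bracket A X Y) c)"
    by (rule smooth_on_cong[OF V.open_V _ relatedD(1)[OF r]]) (use c in \<open>auto simp: vf_coord_lie_bracket\<close>)
  moreover have "smooth_on (snd d ` (U \<inter> fst c \<inter> fst d)) (vf_coord (lie_bracket A X Y) d)"
    by (rule smooth_on_cong[OF W.open_V _ relatedD(2)[OF r]]) (use d in \<open>auto simp: vf_coord_lie_bracket\<close>)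
  moreover have "vf_coord (lie_bracket A X Y) d (transition c d x) = fd (transition c d) x (vf_coord (lie_bracket A X Y) c x)"
    if x: "x \<in> snd c ` (U \<inter> fst d \<inter> fst c)" for x
  proof -
    have "x \<in> snd c ` fst c" "transition c d x \<in> snd d ` fst d" using x maps_to[OF x] by auto
    then show ?thesis using relatedD(3)[OF r x] by (simp add: vf_coord_lie_bracket c d)
  qed
  ultimately show "related (vf_coord (lie_bracket A X Y) c) (vf_coord (lie_bracket A X Y) d)"
    by (simp add: related_def)
qed (simp add: lie_bracket_def)

lemma riemann_in_tangent_space:
  assumes U: "openin M U" and p: "p \<in> U"
    and X: "smooth_vfield_on A U X" and Y: "smooth_vfield_on A U Y" and Z: "smooth_vfield_on A U Z"
  shows "riemann_curvature A g X Y Z p \<in> tangent_space A p"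
proof -
  let ?D = "cov_deriv A g"
  have t: "?D X (?D Y Z) p \<in> tangent_space A p" "?D Y (?D X Z) p \<in> tangent_space A p"
      "?D (lie_bracket A X Y) Z p \<in> tangent_space A p"
    by (rule smooth_vfieldD(1)[OF _ p], intro smooth_cov_deriv smooth_lie_bracket U X Y Z)+
  have "riemann_curvature A g X Y Z p = lincomb 1 (lincomb 1 (?D X (?D Y Z) p) (- 1) (?D Y (?D X Z) p)) (- 1) (?D (lie_bracket A X Y) Z p)"
    by (simp add: riemann_curvature_def lincomb_def)
  then show ?thesis using t by (simp add: lincomb_in_tangent_space)
qed

lemma riemann_coord:
  assumes c: "c \<in> A" and p: "p \<in> fst c"
  shows "riemann_curvature A g X Y Z p c = riem (mc c) (vf_coord X c) (vf_coord Y c) (vf_coord Z c) (snd c p)"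
proof -
  note o = open_chart_codomain[OF c]
  have px: "snd c p \<in> snd c ` fst c" using p by auto
  have cd: "cov_deriv A g X Y p c = nabla (mc c) (vf_coord X c) (vf_coord Y c) (snd c p)" for X Y
    using vf_coord_cov_deriv[OF c px] by (simp add: vf_coord[OF c p])
  have 2: "nabla (mc c) (vf_coord X c) (vf_coord (cov_deriv A g Y Z) c) (snd c p) =
     nabla (mc c) (vf_coord X c) (nabla (mc c) (vf_coord Y c) (vf_coord Z c)) (snd c p)" for X Y Z
  proof -
    \<comment> \<open>The inner covariant derivative is differentiated again, so agreement at
      \<open>p\<close> alone is too weak; it holds on the whole open image of the chart.\<close>
    have "fd (vf_coord (cov_deriv A g Y Z) c) (snd c p) w = fd (nabla (mc c) (vf_coord Y c) (vf_coord Z c)) (snd c p) w" for w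
      by (rule fd_cong[OF o px]) (rule vf_coord_cov_deriv[OF c])
    then show ?thesis
      unfolding nabla_def[of _ _ "vf_coord (cov_deriv A g Y Z) c"] vf_coord_cov_deriv[OF c px]
        nabla_def[of _ _ "nabla (mc c) (vf_coord Y c) (vf_coord Z c)"] by simp
  qed
  have 3: "nabla (mc c) (vf_coord (lie_bracket A X Y) c) (vf_coord Z c) (snd c p) =
     nabla (mc c) (bracket (vf_coord X c) (vf_coord Y c)) (vf_coord Z c) (snd c p)"
    unfolding nabla_def vf_coord_lie_bracket[OF c px] ..
  show ?thesis unfolding riemann_curvature_def cd 2 3 riem_def ..
qed

lemma curvature_coord:
  assumes c: "c \<in> A" and p: "p \<in> fst c" and U: "openin M U" "p \<in> U"
    and X: "smooth_vfield_on A U X" and Y: "smooth_vfield_on A U Y"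
  shows "g p (riemann_curvature A g X Y Y p) (X p) =
    mc c (local_metric.riem_tensor (mc c) (snd c p) (X p c) (Y p c) (Y p c)) (X p c) (snd c p)"
proof -
  interpret V: local_metric "snd c ` (U \<inter> fst c)" "mc c" by (rule local_metric_chart[OF c U(1)])
  have "snd c p \<in> snd c ` (U \<inter> fst c)" using p U by auto
  from V.riem_eq_riem_tensor[OF smooth_vfieldD(2)[OF X c] smooth_vfieldD(2)[OF Y c] smooth_vfieldD(2)[OF Y c] this]
  show ?thesis
    using metric_eq_coord[where g=g, OF c p riemann_in_tangent_space[OF U X Y Y] smooth_vfieldD(1)[OF X U(2)]]
    by (simp add: riemann_coord[OF c p] vf_coord[OF c p])
qed

text \<open>Eliminates the definite description: any one pair of fields may be used. The curvature
  depends only on the two vectors at \<open>p\<close>, and a change of basis multiplies numerator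
  and denominator by the same nonzero square.\<close>

theorem sectional_curvature_eq:
  assumes U: "openin M U" "p \<in> U" and X: "smooth_vfield_on A U X" and Y: "smooth_vfield_on A U Y"
    and ind: "lin_indep (X p) (Y p)" and P: "P = plane_of (X p) (Y p)"
  shows "sectional_curvature M A g p P = g p (riemann_curvature A g X Y Y p) (X p) /
     (g p (X p) (X p) * g p (Y p) (Y p) - (g p (X p) (Y p))\<^sup>2)"
  unfolding sectional_curvature_def
proof (rule the_equality)
  obtain c where c: "c \<in> A" and p: "p \<in> fst c" using ex_chart U openin_subset by blast
  note g = metric_eq_coord[where g=g, OF c p]
  note XY = smooth_vfieldD(1)[OF X U(2)] smooth_vfieldD(1)[OF Y U(2)]
  let ?G = "\<lambda>u v. mc c u v (snd c p)"
  let ?K = "\<lambda>u v. ?G (local_metric.riem_tensor (mc c) (snd c p) u v v) u / (?G u u * ?G v v - (?G u v)\<^sup>2)"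
  have Keq: "g p (riemann_curvature A g X Y Y p) (X p) / (g p (X p) (X p) * g p (Y p) (Y p) - (g p (X p) (Y p))\<^sup>2)
      = ?K (X p c) (Y p c)" if "openin M U" "p \<in> U" "smooth_vfield_on A U X" "smooth_vfield_on A U Y" for U X Y
    using smooth_vfieldD(1)[OF that(3,2)] smooth_vfieldD(1)[OF that(4,2)]
    by (simp add: curvature_coord[OF c p that] g)
  have main: "?K (X p c) (Y p c) = ?K (X' p c) (Y' p c)"
    if U': "openin M U'" "p \<in> U'" and X': "smooth_vfield_on A U' X'" and Y': "smooth_vfield_on A U' Y'"
      and ind': "lin_indep (X' p) (Y' p)" and P': "plane_of (X' p) (Y' p) = P" for U' X' Y'
  proof -
    interpret V: local_metric "snd c ` (U \<inter> fst c)" "mc c" by (rule local_metric_chart[OF c U(1)])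
    have px: "snd c p \<in> snd c ` (U \<inter> fst c)" using p U by auto
    have "X' p = lincomb 1 (X' p) 0 (Y' p)" "Y' p = lincomb 0 (X' p) 1 (Y' p)" by (simp_all add: lincomb_def)
    then have "X' p \<in> P" "Y' p \<in> P" unfolding P'[symmetric] plane_of_def by blast+
    then obtain a b c' d where e: "X' p = lincomb a (X p) b (Y p)" "Y' p = lincomb c' (X p) d (Y p)"
      unfolding P plane_of_def by blast
    have ec: "X' p c = a *\<^sub>R X p c + b *\<^sub>R Y p c" "Y' p c = c' *\<^sub>R X p c + d *\<^sub>R Y p c"
      by (simp_all add: e lincomb_def)
    let ?\<delta> = "a * d - b * c'"
    have nz: "?\<delta> \<noteq> 0"
    proof
      assume z: "?\<delta> = 0"
      \<comment> \<open>The adjugate matrix recovers determinant multiples of the old basis. With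
        determinant zero these are relations between \<open>X' p\<close> and
        \<open>Y' p\<close>.\<close>
      have "lincomb d (X' p) (- b) (Y' p) = (\<lambda>e. ?\<delta> *\<^sub>R X p e)"
        "lincomb (- c') (X' p) a (Y' p) = (\<lambda>e. ?\<delta> *\<^sub>R Y p e)"
        unfolding e by (auto simp: lincomb_def algebra_simps)
      then have "d = 0" "b = 0" "c' = 0" "a = 0"
        using z ind'[unfolded lin_indep_def, rule_format, of d "- b"]
          ind'[unfolded lin_indep_def, rule_format, of "- c'" a] by auto
      then have "lincomb 1 (X' p) 0 (Y' p) = (\<lambda>c. 0)" by (simp add: e lincomb_def)
      then show False using ind' unfolding lin_indep_def by force
    qed
    have num: "?G (V.riem_tensor (snd c p) (X' p c) (Y' p c) (Y' p c)) (X' p c) = ?\<delta>\<^sup>2 * ?G (V.riem_tensor (snd c p) (X p c) (Y p c) (Y p c)) (X p c)"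
      by (rule V.riem_tensor_change_of_basis[OF px ec])
    have den: "?G (X' p c) (X' p c) * ?G (Y' p c) (Y' p c) - (?G (X' p c) (Y' p c))\<^sup>2 =
       ?\<delta>\<^sup>2 * (?G (X p c) (X p c) * ?G (Y p c) (Y p c) - (?G (X p c) (Y p c))\<^sup>2)"
      unfolding ec using V.sym_G[OF px, of "Y p c" "X p c"]
      by (simp add: V.G_linear[OF px] power2_eq_square algebra_simps)
    show ?thesis unfolding num den using nz by simp
  qed
  show "\<forall>U' X' Y'. openin M U' \<longrightarrow> p \<in> U' \<longrightarrow> smooth_vfield_on A U' X' \<longrightarrow> smooth_vfield_on A U' Y' \<longrightarrow>
     lin_indep (X' p) (Y' p) \<longrightarrow> plane_of (X' p) (Y' p) = P \<longrightarrow>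
     g p (riemann_curvature A g X Y Y p) (X p) / (g p (X p) (X p) * g p (Y p) (Y p) - (g p (X p) (Y p))\<^sup>2) =
     g p (riemann_curvature A g X' Y' Y' p) (X' p) / (g p (X' p) (X' p) * g p (Y' p) (Y' p) - (g p (X' p) (Y' p))\<^sup>2)"
    using Keq main Keq[OF U X Y] by simp
  fix k assume "\<forall>U' X' Y'. openin M U' \<longrightarrow> p \<in> U' \<longrightarrow> smooth_vfield_on A U' X' \<longrightarrow> smooth_vfield_on A U' Y' \<longrightarrow>
     lin_indep (X' p) (Y' p) \<longrightarrow> plane_of (X' p) (Y' p) = P \<longrightarrow>
     k = g p (riemann_curvature A g X' Y' Y' p) (X' p) / (g p (X' p) (X' p) * g p (Y' p) (Y' p) - (g p (X' p) (Y' p))\<^sup>2)"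
  then show "k = g p (riemann_curvature A g X Y Y p) (X p) / (g p (X p) (X p) * g p (Y p) (Y p) - (g p (X p) (Y p))\<^sup>2)"
    using U X Y ind P by blast
qed

end

section \<open>Cutoff functions on closed manifolds\<close>

text \<open>The strict Cauchy-Schwarz inequality, from positivity on \<open>?w\<close>, the part of
  \<open>u\<close> orthogonal to \<open>v\<close>, scaled to avoid a division.\<close>

lemma (in local_metric) gram_pos:
  assumes x: "x \<in> V" and ind: "\<And>a b. a *\<^sub>R u + b *\<^sub>R v = 0 \<Longrightarrow> a = 0 \<and> b = 0"
  shows "G u u x * G v v x - (G u v x)\<^sup>2 > 0"
proof -
  have "v \<noteq> 0" using ind[of 0 1] by auto
  then have v: "G v v x > 0" by (rule pos_G[OF x])
  let ?w = "G v v x *\<^sub>R u - G u v x *\<^sub>R v"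
  have "?w \<noteq> 0" using ind[of "G v v x" "- G u v x"] v by auto
  then have "G ?w ?w x > 0" by (rule pos_G[OF x])
  moreover have "G ?w ?w x = G v v x * (G u u x * G v v x - (G u v x)\<^sup>2)"
    using sym_G[OF x, of v u] by (simp add: G_linear[OF x] power2_eq_square algebra_simps)
  ultimately show ?thesis using v by (simp add: zero_less_mult_iff)
qed

text \<open>A suitable h is obtained from an arbitrary metric by projecting both arguments to the
  kernel of \<open>a\<close> along \<open>R\<close>.\<close>

lemma (in local_metric) contact_splitting_projection:
  assumes smooth_a: "\<And>u. smooth_on V (a u)" and linear_a: "\<And>x. x \<in> V \<Longrightarrow> linear (\<lambda>u. a u x)"
    and smooth_R: "smooth_on V R" and a_R: "\<And>x. x \<in> V \<Longrightarrow> a (R x) x = 1"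
  shows "contact_splitting V (\<lambda>u v x. G (u - a u x *\<^sub>R R x) (v - a v x *\<^sub>R R x) x) a R"
proof (rule contact_splitting.intro)
  show "smooth_on V (\<lambda>x. G (u - a u x *\<^sub>R R x) (v - a v x *\<^sub>R R x) x)" for u v
    by (rule smooth_on_G) (intro smooth_on_diff smooth_on_scaleR smooth_on_const open_V smooth_a smooth_R)+
  fix x assume x: "x \<in> V"
  note al = linear_add[OF linear_a[OF x]] linear_cmul[OF linear_a[OF x]]
  show "linear (\<lambda>u. G (u - a u x *\<^sub>R R x) (v - a v x *\<^sub>R R x) x)" for v
    by (rule linearI) (simp_all add: al G_linear[OF x] algebra_simps)
  show "G (u - a u x *\<^sub>R R x) (v - a v x *\<^sub>R R x) x = G (v - a v x *\<^sub>R R x) (u - a u x *\<^sub>R R x) x" for u v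
    by (rule sym_G[OF x])
  show "G (R x - a (R x) x *\<^sub>R R x) (u - a u x *\<^sub>R R x) x = 0" for u
    by (simp add: a_R[OF x] G_linear[OF x])
  show "G (u - a u x *\<^sub>R R x) (u - a u x *\<^sub>R R x) x > 0" if "a u x = 0" "u \<noteq> 0" for u
    using pos_G[OF x that(2)] that(1) by simp
qed (rule open_V smooth_a linear_a smooth_R a_R; assumption?)+

lemma contact_splitting_subset:
  assumes "contact_splitting V H a R" "W \<subseteq> V" "open W"
  shows "contact_splitting W H a R"
proof -
  interpret contact_splitting V H a R by fact
  show ?thesis
    using assms(2,3) linear_H sym_H linear_a a_R H_R pos_H
      smooth_on_subset[OF smooth_H assms(2)] smooth_on_subset[OF smooth_a assms(2)] smooth_on_subset[OF smooth_R assms(2)]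
    by (intro contact_splitting.intro) blast+
qed

context smooth_manifold
begin

lemma riemannian_metricI:
  assumes "\<And>c. c \<in> A \<Longrightarrow> local_metric (snd c ` fst c) (metric_coord A g c)"
  shows "riemannian_metric M A g"
  unfolding riemannian_metric_def
proof (intro conjI ballI allI impI)
  fix p assume p: "p \<in> topspace M"
  then obtain c where c: "c \<in> A" and pc: "p \<in> fst c" using ex_chart by blast
  interpret local_metric "snd c ` fst c" "metric_coord A g c" by (rule assms[OF c])
  have x: "snd c p \<in> snd c ` fst c" using pc by simp
  note e = metric_eq_coord[OF c pc]
  fix u assume u: "u \<in> tangent_space A p"
  { assume "u \<noteq> (\<lambda>c. 0)"
    moreover have "(\<lambda>c. 0) \<in> tangent_space A p"
      using lincomb_in_tangent_space[OF u u, of 0 0] by (simp add: lincomb_def)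
    ultimately have "u c \<noteq> 0" using tangent_space_eqI[OF u _ c pc] by blast
    then show "g p u u > 0" using pos_G[OF x] by (simp add: e[OF u u]) }
  fix v assume v: "v \<in> tangent_space A p"
  show "g p u v = g p v u" by (simp only: e[OF u v] e[OF v u] sym_G[OF x])
  fix w a b assume w: "w \<in> tangent_space A p"
  show "g p (lincomb a u b v) w = a * g p u w + b * g p v w"
    unfolding e[OF u w] e[OF v w] e[OF lincomb_in_tangent_space[OF u v] w]
    by (simp add: lincomb_def G_linear[OF x])
next
  fix c u v assume "c \<in> A"
  then show "smooth_on (snd c ` fst c) (metric_coord A g c u v)"
    using assms local_metric.smooth_G by blast
qed

lemma smooth_vfield_tvec_of:
  assumes c: "c \<in> A" and \<gamma>: "smooth_on (snd c ` fst c) \<gamma>"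
  shows "smooth_vfield_on A (fst c) (\<lambda>p. tvec_of A c p (\<gamma> (snd c p)))"
  unfolding smooth_vfield_on_def
proof (intro conjI ballI)
  show "tvec_of A c p (\<gamma> (snd c p)) \<in> tangent_space A p" if "p \<in> fst c" for p
    by (rule tvec_of_in_tangent_space[OF c that])
  fix d assume d: "d \<in> A"
  note o = open_overlap[OF d c] open_overlap[OF c d]
  have s: "smooth_on (snd c ` (fst c \<inter> fst d)) (\<lambda>x. fd (transition c d) x (\<gamma> x))"
    by (intro smooth_on_fd_apply o smooth_transition c d smooth_on_subset[OF \<gamma>]) auto
  have "smooth_on (snd d ` (fst d \<inter> fst c)) (\<lambda>y. (\<lambda>x. fd (transition c d) x (\<gamma> x)) (transition d c y))"
    by (rule smooth_on_compose[where f="\<lambda>x. fd (transition c d) x (\<gamma> x)", OF o _ smooth_transition[OF d c] s])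
      (use d in \<open>auto simp: transition\<close>)
  then show "smooth_on (snd d ` (fst c \<inter> fst d)) (vf_coord (\<lambda>p. tvec_of A c p (\<gamma> (snd c p))) d)"
    unfolding Int_commute[of "fst c"]
    by (rule smooth_on_cong[OF o(1), rotated])
      (use d in \<open>auto simp: transition vf_coord tvec_of_def charts_at\<close>)
qed

lemma smooth_functionD: "smooth_function A f \<Longrightarrow> c \<in> A \<Longrightarrow> smooth_on (snd c ` fst c) (\<lambda>x. f (chart_inv c x))"
  by (simp add: smooth_function_def comp_def)

text \<open>The domain of \<open>d\<close> is covered by its overlap with the domain of
  \<open>c\<close>, where smoothness is assumed, and the open complement of \<open>K\<close>, where
  \<open>F\<close> is zero.\<close>

lemma smooth_cutoff:
  fixes F :: "'a \<Rightarrow> 'b::real_normed_vector"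
  assumes c: "c \<in> A" and d: "d \<in> A" and K: "closedin M K" "K \<subseteq> fst c"
    and supp: "\<And>q. q \<in> fst d \<Longrightarrow> q \<notin> K \<Longrightarrow> F q = 0"
    and smooth: "smooth_on (snd d ` (fst d \<inter> fst c)) (\<lambda>x. F (chart_inv d x))"
  shows "smooth_on (snd d ` fst d) (\<lambda>x. F (chart_inv d x))"
proof (rule smooth_on_locally)
  fix x assume "x \<in> snd d ` fst d"
  then obtain q where q: "q \<in> fst d" "x = snd d q" by auto
  show "\<exists>T. open T \<and> x \<in> T \<and> smooth_on T (\<lambda>x. F (chart_inv d x))"
  proof (cases "q \<in> fst c")
    case True
    then show ?thesis using smooth open_overlap[OF d c] q by blast
  next
    case False
    let ?T = "snd d ` ((topspace M - K) \<inter> fst d)"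
    have o: "open ?T" by (rule open_chart_image[OF d openin_diff[OF openin_topspace K(1)]])
    have "smooth_on ?T (\<lambda>x. F (chart_inv d x))"
      by (rule smooth_on_cong[OF o _ smooth_on_const[OF o, of 0]]) (use d supp in \<open>auto simp: chart_inv\<close>)
    moreover have "x \<in> ?T" using q False K(2) chart_subset[OF d] by auto
    ultimately show ?thesis using o by blast
  qed
qed

lemma compact_chart_set:
  assumes c: "c \<in> A" and C: "compact C" "C \<subseteq> snd c ` fst c"
  shows "compactin M {p \<in> fst c. snd c p \<in> C}"
proof -
  let ?K = "{p \<in> fst c. snd c p \<in> C}"
  have "snd c ` ?K = C" using C(2) by auto
  moreover have "compactin (top_of_set (snd c ` fst c)) C" using C by (simp add: compactin_subtopology)
  ultimately have "compactin (subtopology M (fst c)) ?K"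
    using homeomorphic_map_compactness[OF homeo[OF c], of ?K] chart_subset[OF c] by auto
  then show ?thesis by (simp add: compactin_subtopology)
qed

lemma continuous_map_smooth_function:
  assumes f: "smooth_function A f"
  shows "continuous_map M euclideanreal f"
  unfolding continuous_map_def
proof (intro conjI allI impI)
  fix W :: "real set" assume "openin euclideanreal W"
  then have W: "open W" by simp
  show "openin M {p \<in> topspace M. f p \<in> W}"
  proof (subst openin_subopen, safe)
    fix p assume p: "p \<in> topspace M" "f p \<in> W"
    then obtain c where c: "c \<in> A" and pc: "p \<in> fst c" using ex_chart by blast
    let ?T = "{x \<in> snd c ` fst c. f (chart_inv c x) \<in> W}"
    have "open ?T"
      using continuous_open_preimage[OF smooth_on_imp_continuous_on[OF smooth_functionD[OF f c]] open_chart_codomain[OF c] W]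
      by (simp add: vimage_def Int_def)
    from openin_chart_preimage[OF c this]
    have "openin M {p \<in> fst c. snd c p \<in> ?T}" .
    moreover have "{p \<in> fst c. snd c p \<in> ?T} \<subseteq> {p \<in> topspace M. f p \<in> W}"
    proof
      fix q assume "q \<in> {p \<in> fst c. snd c p \<in> ?T}"
      then have "q \<in> fst c" "f (chart_inv c (snd c q)) \<in> W" by blast+
      then show "q \<in> {p \<in> topspace M. f p \<in> W}" using chart_subset[OF c] by (auto simp: chart_inv[OF c])
    qed
    moreover have "p \<in> {p \<in> fst c. snd c p \<in> ?T}" using p pc by (simp add: chart_inv[OF c])
    ultimately show "\<exists>T. openin M T \<and> p \<in> T \<and> T \<subseteq> {p \<in> topspace M. f p \<in> W}" by blast
  qed
qed auto

end

section \<open>Finite families of cutoff functions and existence of metrics\<close>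

locale closed_manifold = smooth_manifold M A for M :: "'a topology" and A +
  assumes hausdorff: "Hausdorff_space M" and compact: "compact_space M"
begin

lemma smooth_function_bounded:
  assumes "smooth_function A f"
  obtains B where "\<And>p. p \<in> topspace M \<Longrightarrow> \<bar>f p\<bar> \<le> B"
proof -
  have "compactin euclideanreal (f ` topspace M)"
    using image_compactin[OF _ continuous_map_smooth_function[OF assms]] compact by (simp add: compact_space_def)
  then have "bounded (f ` topspace M)" by (simp add: compact_imp_bounded)
  then show ?thesis using that by (auto simp: bounded_iff)
qed

text \<open>The closed set \<open>K\<close> inside the chart domain is what lets
  \<open>smooth_cutoff\<close> extend products with local objects by zero.\<close>

definition cutoff where
  "cutoff c \<rho> \<longleftrightarrow> c \<in> A \<and> smooth_function A \<rho> \<and> (\<forall>p. \<rho> p \<ge> 0) \<and>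
     (\<exists>K. closedin M K \<and> K \<subseteq> fst c \<and> (\<forall>p. p \<notin> K \<longrightarrow> \<rho> p = 0))"

lemma ex_cutoff:
  assumes p: "p \<in> topspace M"
  shows "\<exists>c \<rho>. cutoff c \<rho> \<and> openin M {q \<in> topspace M. \<rho> q > 0} \<and> \<rho> p > 0"
proof -
  obtain c where c: "c \<in> A" and pc: "p \<in> fst c" using ex_chart[OF p] by blast
  obtain r where r: "r > 0" "cball (snd c p) r \<subseteq> snd c ` fst c"
    using open_chart_codomain[OF c] pc open_contains_cball by blast
  obtain b :: "real ^ 3 \<Rightarrow> real" where b: "smooth_on UNIV b" "\<And>y. b y \<ge> 0" "\<And>y. b y > 0 \<longleftrightarrow> y \<in> ball (snd c p) r"
    using smooth_bump[OF r(1)] by metis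
  define K where "K = {q \<in> fst c. snd c q \<in> cball (snd c p) r}"
  define \<rho> where "\<rho> q = (if q \<in> fst c then b (snd c q) else 0)" for q
  \<comment> \<open>\<open>K\<close> has to be closed in \<open>M\<close>, not merely in the chart
    domain: it is compact, being modelled on a closed ball, and \<open>M\<close> is
    Hausdorff.\<close>
  have K: "closedin M K"
    unfolding K_def using compactin_imp_closedin[OF hausdorff compact_chart_set[OF c compact_cball r(2)]] .
  have supp: "\<rho> q = 0" if "q \<notin> K" for q
  proof (cases "q \<in> fst c")
    case True
    then have "\<not> b (snd c q) > 0" using that b(3)[of "snd c q"] by (auto simp: K_def)
    then show ?thesis using b(2)[of "snd c q"] by (simp add: \<rho>_def)
  qed (simp add: \<rho>_def)
  have "smooth_on (snd d ` fst d) (\<lambda>x. \<rho> (chart_inv d x))" if d: "d \<in> A" for d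
  proof (rule smooth_cutoff[OF c d K _ supp])
    show "K \<subseteq> fst c" by (auto simp: K_def)
    have "smooth_on (snd d ` (fst d \<inter> fst c)) (\<lambda>x. b (transition d c x))"
      by (rule smooth_on_compose[OF open_overlap[OF d c] open_UNIV _ smooth_transition[OF d c] b(1)]) simp
    then show "smooth_on (snd d ` (fst d \<inter> fst c)) (\<lambda>x. \<rho> (chart_inv d x))"
      by (rule smooth_on_cong[OF open_overlap[OF d c], rotated]) (use d in \<open>auto simp: transition chart_inv \<rho>_def\<close>)
  qed
  then have "cutoff c \<rho>"
    unfolding cutoff_def smooth_function_def comp_def
  proof (intro conjI ballI allI exI[of _ K] impI)
    show "\<rho> q \<ge> 0" for q using b(2) by (simp add: \<rho>_def)
    show "K \<subseteq> fst c" by (auto simp: K_def)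
  qed (use c K supp in auto)
  moreover have "{q \<in> topspace M. \<rho> q > 0} = {q \<in> fst c. snd c q \<in> ball (snd c p) r}"
    using b(3) chart_subset[OF c] by (auto simp: \<rho>_def split: if_splits)
  then have "openin M {q \<in> topspace M. \<rho> q > 0}" using openin_chart_preimage[OF c open_ball] by simp
  moreover have "\<rho> p > 0" using pc b(3)[of "snd c p"] r(1) by (simp add: \<rho>_def)
  ultimately show ?thesis by blast
qed

text \<open>Takes the role of a partition of unity. Positivity of metrics and of \<alpha> on a field
  persists under nonnegative weights of which one is positive, so the functions are left without
  normalisation.\<close>

lemma ex_cutoffs:
  obtains I :: "('a chart \<times> ('a \<Rightarrow> real)) set"
  where "finite I" "\<And>c \<rho>. (c, \<rho>) \<in> I \<Longrightarrow> cutoff c \<rho>" "\<And>p. p \<in> topspace M \<Longrightarrow> \<exists>(c, \<rho>)\<in>I. \<rho> p > 0"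
proof -
  define S where "S = {(c, \<rho>). cutoff c \<rho> \<and> openin M {q \<in> topspace M. \<rho> q > 0}}"
  define P where "P i = {q \<in> topspace M. snd i q > 0}" for i :: "'a chart \<times> ('a \<Rightarrow> real)"
  have "topspace M \<subseteq> \<Union> (P ` S)" using ex_cutoff by (fastforce simp: S_def P_def)
  moreover have "\<And>U. U \<in> P ` S \<Longrightarrow> openin M U" by (auto simp: S_def P_def)
  ultimately obtain F where F: "finite F" "F \<subseteq> P ` S" "topspace M \<subseteq> \<Union> F"
    using compact unfolding compact_space_alt by (metis (no_types, lifting))
  then obtain I where I: "finite I" "I \<subseteq> S" "F = P ` I" by (metis finite_subset_image)
  show ?thesis
  proof (rule that[OF I(1)])
    show "cutoff c \<rho>" if "(c, \<rho>) \<in> I" for c \<rho> using I(2) that by (auto simp: S_def)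
    show "\<exists>(c, \<rho>)\<in>I. \<rho> p > 0" if "p \<in> topspace M" for p using F(3) I(3) that by (fastforce simp: P_def)
  qed
qed

lemma cutoff_pos: "cutoff c \<rho> \<Longrightarrow> \<rho> p > 0 \<Longrightarrow> p \<in> fst c"
  unfolding cutoff_def by (metis less_irrefl subsetD)

lemma smooth_cutoff_mult:
  fixes F :: "'a \<Rightarrow> 'b::real_normed_vector"
  assumes \<rho>: "cutoff c \<rho>" and d: "d \<in> A"
    and F: "smooth_on (snd d ` (fst d \<inter> fst c)) (\<lambda>x. F (chart_inv d x))"
  shows "smooth_on (snd d ` fst d) (\<lambda>x. \<rho> (chart_inv d x) *\<^sub>R F (chart_inv d x))"
proof -
  obtain K where K: "closedin M K" "K \<subseteq> fst c" "\<And>p. p \<notin> K \<Longrightarrow> \<rho> p = 0" and c: "c \<in> A" and s: "smooth_function A \<rho>"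
    using \<rho> unfolding cutoff_def by metis
  show ?thesis
  proof (rule smooth_cutoff[OF c d K(1,2), where F="\<lambda>p. \<rho> p *\<^sub>R F p"])
    show "smooth_on (snd d ` (fst d \<inter> fst c)) (\<lambda>x. \<rho> (chart_inv d x) *\<^sub>R F (chart_inv d x))"
      by (intro smooth_on_scaleR open_overlap d c F smooth_on_subset[OF smooth_functionD[OF s d]]) auto
  qed (simp add: K(3))
qed

lemma ex_riemannian_metric: "\<exists>k. riemannian_metric M A k"
proof -
  obtain I where I: "finite I" "\<And>c \<rho>. (c, \<rho>) \<in> I \<Longrightarrow> cutoff c \<rho>" "\<And>p. p \<in> topspace M \<Longrightarrow> \<exists>(c, \<rho>)\<in>I. \<rho> p > 0"
    using ex_cutoffs by metis
  \<comment> \<open>A weighted sum of the Euclidean inner products of the charts. Tangent vectors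
    have entry zero at charts not around \<open>p\<close>, so every summand is meaningful
    everywhere.\<close>
  define k where "k p u v = (\<Sum>i\<in>I. snd i p *\<^sub>R (u (fst i) \<bullet> v (fst i)))" for p and u v :: "'a tvec"
  have "riemannian_metric M A k"
  proof (rule riemannian_metricI)
    fix c assume c: "c \<in> A"
    show "local_metric (snd c ` fst c) (metric_coord A k c)"
    proof (rule local_metric.intro)
      show "open (snd c ` fst c)" by (rule open_chart_codomain[OF c])
      show "smooth_on (snd c ` fst c) (metric_coord A k c u v)" for u v
        unfolding metric_coord_def[abs_def] k_def
      proof (rule smooth_on_sum[OF open_chart_codomain[OF c]])
        fix i assume "i \<in> I"
        then have i: "cutoff (fst i) (snd i)" using I(2) by (cases i) simp
        then have ci: "fst i \<in> A" by (simp add: cutoff_def)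
        have s: "smooth_on (snd c ` (fst c \<inter> fst (fst i))) (\<lambda>x. tvec_of A c (chart_inv c x) w (fst i))" for w
          by (rule smooth_on_cong[OF open_overlap[OF c ci] _ smooth_on_derivative[OF smooth_transition[OF c ci], of w]])
            (use c ci in \<open>auto simp: tvec_of_def charts_at chart_inv\<close>)
        show "smooth_on (snd c ` fst c) (\<lambda>x. snd i (chart_inv c x) *\<^sub>R
            (tvec_of A c (chart_inv c x) u (fst i) \<bullet> tvec_of A c (chart_inv c x) v (fst i)))"
          by (rule smooth_cutoff_mult[OF i c, where F="\<lambda>p. tvec_of A c p u (fst i) \<bullet> tvec_of A c p v (fst i)"])
            (intro smooth_on_inner s open_overlap c ci)
      qed
      fix x assume "x \<in> snd c ` fst c"
      then obtain p where p: "p \<in> fst c" "x = snd c p" by auto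
      have mc: "metric_coord A k c u v x = (\<Sum>i\<in>I. snd i p *\<^sub>R (tvec_of A c p u (fst i) \<bullet> tvec_of A c p v (fst i)))" for u v
        using p c by (simp add: metric_coord_def k_def chart_inv)
      have l: "tvec_of A c p (a *\<^sub>R u + b *\<^sub>R v) d = a *\<^sub>R tvec_of A c p u d + b *\<^sub>R tvec_of A c p v d" for a b u v d
        unfolding tvec_of_lincomb[OF c p(1)] by (simp add: lincomb_def)
      show "linear (\<lambda>u. metric_coord A k c u v x)" for v
      proof (rule linearI)
        show "metric_coord A k c (b1 + b2) v x = metric_coord A k c b1 v x + metric_coord A k c b2 v x" for b1 b2
          using l[of 1 b1 1 b2] by (simp add: mc inner_add_left distrib_left sum.distrib)
        show "metric_coord A k c (r *\<^sub>R b) v x = r *\<^sub>R metric_coord A k c b v x" for r b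
          using l[of r b 0 0] by (simp add: mc sum_distrib_left mult.left_commute)
      qed
      show "metric_coord A k c u v x = metric_coord A k c v u x" for u v by (simp add: mc inner_commute)
      fix u :: "real ^ 3" assume u: "u \<noteq> 0"
      have nn: "snd i p *\<^sub>R (tvec_of A c p u (fst i) \<bullet> tvec_of A c p u (fst i)) \<ge> 0" if "i \<in> I" for i
        using I(2)[of "fst i" "snd i"] that by (simp add: cutoff_def)
      have "p \<in> topspace M" using chart_subset[OF c] p(1) by blast
      from I(3)[OF this] obtain i where i: "i \<in> I" "snd i p > 0" by (auto simp: case_prod_unfold)
      then have ci: "fst i \<in> A" "p \<in> fst (fst i)" using I(2)[of "fst i" "snd i"] cutoff_pos by (auto simp: cutoff_def)
      have "tvec_of A c p u (fst i) \<noteq> 0"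
      proof
        assume "tvec_of A c p u (fst i) = 0"
        then have "tvec_of A c p u (fst i) = tvec_of A c p 0 (fst i)" using l[of 0 0 0 0 "fst i"] by simp
        then have "tvec_of A c p u = tvec_of A c p 0"
          using c p(1) ci by (intro tangent_space_eqI[OF _ _ ci]) (auto simp: tvec_of_in_tangent_space)
        then show False using u tvec_of_self[OF c p(1)] by metis
      qed
      then have "snd i p *\<^sub>R (tvec_of A c p u (fst i) \<bullet> tvec_of A c p u (fst i)) > 0" using i by simp
      then show "metric_coord A k c u u x > 0"
        unfolding mc by (rule sum_pos2[OF I(1) i(1)]) (rule nn)
    qed
  qed
  then show ?thesis by blast
qed

end

section \<open>Vector fields transverse to the kernel of a form\<close>

locale nonvanishing_form = closed_manifold M A for M :: "'a topology" and A +
  fixes \<alpha> :: "'a \<Rightarrow> 'a tvec \<Rightarrow> real"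
  assumes form: "smooth_1_form M A \<alpha>"
    and nonvanishing: "p \<in> topspace M \<Longrightarrow> \<exists>v\<in>tangent_space A p. \<alpha> p v \<noteq> 0"
begin

lemma \<alpha>_lincomb: "p \<in> topspace M \<Longrightarrow> u \<in> tangent_space A p \<Longrightarrow> v \<in> tangent_space A p \<Longrightarrow>
    \<alpha> p (lincomb a u b v) = a * \<alpha> p u + b * \<alpha> p v"
  using form by (simp add: smooth_1_form_def)

definition form_coord where
  "form_coord c u x = \<alpha> (chart_inv c x) (tvec_of A c (chart_inv c x) u)"

lemma smooth_form_coord: "c \<in> A \<Longrightarrow> smooth_on (snd c ` fst c) (form_coord c u)"
  using form unfolding smooth_1_form_def form_coord_def[abs_def] by blast

lemma linear_form_coord:
  assumes c: "c \<in> A" and x: "x \<in> snd c ` fst c"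
  shows "linear (\<lambda>u. form_coord c u x)"
proof -
  obtain p where p: "p \<in> fst c" "x = snd c p" using x by auto
  have pt: "p \<in> topspace M" using chart_subset[OF c] p by blast
  note t = tvec_of_in_tangent_space[OF c p(1)]
  have l: "form_coord c (a *\<^sub>R u + b *\<^sub>R v) x = a * form_coord c u x + b * form_coord c v x" for a b u v
    unfolding form_coord_def p(2) chart_inv[OF c p(1)] tvec_of_lincomb[OF c p(1)] by (rule \<alpha>_lincomb[OF pt t t])
  show ?thesis using l[of 1 _ 1 _] l[of _ _ 0 0] by (intro linearI) simp_all
qed

lemma form_eq_coord:
  assumes "c \<in> A" "p \<in> fst c" "v \<in> tangent_space A p"
  shows "\<alpha> p v = form_coord c (v c) (snd c p)"
  using assms by (simp add: form_coord_def chart_inv tvec_of_coord)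

lemma form_coord_tvec: "c \<in> A \<Longrightarrow> p \<in> fst c \<Longrightarrow> form_coord c u (snd c p) = \<alpha> p (tvec_of A c p u)"
  by (simp add: form_coord_def chart_inv)

text \<open>The Euclidean dual of \<alpha> in the chart, on which \<alpha> takes its squared
  Euclidean norm as value.\<close>

definition form_gradient where
  "form_gradient c x = (\<Sum>b\<in>Basis. form_coord c b x *\<^sub>R b)"

lemma form_coord_gradient:
  assumes c: "c \<in> A" and x: "x \<in> snd c ` fst c"
  shows "form_coord c (form_gradient c x) x = (\<Sum>b\<in>Basis. (form_coord c b x)\<^sup>2)"
  unfolding form_gradient_def
  by (simp add: linear_sum[OF linear_form_coord[OF c x]] linear_cmul[OF linear_form_coord[OF c x]] power2_eq_square)

lemma form_coord_gradient_pos: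
  assumes c: "c \<in> A" and p: "p \<in> fst c"
  shows "form_coord c (form_gradient c (snd c p)) (snd c p) > 0"
proof -
  have x: "snd c p \<in> snd c ` fst c" using p by simp
  interpret linear "\<lambda>u. form_coord c u (snd c p)" by (rule linear_form_coord[OF c x])
  have "\<exists>b\<in>Basis. form_coord c b (snd c p) \<noteq> 0"
  proof (rule ccontr)
    assume "\<not> ?thesis"
    then have z: "form_coord c u (snd c p) = 0" for u
      by (subst euclidean_representation[symmetric, of u]) (simp add: sum scaleR)
    have "p \<in> topspace M" using chart_subset[OF c] p by blast
    from nonvanishing[OF this] show False using form_eq_coord[OF c p] z by auto
  qed
  then obtain b :: "real ^ 3" where b: "b \<in> Basis" "form_coord c b (snd c p) \<noteq> 0" by blast
  show ?thesis unfolding form_coord_gradient[OF c x]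
    by (rule sum_pos2[OF finite_Basis b(1)]) (use b(2) in auto)
qed

lemma ex_positive_field:
  "\<exists>X. smooth_vfield_on A (topspace M) X \<and> (\<forall>p\<in>topspace M. \<alpha> p (X p) > 0)"
proof -
  obtain I where I: "finite I" "\<And>c \<rho>. (c, \<rho>) \<in> I \<Longrightarrow> cutoff c \<rho>" "\<And>p. p \<in> topspace M \<Longrightarrow> \<exists>(c, \<rho>)\<in>I. \<rho> p > 0"
    using ex_cutoffs by metis
  have cut: "cutoff (fst i) (snd i)" if "i \<in> I" for i using I(2)[of "fst i" "snd i"] that by simp
  then have iA: "fst i \<in> A" if "i \<in> I" for i using that by (simp add: cutoff_def)
  have \<rho>0: "snd i p \<ge> 0" if "i \<in> I" for i p using cut[OF that] by (simp add: cutoff_def)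
  define Y where "Y i p = tvec_of A (fst i) p (form_gradient (fst i) (snd (fst i) p))" for i :: "'a chart \<times> ('a \<Rightarrow> real)" and p
  \<comment> \<open>Outside the domain of the chart \<open>fst i\<close> the value of
    \<open>Y i\<close> is arbitrary, but there its weight is zero.\<close>
  define X where "X p = (\<lambda>d. \<Sum>i\<in>I. snd i p *\<^sub>R Y i p d)" for p
  have Y: "smooth_vfield_on A (fst (fst i)) (Y i)" if "i \<in> I" for i
    unfolding Y_def
  proof (rule smooth_vfield_tvec_of[OF iA[OF that]])
    show "smooth_on (snd (fst i) ` fst (fst i)) (form_gradient (fst i))"
      unfolding form_gradient_def[abs_def]
      by (intro smooth_on_sum smooth_on_scaleR smooth_on_const smooth_form_coord open_chart_codomain iA[OF that])
  qed
  have Yt: "Y i p \<in> tangent_space A p" if "i \<in> I" "snd i p \<noteq> 0" for i p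
    using smooth_vfieldD(1)[OF Y[OF that(1)] cutoff_pos[OF cut[OF that(1)]]] \<rho>0[OF that(1), of p] that(2) by simp
  have t: "X p \<in> tangent_space A p" for p
  proof -
    have "X p d = fd (transition c d) (snd c p) (X p c)" if "c \<in> charts_at A p" "d \<in> charts_at A p" for c d
    proof -
      have cd: "c \<in> A" "d \<in> A" "p \<in> fst c" "p \<in> fst d" using that by (auto simp: charts_at)
      note l = linear_transition[OF cd]
      have "fd (transition c d) (snd c p) (X p c) = (\<Sum>i\<in>I. snd i p *\<^sub>R fd (transition c d) (snd c p) (Y i p c))"
        by (simp add: X_def linear_sum[OF l] linear_cmul[OF l])
      also have "\<dots> = X p d" unfolding X_def
      proof (rule sum.cong[OF refl])
        fix i assume i: "i \<in> I"
        show "snd i p *\<^sub>R fd (transition c d) (snd c p) (Y i p c) = snd i p *\<^sub>R Y i p d"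
          using tangent_space_change[OF Yt[OF i] cd] by (cases "snd i p = 0") simp_all
      qed
      finally show ?thesis ..
    qed
    moreover have "X p c = 0" if "c \<notin> charts_at A p" for c
      using that by (simp add: X_def Y_def tvec_of_def)
    ultimately show ?thesis unfolding tangent_space_def by blast
  qed
  have s: "smooth_on (snd d ` fst d) (vf_coord X d)" if d: "d \<in> A" for d
    unfolding vf_coord_def X_def
  proof (rule smooth_on_sum[OF open_chart_codomain[OF d]])
    fix i assume i: "i \<in> I"
    have "smooth_on (snd d ` (fst d \<inter> fst (fst i))) (vf_coord (Y i) d)"
      using smooth_vfieldD(2)[OF Y[OF i] d] by (simp add: Int_commute)
    then show "smooth_on (snd d ` fst d) (\<lambda>x. snd i (chart_inv d x) *\<^sub>R Y i (chart_inv d x) d)"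
      unfolding vf_coord_def by (intro smooth_cutoff_mult[OF cut[OF i] d, where F="\<lambda>p. Y i p d"])
  qed
  have "\<alpha> p (X p) > 0" if p: "p \<in> topspace M" for p
  proof -
    obtain e where e: "e \<in> A" and pe: "p \<in> fst e" using ex_chart[OF p] by blast
    have l: "linear (\<lambda>u. form_coord e u (snd e p))" by (rule linear_form_coord[OF e]) (use pe in simp)
    have "\<alpha> p (X p) = (\<Sum>i\<in>I. snd i p * form_coord e (Y i p e) (snd e p))"
      unfolding form_eq_coord[OF e pe t] by (simp add: X_def linear_sum[OF l] linear_cmul[OF l])
    also have "\<dots> > 0"
    proof -
      have pos: "form_coord e (Y i p e) (snd e p) > 0" if i: "i \<in> I" "snd i p > 0" for i
      proof -
        have pi: "p \<in> fst (fst i)" using cutoff_pos[OF cut[OF i(1)] i(2)] .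
        have "Y i p \<in> tangent_space A p" using Yt i by simp
        then have "form_coord e (Y i p e) (snd e p) = \<alpha> p (Y i p)" by (rule form_eq_coord[OF e pe, symmetric])
        also have "\<dots> > 0"
          using form_coord_gradient_pos[OF iA[OF i(1)] pi] by (simp add: Y_def form_coord_tvec iA[OF i(1)] pi)
        finally show ?thesis .
      qed
      from I(3)[OF p] obtain i where i: "i \<in> I" "snd i p > 0" by (auto simp: case_prod_unfold)
      show ?thesis
      proof (rule sum_pos2[OF I(1) i(1)])
        show "snd i p * form_coord e (Y i p e) (snd e p) > 0" using pos[OF i] i by simp
        show "0 \<le> snd j p * form_coord e (Y j p e) (snd e p)" if "j \<in> I" for j
          using pos[OF that] \<rho>0[OF that, of p] by (cases "snd j p = 0") simp_all
      qed
    qed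
    finally show ?thesis .
  qed
  then show ?thesis
    using t s chart_subset by (intro exI[of _ X]) (simp add: smooth_vfield_on_def Int_absorb1)
qed

lemma ex_transverse_field:
  "\<exists>X. smooth_vfield_on A (topspace M) X \<and> (\<forall>p\<in>topspace M. \<alpha> p (X p) = 1)"
proof -
  obtain X where X: "smooth_vfield_on A (topspace M) X" and pos: "\<And>p. p \<in> topspace M \<Longrightarrow> \<alpha> p (X p) > 0"
    using ex_positive_field by blast
  define R where "R p = lincomb (1 / \<alpha> p (X p)) (X p) 0 (X p)" for p
  note t = smooth_vfieldD(1)[OF X]
  have "R p \<in> tangent_space A p" if "p \<in> topspace M" for p
    unfolding R_def using t[OF that] by (intro lincomb_in_tangent_space)
  moreover have "\<alpha> p (R p) = 1" if "p \<in> topspace M" for p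
    using pos[OF that] by (simp add: R_def \<alpha>_lincomb[OF that t[OF that] t[OF that]])
  moreover have "smooth_on (snd c ` (topspace M \<inter> fst c)) (vf_coord R c)" if c: "c \<in> A" for c
  proof -
    have dom: "topspace M \<inter> fst c = fst c" using chart_subset[OF c] by blast
    note o = open_chart_codomain[OF c]
    have sX: "smooth_on (snd c ` fst c) (vf_coord X c)" using smooth_vfieldD(2)[OF X c] dom by simp
    have sa: "smooth_on (snd c ` fst c) (\<lambda>x. form_coord c (vf_coord X c x) x)"
      by (rule smooth_on_linear_coeff(1)[where A="\<lambda>x u. form_coord c u x", OF o linear_form_coord[OF c] smooth_form_coord[OF c] sX])
    have e: "form_coord c (vf_coord X c (snd c p)) (snd c p) = \<alpha> p (X p)" if p: "p \<in> fst c" for p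
    proof -
      have "p \<in> topspace M" using p chart_subset[OF c] by blast
      from form_eq_coord[OF c p t[OF this]] show ?thesis by (simp add: vf_coord c p)
    qed
    have "smooth_on (snd c ` fst c) (\<lambda>x. (1 / form_coord c (vf_coord X c x) x) *\<^sub>R vf_coord X c x)"
      by (intro smooth_on_scaleR smooth_on_divide smooth_on_const o sa sX) (use e pos dom in force)
    then show ?thesis unfolding dom
      by (rule smooth_on_cong[OF o, rotated]) (use c e in \<open>auto simp: vf_coord R_def lincomb_def\<close>)
  qed
  ultimately show ?thesis by (intro exI[of _ R]) (simp add: smooth_vfield_on_def)
qed

end

section \<open>Curvature of the plane field\<close>

lemma gamma_cong:
  assumes V: "open V" "x \<in> V" and eq: "\<And>u v y. y \<in> V \<Longrightarrow> G u v y = G' u v y"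
  shows "gamma G x u v = gamma G' x u v"
proof -
  have "fd (G u v) x = fd (G' u v) x" for u v
    by (rule frechet_derivative_cong_open[OF V]) (rule eq)
  then show ?thesis unfolding gamma_def by (simp add: eq[OF V(2)])
qed

text \<open>The hypothesis compares Christoffel symbols instead of metrics, so that the lemma serves
  for metrics that agree and for metrics that differ by a constant factor.\<close>

lemma riem_cong:
  assumes V: "open V" "x \<in> V" and eq: "\<And>u v y. y \<in> V \<Longrightarrow> gamma G y u v = gamma G' y u v"
  shows "riem G X Y Z x = riem G' X Y Z x"
proof -
  have n: "nabla G X Y y = nabla G' X Y y" if "y \<in> V" for X Y y
    by (simp add: nabla_def eq[OF that])
  have "nabla G X (nabla G Y Z) x = nabla G' X (nabla G' Y Z) x" for X Y
  proof -
    have "fd (nabla G Y Z) x (X x) = fd (nabla G' Y Z) x (X x)" by (rule fd_cong[OF V]) (rule n)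
    then show ?thesis by (simp add: n[OF V(2), of X] nabla_def[of G' X] n[OF V(2), of Y])
  qed
  then show ?thesis by (simp add: riem_def n[OF V(2)])
qed

text \<open>Both sides of the defining equation of the Christoffel symbols acquire the factor
  \<open>s\<close>.\<close>

lemma (in local_metric) gamma_scale:
  assumes x: "x \<in> V" and s: "s \<noteq> 0"
  shows "gamma (\<lambda>u v x. s * G u v x) x u v = gamma G x u v"
proof -
  have f: "fd (\<lambda>x. s * G u v x) x w = s * fd (G u v) x w" for u v w
    using frechet_derivative_at[OF has_derivative_mult_right[OF smooth_on_has_derivative[OF smooth_G x], of s], symmetric]
    by simp
  have "s * G w z x = (s * a + s * b - s * c) / 2 \<longleftrightarrow> G w z x = (a + b - c) / 2" for w z a b c
  proof -
    have e: "(s * a + s * b - s * c) / 2 = s * ((a + b - c) / 2)" by (simp add: algebra_simps)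
    show ?thesis unfolding e mult_cancel_left using s by blast
  qed
  then show ?thesis unfolding gamma_def f by simp
qed

lemma (in local_metric) local_metric_cong:
  assumes "\<And>u v x. x \<in> V \<Longrightarrow> G' u v x = G u v x"
  shows "local_metric V G'"
proof (rule local_metric.intro)
  show "smooth_on V (G' u v)" for u v
    by (rule smooth_on_cong[OF open_V _ smooth_G]) (simp add: assms)
  show "linear (\<lambda>u. G' u v x)" if "x \<in> V" for x v
    using linear_G[OF that] by (simp add: assms[OF that])
  show "G' u v x = G' v u x" if "x \<in> V" for x u v
    unfolding assms[OF that] by (rule sym_G[OF that])
qed (simp_all add: open_V assms pos_G)

context riemannian_manifold
begin

lemma gram_pos_chart:
  assumes c: "c \<in> A" and q: "q \<in> fst c" and ST: "S \<in> tangent_space A q" "T \<in> tangent_space A q"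
    and ind: "lin_indep S T"
  shows "mc c (S c) (S c) (snd c q) * mc c (T c) (T c) (snd c q) - (mc c (S c) (T c) (snd c q))\<^sup>2 > 0"
proof -
  interpret local_metric "snd c ` (fst c \<inter> fst c)" "mc c" by (rule local_metric_chart[OF c openin_chart[OF c]])
  show ?thesis
  proof (rule gram_pos)
    show "snd c q \<in> snd c ` (fst c \<inter> fst c)" using q by simp
    fix a b assume z: "a *\<^sub>R S c + b *\<^sub>R T c = 0"
    have "lincomb a S b T = lincomb 0 S 0 T"
      by (rule tangent_space_eqI[OF lincomb_in_tangent_space[OF ST] lincomb_in_tangent_space[OF ST] c q])
        (simp add: lincomb_def z)
    then have "lincomb a S b T = (\<lambda>c. 0)" by (simp add: lincomb_def)
    then show "a = 0 \<and> b = 0" using ind unfolding lin_indep_def by blast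
  qed
qed

lemma distribution_curvature_coord:
  assumes U: "openin M U" "q \<in> U" and S: "smooth_vfield_on A U S" and T: "smooth_vfield_on A U T"
    and ind: "lin_indep (S q) (T q)" and P: "\<xi> q = plane_of (S q) (T q)"
    and c: "c \<in> A" and q: "q \<in> fst c"
  shows "distribution_curvature M A g \<xi> q =
    mc c (riem (mc c) (vf_coord S c) (vf_coord T c) (vf_coord T c) (snd c q)) (S q c) (snd c q) /
    (mc c (S q c) (S q c) (snd c q) * mc c (T q c) (T q c) (snd c q) - (mc c (S q c) (T q c) (snd c q))\<^sup>2)"
  unfolding distribution_curvature_def sectional_curvature_eq[OF U S T ind P]
  using metric_eq_coord[where g=g, OF c q] riemann_in_tangent_space[OF U S T T] smooth_vfieldD(1)[OF S U(2)] smooth_vfieldD(1)[OF T U(2)]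
  by (simp add: riemann_coord[OF c q])

text \<open>Near each point a local frame of \<xi> exhibits the curvature as a quotient with
  positive Gram determinant. Applied to metrics with constant L, this is the source of the
  smoothness of P, C and D.\<close>

lemma smooth_distribution_curvature:
  assumes "plane_distribution M A \<xi>"
  shows "smooth_function A (distribution_curvature M A g \<xi>)"
  unfolding smooth_function_def
proof
  fix c assume c: "c \<in> A"
  show "smooth_on (snd c ` fst c) (distribution_curvature M A g \<xi> \<circ> chart_inv c)"
  proof (rule smooth_on_locally)
    fix x assume "x \<in> snd c ` fst c"
    then obtain p where p: "p \<in> fst c" "x = snd c p" by auto
    then have "p \<in> topspace M" using chart_subset[OF c] by blast
    then obtain U S T where U: "openin M U" "p \<in> U" and S: "smooth_vfield_on A U S" and T: "smooth_vfield_on A U T"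
      and f: "\<And>q. q \<in> U \<Longrightarrow> lin_indep (S q) (T q)" "\<And>q. q \<in> U \<Longrightarrow> \<xi> q = plane_of (S q) (T q)"
      using assms unfolding plane_distribution_def by metis
    let ?V = "snd c ` (U \<inter> fst c)"
    interpret V: local_metric ?V "mc c" by (rule local_metric_chart[OF c U(1)])
    let ?S = "vf_coord S c" and ?T = "vf_coord T c"
    note s = smooth_vfieldD(2)[OF S c] smooth_vfieldD(2)[OF T c]
    have gram: "mc c (?S y) (?S y) y * mc c (?T y) (?T y) y - (mc c (?S y) (?T y) y) * (mc c (?S y) (?T y) y) > 0"
      if y: "y \<in> ?V" for y
    proof -
      from y obtain q where q: "q \<in> U" "q \<in> fst c" "y = snd c q" by auto
      show ?thesis
        using gram_pos_chart[OF c q(2) smooth_vfieldD(1)[OF S q(1)] smooth_vfieldD(1)[OF T q(1)] f(1)[OF q(1)]]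
        by (simp add: q vf_coord c power2_eq_square)
    qed
    have n: "smooth_on ?V (\<lambda>y. mc c (riem (mc c) ?S ?T ?T y) (?S y) y)"
      by (rule V.smooth_on_G[OF V.smooth_on_riem[OF s(1,2,2)] s(1)])
    have "smooth_on ?V (\<lambda>y. mc c (riem (mc c) ?S ?T ?T y) (?S y) y /
        (mc c (?S y) (?S y) y * mc c (?T y) (?T y) y - mc c (?S y) (?T y) y * mc c (?S y) (?T y) y))"
      using gram by (intro smooth_on_divide n smooth_on_diff smooth_on_mult V.smooth_on_G V.open_V s) force
    then have "smooth_on ?V (distribution_curvature M A g \<xi> \<circ> chart_inv c)"
    proof (rule smooth_on_cong[OF V.open_V, rotated])
      fix y assume "y \<in> ?V"
      then obtain q where q: "q \<in> U" "q \<in> fst c" "y = snd c q" by auto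
      show "mc c (riem (mc c) ?S ?T ?T y) (?S y) y /
        (mc c (?S y) (?S y) y * mc c (?T y) (?T y) y - mc c (?S y) (?T y) y * mc c (?S y) (?T y) y) =
        (distribution_curvature M A g \<xi> \<circ> chart_inv c) y"
        using distribution_curvature_coord[where \<xi>=\<xi>, OF U(1) q(1) S T f(1)[OF q(1)] f(2)[OF q(1)] c q(2)]
        by (simp add: q vf_coord c chart_inv power2_eq_square)
    qed
    then show "\<exists>W. open W \<and> x \<in> W \<and> smooth_on W (distribution_curvature M A g \<xi> \<circ> chart_inv c)"
      using V.open_V p U(2) by blast
  qed
qed

lemma metric_coord_scale: "metric_coord A (\<lambda>p u v. s * g p u v) c = (\<lambda>u v x. s * mc c u v x)"
  by (simp add: fun_eq_iff metric_coord_def)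

lemma riemannian_scale:
  assumes s: "s > 0"
  shows "riemannian_metric M A (\<lambda>p u v. s * g p u v)"
  using riemannian s
  by (simp add: riemannian_metric_def metric_coord_scale algebra_simps smooth_on_mult smooth_on_const open_chart_codomain)

text \<open>The curvature vector is unchanged, so the numerator scales by \<open>s\<close> and the
  Gram determinant by the square of \<open>s\<close>.\<close>

lemma distribution_curvature_scale:
  assumes s: "s > 0" and D: "plane_distribution M A \<xi>" and p: "p \<in> topspace M"
  shows "distribution_curvature M A (\<lambda>p u v. s * g p u v) \<xi> p = distribution_curvature M A g \<xi> p / s"
proof -
  obtain U S T where U: "openin M U" "p \<in> U" and S: "smooth_vfield_on A U S" and T: "smooth_vfield_on A U T"
    and f: "lin_indep (S p) (T p)" "\<xi> p = plane_of (S p) (T p)"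
    using D p unfolding plane_distribution_def by metis
  obtain c where c: "c \<in> A" and pc: "p \<in> fst c" using ex_chart[OF p] by blast
  interpret s: riemannian_manifold M A "\<lambda>p u v. s * g p u v"
    by (intro riemannian_manifold.intro riemannian_manifold_axioms.intro smooth_manifold_axioms riemannian_scale s)
  interpret V: local_metric "snd c ` (fst c \<inter> fst c)" "mc c" by (rule local_metric_chart[OF c openin_chart[OF c]])
  have x: "snd c p \<in> snd c ` (fst c \<inter> fst c)" using pc by simp
  have r: "riem (\<lambda>u v x. s * mc c u v x) X Y Z (snd c p) = riem (mc c) X Y Z (snd c p)" for X Y Z
    by (rule riem_cong[OF V.open_V x V.gamma_scale]) (use s in auto)
  have a: "s * n / (s * a * (s * b) - (s * d)\<^sup>2) = n / (a * b - d\<^sup>2) / s" for n a b d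
  proof -
    have "s * a * (s * b) - (s * d)\<^sup>2 = s * (s * (a * b - d\<^sup>2))" by (simp add: power2_eq_square algebra_simps)
    then show ?thesis using s by simp
  qed
  show ?thesis
    unfolding distribution_curvature_coord[where \<xi>=\<xi>, OF U S T f c pc] s.distribution_curvature_coord[where \<xi>=\<xi>, OF U S T f c pc]
      metric_coord_scale r a ..
qed

end

section \<open>The family of metrics on a contact manifold\<close>

locale contact_manifold = nonvanishing_form M A \<alpha> + k: riemannian_manifold M A k
  for M :: "'a topology" and A and \<alpha> and k +
  fixes \<xi> :: "'a distribution" and R :: "'a vfield"
  assumes contact: "contact_structure M A \<xi>"
    and kernel: "p \<in> topspace M \<Longrightarrow> \<xi> p = {v \<in> tangent_space A p. \<alpha> p v = 0}"
    and smooth_R: "smooth_vfield_on A (topspace M) R"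
    and \<alpha>_R: "p \<in> topspace M \<Longrightarrow> \<alpha> p (R p) = 1"
begin

definition proj where "proj p u = lincomb 1 u (- \<alpha> p u) (R p)"

text \<open>The first summand is h, made from the auxiliary metric \<open>k\<close> by projection to
  \<xi> along \<open>R\<close>; \<open>H\<close> below is its coordinate expression.\<close>

definition contact_metric where "contact_metric L p u v = k p (proj p u) (proj p v) + L p * (\<alpha> p u * \<alpha> p v)"

definition H where
  "H c u v x = metric_coord A k c (u - form_coord c u x *\<^sub>R vf_coord R c x) (v - form_coord c v x *\<^sub>R vf_coord R c x) x"

lemma R_tangent: "p \<in> topspace M \<Longrightarrow> R p \<in> tangent_space A p"
  by (rule smooth_vfieldD(1)[OF smooth_R])

lemma splitting:
  assumes c: "c \<in> A" and U: "openin M U"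
  shows "contact_splitting (snd c ` (U \<inter> fst c)) (H c) (form_coord c) (vf_coord R c)"
proof (rule contact_splitting_subset[OF _ _ open_chart_image[OF c U]])
  have dom: "topspace M \<inter> fst c = fst c" using chart_subset[OF c] by blast
  interpret local_metric "snd c ` (topspace M \<inter> fst c)" "metric_coord A k c" by (rule k.local_metric_chart[OF c openin_topspace])
  show "contact_splitting (snd c ` fst c) (H c) (form_coord c) (vf_coord R c)"
    unfolding H_def[abs_def]
  proof (rule contact_splitting_projection[unfolded dom])
    fix x assume "x \<in> snd c ` fst c"
    then obtain p where p: "p \<in> fst c" "x = snd c p" by auto
    then have "p \<in> topspace M" using dom by auto
    then show "form_coord c (vf_coord R c x) x = 1"
      using form_eq_coord[OF c p(1) R_tangent] \<alpha>_R p by (simp add: vf_coord c)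
  qed (use smooth_form_coord[OF c] linear_form_coord[OF c] smooth_vfieldD(2)[OF smooth_R c] dom in auto)
qed auto

lemma metric_coord_contact_metric:
  assumes c: "c \<in> A" and x: "x \<in> snd c ` fst c"
  shows "metric_coord A (contact_metric L) c u v x =
    contact_splitting.Gs (H c) (form_coord c) (\<lambda>x. L (chart_inv c x)) u v x"
proof -
  obtain p where p: "p \<in> fst c" "x = snd c p" using x by auto
  have pt: "p \<in> topspace M" using chart_subset[OF c] p by blast
  interpret contact_splitting "snd c ` (fst c \<inter> fst c)" "H c" "form_coord c" "vf_coord R c"
    by (rule splitting[OF c openin_chart[OF c]])
  have "proj p (tvec_of A c p u) = tvec_of A c p (1 *\<^sub>R u + (- form_coord c u x) *\<^sub>R vf_coord R c x)" for u
    unfolding proj_def tvec_of_lincomb[OF c p(1)] p(2) vf_coord[OF c p(1)] tvec_of_coord[OF R_tangent[OF pt] c p(1)]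
      form_coord_tvec[OF c p(1)] ..
  then show ?thesis
    unfolding metric_coord_def Gs_def H_def contact_metric_def using p
    by (simp add: chart_inv[OF c] form_coord_tvec[OF c])
qed

lemma riemannian_contact_metric:
  assumes L: "smooth_function A L" "\<And>p. p \<in> topspace M \<Longrightarrow> L p > 0"
  shows "riemannian_manifold M A (contact_metric L)"
proof (intro riemannian_manifold.intro riemannian_manifold_axioms.intro smooth_manifold_axioms riemannian_metricI)
  fix c assume c: "c \<in> A"
  interpret contact_splitting "snd c ` (fst c \<inter> fst c)" "H c" "form_coord c" "vf_coord R c"
    by (rule splitting[OF c openin_chart[OF c]])
  have "local_metric (snd c ` (fst c \<inter> fst c)) (Gs (\<lambda>x. L (chart_inv c x)))"
  proof (rule local_metric_Gs)
    show "smooth_on (snd c ` (fst c \<inter> fst c)) (\<lambda>x. L (chart_inv c x))" using smooth_functionD[OF L(1) c] by simp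
    show "L (chart_inv c x) > 0" if "x \<in> snd c ` (fst c \<inter> fst c)" for x
      using that chart_subset[OF c] L(2) by (auto simp: chart_inv[OF c])
  qed
  then show "local_metric (snd c ` fst c) (metric_coord A (contact_metric L) c)"
    using local_metric.local_metric_cong[of "snd c ` fst c" _ "metric_coord A (contact_metric L) c"] metric_coord_contact_metric[OF c] by simp
qed

text \<open>The order of the quantifiers is the point: one triple, built from a frame and a chart
  chosen at \<open>p\<close>, serves all L simultaneously. Regularity in \<open>p\<close> is not
  claimed.\<close>

lemma curvature_contact_metric:
  assumes p: "p \<in> topspace M"
  shows "\<exists>P C D. C > 0 \<and> (\<forall>L. smooth_function A L \<longrightarrow> (\<forall>q\<in>topspace M. L q > 0) \<longrightarrow>
     distribution_curvature M A (contact_metric L) \<xi> p = P - C * L p + D / L p)"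
proof -
  obtain U S T where U: "openin M U" "p \<in> U" and S: "smooth_vfield_on A U S" and T: "smooth_vfield_on A U T"
    and f: "\<And>q. q \<in> U \<Longrightarrow> lin_indep (S q) (T q)" "\<And>q. q \<in> U \<Longrightarrow> \<xi> q = plane_of (S q) (T q)"
    using contact p unfolding contact_structure_def plane_distribution_def by metis
  have UM: "U \<subseteq> topspace M" using U openin_subset by blast
  have mem: "S q \<in> \<xi> q" "T q \<in> \<xi> q" if q: "q \<in> U" for q
  proof -
    have "S q = lincomb 1 (S q) 0 (T q)" "T q = lincomb 0 (S q) 1 (T q)" by (simp_all add: lincomb_def)
    then show "S q \<in> \<xi> q" "T q \<in> \<xi> q" unfolding f(2)[OF q] plane_of_def by blast+
  qed
  obtain c where c: "c \<in> A" and pc: "p \<in> fst c" using ex_chart[OF p] by blast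
  let ?V = "snd c ` (U \<inter> fst c)" and ?x = "snd c p" and ?S = "vf_coord S c" and ?T = "vf_coord T c"
  interpret cs: contact_splitting ?V "H c" "form_coord c" "vf_coord R c" by (rule splitting[OF c U(1)])
  have x: "?x \<in> ?V" using pc U by simp
  have z: "form_coord c (vf_coord X c y) y = 0"
    if X: "smooth_vfield_on A U X" "\<And>q. q \<in> U \<Longrightarrow> X q \<in> \<xi> q" and y: "y \<in> ?V" for X y
  proof -
    from y obtain q where q: "q \<in> U" "q \<in> fst c" "y = snd c q" by auto
    have "\<alpha> q (X q) = 0" using X(2)[OF q(1)] kernel[of q] q(1) UM by blast
    then show ?thesis using form_eq_coord[OF c q(2) smooth_vfieldD(1)[OF X(1) q(1)]] by (simp add: q(3) vf_coord[OF c q(2)])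
  qed
  have horizontal: "cs.horizontal ?S" "cs.horizontal ?T"
    using z[OF S mem(1)] z[OF T mem(2)] smooth_vfieldD(2)[OF S c] smooth_vfieldD(2)[OF T c]
    by (simp_all add: cs.horizontal_def)
  have span: "\<exists>a b. w = a *\<^sub>R ?S ?x + b *\<^sub>R ?T ?x" if "form_coord c w ?x = 0" for w
  proof -
    have "tvec_of A c p w \<in> plane_of (S p) (T p)"
      using that tvec_of_in_tangent_space[OF c pc] by (simp add: f(2)[OF U(2), symmetric] kernel[OF p] form_coord_tvec[OF c pc])
    then obtain a b where "tvec_of A c p w = lincomb a (S p) b (T p)" unfolding plane_of_def by blast
    then have "tvec_of A c p w c = lincomb a (S p) b (T p) c" by simp
    then show ?thesis by (auto simp: tvec_of_self[OF c pc] lincomb_def vf_coord[OF c pc])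
  qed
  obtain P D where PD: "\<And>L. smooth_on ?V L \<Longrightarrow> (\<forall>x\<in>?V. L x > 0) \<Longrightarrow>
      cs.Gs L (riem (cs.Gs L) ?S ?T ?T ?x) (?S ?x) ?x = P - 3 / 4 * (form_coord c (bracket ?S ?T ?x) ?x)\<^sup>2 * L ?x + D / L ?x"
    using cs.curvature_splitting[OF horizontal x span] by blast
  let ?a = "form_coord c (bracket ?S ?T ?x) ?x"
  let ?N = "H c (?S ?x) (?S ?x) ?x * H c (?T ?x) (?T ?x) ?x - (H c (?S ?x) (?T ?x) ?x)\<^sup>2"
  have "lie_bracket A S T p \<notin> \<xi> p"
    using contact U S T f(1) mem unfolding contact_structure_def section_on_def by blast
  moreover have br: "lie_bracket A S T p \<in> tangent_space A p"
    by (rule smooth_vfieldD(1)[OF k.smooth_lie_bracket[OF U(1) S T] U(2)])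
  ultimately have "\<alpha> p (lie_bracket A S T p) \<noteq> 0" using kernel[OF p] by blast
  then have a: "?a \<noteq> 0"
    using form_eq_coord[OF c pc br] k.vf_coord_lie_bracket[OF c, of ?x S T] pc by (simp add: vf_coord[OF c pc])
  \<comment> \<open>A horizontal argument removes the summand with L; hence the Gram determinant of
    the frame is \<open>?N\<close> for every metric of the family.\<close>
  have g: "contact_splitting.Gs (H c) (form_coord c) L u v ?x = H c u v ?x" if "form_coord c v ?x = 0" for L u v
    using that by (simp add: cs.Gs_def)
  have mcg: "metric_coord A (contact_metric L) c u v ?x = H c u v ?x" if "form_coord c v ?x = 0" for L u v
    unfolding metric_coord_contact_metric[OF c imageI[OF pc]] by (rule g[OF that])
  have zST: "form_coord c (S p c) ?x = 0" "form_coord c (T p c) ?x = 0"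
    using z[OF S mem(1) x] z[OF T mem(2) x] by (simp_all add: vf_coord[OF c pc])
  have one: "smooth_function A (\<lambda>_. 1)"
    by (simp add: smooth_function_def comp_def smooth_on_const open_chart_codomain)
  \<comment> \<open>Any member of the family shows that \<open>?N\<close> is positive; L = 1 is
    taken.\<close>
  interpret g1: riemannian_manifold M A "contact_metric (\<lambda>_. 1)" by (rule riemannian_contact_metric[OF one]) simp
  have N: "?N > 0"
    using g1.gram_pos_chart[OF c pc smooth_vfieldD(1)[OF S U(2)] smooth_vfieldD(1)[OF T U(2)] f(1)[OF U(2)]]
    by (simp add: mcg zST vf_coord[OF c pc])
  have "distribution_curvature M A (contact_metric L) \<xi> p = P / ?N - (3 / 4 * ?a\<^sup>2 / ?N) * L p + (D / ?N) / L p"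
    if L: "smooth_function A L" "\<forall>q\<in>topspace M. L q > 0" for L
  proof -
    interpret gL: riemannian_manifold M A "contact_metric L" by (rule riemannian_contact_metric) (use L in auto)
    let ?L = "\<lambda>x. L (chart_inv c x)"
    have sL: "smooth_on ?V ?L" by (rule smooth_on_subset[OF smooth_functionD[OF L(1) c]]) auto
    have pL: "\<forall>x\<in>?V. ?L x > 0" using L(2) UM by (auto simp: chart_inv[OF c])
    have r: "riem (metric_coord A (contact_metric L) c) X Y Z ?x = riem (cs.Gs ?L) X Y Z ?x" for X Y Z
      by (rule riem_cong[OF cs.open_V x], rule gamma_cong[OF cs.open_V], assumption)
        (use metric_coord_contact_metric[OF c] in auto)
    have "distribution_curvature M A (contact_metric L) \<xi> p = cs.Gs ?L (riem (cs.Gs ?L) ?S ?T ?T ?x) (?S ?x) ?x / ?N"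
      unfolding gL.distribution_curvature_coord[where \<xi>=\<xi>, OF U S T f(1)[OF U(2)] f(2)[OF U(2)] c pc]
      by (simp add: mcg zST vf_coord[OF c pc] r g)
    then show ?thesis
      unfolding PD[OF sL pL] by (simp add: chart_inv[OF c pc] add_divide_distrib diff_divide_distrib)
  qed
  moreover have "3 / 4 * ?a\<^sup>2 / ?N > 0" using a N by simp
  ultimately show ?thesis by blast
qed

end

section \<open>Smooth functions and the equation for L\<close>

context smooth_manifold
begin

lemma smooth_function_const: "smooth_function A (\<lambda>_. c)"
  by (simp add: smooth_function_def comp_def smooth_on_const open_chart_codomain)

lemma smooth_function_add: "smooth_function A f \<Longrightarrow> smooth_function A g \<Longrightarrow> smooth_function A (\<lambda>p. f p + g p)"
  by (simp add: smooth_function_def comp_def smooth_on_add open_chart_codomain)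

lemma smooth_function_diff: "smooth_function A f \<Longrightarrow> smooth_function A g \<Longrightarrow> smooth_function A (\<lambda>p. f p - g p)"
  by (simp add: smooth_function_def comp_def smooth_on_diff open_chart_codomain)

lemma smooth_function_mult: "smooth_function A f \<Longrightarrow> smooth_function A g \<Longrightarrow> smooth_function A (\<lambda>p. f p * g p)"
  by (simp add: smooth_function_def comp_def smooth_on_mult open_chart_codomain)

lemma chart_inv_in_topspace: "c \<in> A \<Longrightarrow> x \<in> snd c ` fst c \<Longrightarrow> chart_inv c x \<in> topspace M"
  using chart_subset[of c] by (auto simp: chart_inv)

lemma smooth_function_divide:
  assumes "smooth_function A f" "smooth_function A g" "\<And>p. p \<in> topspace M \<Longrightarrow> g p \<noteq> 0"
  shows "smooth_function A (\<lambda>p. f p / g p)"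
  using assms by (simp add: smooth_function_def comp_def smooth_on_divide open_chart_codomain chart_inv_in_topspace)

lemma smooth_function_sqrt:
  assumes "smooth_function A f" "\<And>p. p \<in> topspace M \<Longrightarrow> f p > 0"
  shows "smooth_function A (\<lambda>p. sqrt (f p))"
  using assms by (simp add: smooth_function_def comp_def smooth_on_sqrt open_chart_codomain chart_inv_in_topspace)

text \<open>Excludes zeros of \<alpha>: at a zero the kernel would be the whole three-dimensional
  tangent space, although \<xi> is a plane there.\<close>

lemma tangent_space_not_plane:
  assumes p: "p \<in> topspace M"
  shows "tangent_space A p \<noteq> plane_of u v"
proof
  assume e: "tangent_space A p = plane_of u v"
  obtain c where c: "c \<in> A" and pc: "p \<in> fst c" using ex_chart[OF p] by blast
  have "w \<in> span {u c, v c}" for w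
  proof -
    have "tvec_of A c p w \<in> plane_of u v" using tvec_of_in_tangent_space[OF c pc] e by simp
    then obtain a b where "tvec_of A c p w = lincomb a u b v" unfolding plane_of_def by blast
    then have "tvec_of A c p w c = lincomb a u b v c" by simp
    then have "w = a *\<^sub>R u c + b *\<^sub>R v c" by (simp add: tvec_of_self[OF c pc] lincomb_def)
    then show ?thesis by (simp add: span_add span_scale span_base)
  qed
  then have "dim (UNIV :: (real ^ 3) set) \<le> card {u c, v c}" by (intro dim_le_card) auto
  also have "\<dots> \<le> 2" by (simp add: card_insert_if)
  finally show False by simp
qed

end

text \<open>Multiplying by \<open>L\<close> gives C L^2 - (P - t) L - D = 0, and \<open>L\<close> is
  the larger root. The first positivity condition makes it positive even for negative
  \<open>D\<close>; the second keeps the argument of the root positive, where \<open>sqrt\<close> is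
  smooth.\<close>

lemma quadratic_root:
  fixes P C D t :: real
  defines "L \<equiv> (P - t + sqrt ((P - t)\<^sup>2 + 4 * (C * D))) / (2 * C)"
  assumes C: "C > 0" and pos: "P - t > 0" "(P - t)\<^sup>2 + 4 * (C * D) > 0"
  shows "L > 0" "P - C * L + D / L = t"
proof -
  let ?r = "sqrt ((P - t)\<^sup>2 + 4 * (C * D))"
  have r: "?r\<^sup>2 = (P - t)\<^sup>2 + 4 * (C * D)" "?r > 0" using pos(2) by simp_all
  show L: "L > 0" unfolding L_def using C pos(1) r(2) by (intro divide_pos_pos add_pos_pos) auto
  have "?r = 2 * C * L - (P - t)" using C by (simp add: L_def)
  then have "(2 * C * L - (P - t))\<^sup>2 = (P - t)\<^sup>2 + 4 * (C * D)" using r(1) by metis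
  then have "C * (D - (C * L - (P - t)) * L) = 0" by (simp add: power2_eq_square algebra_simps)
  then have "D = (C * L - (P - t)) * L" using C by simp
  then show "P - C * L + D / L = t" using L by simp
qed

lemma (in contact_manifold) ex_metric_with_curvature:
  assumes f: "smooth_function A f" and neg: "\<And>p. p \<in> topspace M \<Longrightarrow> f p < 0"
  shows "\<exists>g. riemannian_metric M A g \<and> (\<forall>p\<in>topspace M. distribution_curvature M A g \<xi> p = f p)"
proof -
  have plane: "plane_distribution M A \<xi>" using contact by (simp add: contact_structure_def)
  let ?K = "\<lambda>i::real. distribution_curvature M A (contact_metric (\<lambda>_. i)) \<xi>"
  \<comment> \<open>Inverts the three equations ?K i = P - C i + D / i for i = 1, 2, 3. The second
    difference removes P and C and leaves (1 - 2/2 + 1/3) D = D / 3; the first difference then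
    yields C.\<close>
  define D where "D p = 3 * (?K 1 p - 2 * ?K 2 p + ?K 3 p)" for p
  define C where "C p = ?K 1 p - ?K 2 p - 1 / 2 * D p" for p
  define P where "P p = ?K 1 p + C p - D p" for p
  have sK: "smooth_function A (?K i)" if "i > 0" for i
    by (rule riemannian_manifold.smooth_distribution_curvature[OF riemannian_contact_metric plane])
      (use that smooth_function_const in auto)
  have sD: "smooth_function A D" unfolding D_def[abs_def]
    by (intro smooth_function_mult smooth_function_add smooth_function_diff smooth_function_const sK) auto
  have sC: "smooth_function A C" unfolding C_def[abs_def]
    by (intro smooth_function_mult smooth_function_diff smooth_function_const sK sD) auto
  have sP: "smooth_function A P" unfolding P_def[abs_def]
    by (intro smooth_function_add smooth_function_diff sK sC sD) auto
  have CK: "C p > 0 \<and> (\<forall>L. smooth_function A L \<longrightarrow> (\<forall>q\<in>topspace M. L q > 0) \<longrightarrow>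
      distribution_curvature M A (contact_metric L) \<xi> p = P p - C p * L p + D p / L p)" if p: "p \<in> topspace M" for p
  proof -
    obtain P' C' D' where C': "C' > 0" and K: "\<And>L. smooth_function A L \<Longrightarrow> (\<forall>q\<in>topspace M. L q > 0) \<Longrightarrow>
       distribution_curvature M A (contact_metric L) \<xi> p = P' - C' * L p + D' / L p"
      using curvature_contact_metric[OF p] by blast
    have "?K i p = P' - C' * i + D' / i" if "i > 0" for i
      using K[OF smooth_function_const, of i] that by simp
    from this[of 1] this[of 2] this[of 3] have "D p = D'" "C p = C'" "P p = P'"
      by (simp_all add: D_def C_def P_def)
    then show ?thesis using C' K by simp
  qed
  obtain B where B: "\<And>p. p \<in> topspace M \<Longrightarrow> \<bar>P p\<bar> \<le> B" using smooth_function_bounded[OF sP] by blast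
  obtain B' where B': "\<And>p. p \<in> topspace M \<Longrightarrow> \<bar>C p * D p\<bar> \<le> B'"
    using smooth_function_bounded[OF smooth_function_mult[OF sC sD]] by blast
  have "smooth_function A (\<lambda>p. 1 / f p)"
    by (intro smooth_function_divide smooth_function_const f) (use neg in force)
  then obtain E where E: "\<And>p. p \<in> topspace M \<Longrightarrow> \<bar>1 / f p\<bar> \<le> E" using smooth_function_bounded by blast
  \<comment> \<open>\<open>E\<close> bounds 1 / |f|, hence - s f is at least |B| + 2 |B'| + 1. The
    absolute values and \<open>max\<close> ensure \<open>s > 0\<close> even if \<open>M\<close> is
    empty and the bounds carry no information.\<close>
  define s where "s = max 1 E * (\<bar>B\<bar> + 2 * \<bar>B'\<bar> + 1)"
  have s: "s > 0" unfolding s_def by (intro mult_pos_pos) auto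
  have big: "P p - s * f p > 0" "(P p - s * f p)\<^sup>2 + 4 * (C p * D p) > 0" if p: "p \<in> topspace M" for p
  proof -
    have "1 \<le> E * - f p" using E[OF p] neg[OF p] by (simp add: abs_if field_simps split: if_splits)
    also have "\<dots> \<le> max 1 E * - f p" using neg[OF p] by (intro mult_right_mono) auto
    finally have "(\<bar>B\<bar> + 2 * \<bar>B'\<bar> + 1) * 1 \<le> (\<bar>B\<bar> + 2 * \<bar>B'\<bar> + 1) * (max 1 E * - f p)"
      by (intro mult_left_mono) auto
    then have "\<bar>B\<bar> + 2 * \<bar>B'\<bar> + 1 \<le> - (s * f p)" by (simp add: s_def mult_ac)
    then have Q: "2 * \<bar>B'\<bar> + 1 \<le> P p - s * f p" using B[OF p] by linarith
    then show "P p - s * f p > 0" by linarith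
    \<comment> \<open>The margin 2 |B'| + 1 is chosen because its square exceeds 4 |B'|, which
      dominates 4 |C D|.\<close>
    have "(2 * \<bar>B'\<bar> + 1)\<^sup>2 \<le> (P p - s * f p)\<^sup>2" using Q by (intro power_mono) auto
    moreover have "(2 * \<bar>B'\<bar> + 1)\<^sup>2 = 4 * \<bar>B'\<bar>\<^sup>2 + 4 * \<bar>B'\<bar> + 1" by (simp add: power2_eq_square algebra_simps)
    moreover have "0 \<le> \<bar>B'\<bar>\<^sup>2" by simp
    ultimately show "(P p - s * f p)\<^sup>2 + 4 * (C p * D p) > 0" using B'[OF p] by linarith
  qed
  define L where "L p = (P p - s * f p + sqrt ((P p - s * f p)\<^sup>2 + 4 * (C p * D p))) / (2 * C p)" for p
  have sL: "smooth_function A L" unfolding L_def[abs_def] power2_eq_square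
    by (intro smooth_function_divide smooth_function_add smooth_function_sqrt smooth_function_diff
        smooth_function_mult smooth_function_const sP sC sD f) (use big CK in \<open>force simp: power2_eq_square\<close>)+
  have L: "L p > 0" "P p - C p * L p + D p / L p = s * f p" if "p \<in> topspace M" for p
    using quadratic_root[of "C p" "P p" "s * f p" "D p"] CK[OF that] big[OF that] by (simp_all add: L_def)
  interpret gL: riemannian_manifold M A "contact_metric L" by (rule riemannian_contact_metric[OF sL L(1)])
  note scale = gL.riemannian_scale[OF s] gL.distribution_curvature_scale[OF s plane]
  \<comment> \<open>The metric for \<open>L\<close> has curvature s f on \<xi>, and the factor
    \<open>s\<close> in front of it divides this by \<open>s\<close>.\<close>
  have "distribution_curvature M A (\<lambda>p u v. s * contact_metric L p u v) \<xi> p = f p" if p: "p \<in> topspace M" for p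
    using scale(2)[OF p] CK[OF p] sL L s p by simp
  then show ?thesis using scale(1) by blast
qed

theorem theorem4p1:
  fixes M :: "'a topology" and A :: "'a chart set"
    and \<xi> :: "'a distribution" and f :: "'a \<Rightarrow> real"
  assumes "closed_3_manifold M A"
    and "orientable M A"
    and "contact_structure M A \<xi>"
    and "transversally_orientable M A \<xi>"
    and "smooth_function A f"
    and "\<And>p. p \<in> topspace M \<Longrightarrow> f p < 0"
  shows "\<exists>g. riemannian_metric M A g \<and>
           (\<forall>p\<in>topspace M. distribution_curvature M A g \<xi> p = f p)"
proof -
  interpret closed_manifold M A
    using assms(1)
    by (intro closed_manifold.intro smooth_manifold.intro closed_manifold_axioms.intro)
      (simp_all add: closed_3_manifold_def smooth_3_manifold_def)
  obtain \<alpha> where \<alpha>: "smooth_1_form M A \<alpha>"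
    and kernel: "\<And>p. p \<in> topspace M \<Longrightarrow> \<xi> p = {v \<in> tangent_space A p. \<alpha> p v = 0}"
    using assms(4) unfolding transversally_orientable_def by blast
  have "\<exists>v\<in>tangent_space A p. \<alpha> p v \<noteq> 0" if p: "p \<in> topspace M" for p
  proof (rule ccontr)
    assume "\<not> ?thesis"
    then have "\<xi> p = tangent_space A p" using kernel[OF p] by blast
    moreover obtain u v where "\<xi> p = plane_of u v"
      using assms(3) p unfolding contact_structure_def plane_distribution_def by metis
    ultimately show False using tangent_space_not_plane[OF p] by metis
  qed
  then interpret nonvanishing_form M A \<alpha>
    by (intro nonvanishing_form.intro nonvanishing_form_axioms.intro closed_manifold_axioms \<alpha>)
  obtain R where R: "smooth_vfield_on A (topspace M) R" "\<forall>p\<in>topspace M. \<alpha> p (R p) = 1"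
    using ex_transverse_field by blast
  obtain k where k: "riemannian_metric M A k" using ex_riemannian_metric by blast
  interpret contact_manifold M A \<alpha> k \<xi> R
    using R(2) by (intro contact_manifold.intro contact_manifold_axioms.intro riemannian_manifold.intro
        riemannian_manifold_axioms.intro nonvanishing_form_axioms smooth_manifold_axioms k assms(3) kernel R(1)) auto
  show ?thesis by (rule ex_metric_with_curvature[OF assms(5,6)])
qed

end
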